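(* Let $\Gamma$ be a torsion-free closed surface group of genus at least two, realized as a discrete subgroup of $\mathsf{PSL}(2,\mathbb R)$ (so $\Lambda(\Gamma)=S^1$), let $n\ge1$, and let $\rho_1,\dots,\rho_n:\Gamma\to\mathsf{SL}(2,\mathbb R)$ be pairwise nonconjugate Fuchsian (discrete faithful) representations, $\rho_i(\gamma)=\begin{pmatrix}a_i(\gamma)&b_i(\gamma)\\c_i(\gamma)&d_i(\gamma)\end{pmatrix}$. Let $\rho:\Gamma\to\mathsf{Sp}(2n,\mathbb R)$ be $$\rho(\gamma)=\begin{pmatrix}\mathrm{diag}(a_i(\gamma))&\mathrm{diag}(b_i(\gamma))\\ \mathrm{diag}(c_i(\gamma))&\mathrm{diag}(d_i(\gamma))\end{pmatrix}.$$ Let $\alpha$ be the long simple root of $\mathfrak{sp}(2n,\mathbb R)$, $\xi^\alpha:\Lambda(\Gamma)\to\mathcal F_\alpha$ the positive limit map of $\rho$ (which is maximal, hence $\{\alpha\}$-positive), and $m_\alpha$ the arc-length (1-dimensional Hausdorff) measure on the rectifiable curve $\xi^\alpha(\Lambda(\Gamma))$ with respect to a Riemannian metric on $\mathcal F_\alpha$. Then $m_\alpha$ has exactly $n$ ergodic components under the action of $\rho(\Gamma)$.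
   Context: $\mathcal F_\alpha$ is the flag manifold of $\mathsf{Sp}(2n,\mathbb R)$ associated to the long simple root $\alpha$ (the Lagrangian Grassmannian), where $\alpha(\mathrm{diag}(\lambda_1,\dots,\lambda_n,-\lambda_1,\dots,-\lambda_n))=2\lambda_n$. The limit map $\xi^\alpha$ is the continuous $\rho$-equivariant map $\Lambda(\Gamma)\to\mathcal F_\alpha$ sending cyclically ordered tuples to positive (maximal) tuples.
   Formalization: Nonconjugate is taken up to sign and in GL(2,R), since twisting one representation by a sign character gives the same limit curve and fewer components; the Riemannian metric is fixed as the one induced by orthogonal projections (same null sets as any other). *)

theory Defs
  imports "HOL-Analysis.Analysis"
begin

section \<open>General linear-algebra helpers\<close>

text \<open>Action of a matrix on a subset (subspace) of the vector space: image under the linear map.\<close>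
definition act :: "real^'m^'m \<Rightarrow> (real^'m) set \<Rightarrow> (real^'m) set" where
  "act M L = (\<lambda>x. M *v x) ` L"

text \<open>Iterated matrix product g^m.\<close>
definition mpow :: "real^'m^'m \<Rightarrow> nat \<Rightarrow> real^'m^'m" where
  "mpow g m = (((**) g) ^^ m) (mat 1)"

text \<open>A set of matrices is discrete: every element is isolated.\<close>
definition discrete_set :: "('a::metric_space) set \<Rightarrow> bool" where
  "discrete_set S \<longleftrightarrow> (\<forall>x\<in>S. \<exists>e>0. \<forall>y\<in>S. y \<noteq> x \<longrightarrow> e \<le> dist y x)"

section \<open>The surface group Gamma inside PSL(2,R)\<close>

text \<open>A subgroup of PSL(2,R) is represented by its full preimage in SL(2,R)
  (a subgroup of SL(2,R) containing -I).  Torsion-free in PSL(2,R), discrete,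
  and cocompact (hence a closed surface group of genus at least 2, with limit set the whole circle).\<close>
definition surface_group :: "(real^2^2) set \<Rightarrow> bool" where
  "surface_group G \<longleftrightarrow>
     (\<forall>g\<in>G. det g = 1) \<and> mat 1 \<in> G \<and> - mat 1 \<in> G \<and>
     (\<forall>g\<in>G. \<forall>h\<in>G. g ** h \<in> G) \<and> (\<forall>g\<in>G. matrix_inv g \<in> G) \<and>
     discrete_set G \<and>
     (\<forall>g\<in>G. \<forall>m::nat. m > 0 \<and> (mpow g m = mat 1 \<or> mpow g m = - mat 1)
                 \<longrightarrow> (g = mat 1 \<or> g = - mat 1)) \<and>
     (\<exists>K. compact K \<and> (\<forall>h::real^2^2. det h = 1 \<longrightarrow> (\<exists>g\<in>G. \<exists>k\<in>K. h = g ** k)))"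

text \<open>A Fuchsian (discrete faithful) representation of the PSL(2,R)-subgroup represented by G
  into SL(2,R).  It is a function on the preimage G which is well defined on G/{+-I}.\<close>
definition fuchsian_rep :: "(real^2^2) set \<Rightarrow> (real^2^2 \<Rightarrow> real^2^2) \<Rightarrow> bool" where
  "fuchsian_rep G r \<longleftrightarrow>
     (\<forall>g\<in>G. r (- g) = r g) \<and>
     (\<forall>g\<in>G. \<forall>h\<in>G. r (g ** h) = r g ** r h) \<and>
     (\<forall>g\<in>G. det (r g) = 1) \<and>
     (\<forall>g\<in>G. \<forall>h\<in>G. r g = r h \<longrightarrow> (g = h \<or> g = - h)) \<and>
     discrete_set (r ` G)"

text \<open>Conjugacy of two representations (as projective representations, i.e. up to sign).\<close>
definition proj_conj :: "(real^2^2) set \<Rightarrow> (real^2^2 \<Rightarrow> real^2^2) \<Rightarrow> (real^2^2 \<Rightarrow> real^2^2) \<Rightarrow> bool" where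
  "proj_conj G r s \<longleftrightarrow>
     (\<exists>c::real^2^2. invertible c \<and>
        (\<forall>g\<in>G. s g = c ** r g ** matrix_inv c \<or> s g = - (c ** r g ** matrix_inv c)))"

section \<open>The representation rho into Sp(2n,R)\<close>

text \<open>R^{2n} is indexed by 'n + 'n: Inl i is the i-th coordinate of the first block, Inr i of the second.\<close>
definition rho_diag :: "('n::finite \<Rightarrow> real^2^2 \<Rightarrow> real^2^2) \<Rightarrow> real^2^2 \<Rightarrow> real^('n + 'n)^('n + 'n)" where
  "rho_diag rs g = (\<chi> r s. case (r, s) of
       (Inl i, Inl j) \<Rightarrow> if i = j then rs i g $ 1 $ 1 else 0
     | (Inl i, Inr j) \<Rightarrow> if i = j then rs i g $ 1 $ 2 else 0
     | (Inr i, Inl j) \<Rightarrow> if i = j then rs i g $ 2 $ 1 else 0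
     | (Inr i, Inr j) \<Rightarrow> if i = j then rs i g $ 2 $ 2 else 0)"

text \<open>Standard symplectic form on R^{2n}.\<close>
definition symp :: "real^('n::finite + 'n) \<Rightarrow> real^('n + 'n) \<Rightarrow> real" where
  "symp x y = (\<Sum>i\<in>UNIV. x $ Inl i * y $ Inr i - x $ Inr i * y $ Inl i)"

text \<open>The flag manifold F_alpha: the Lagrangian Grassmannian.\<close>
definition Lag :: "(real^('n::finite + 'n)) set set" where
  "Lag = {L. subspace L \<and> dim L = CARD('n) \<and> (\<forall>x\<in>L. \<forall>y\<in>L. symp x y = 0)}"

definition transverse :: "('a::real_vector) set \<Rightarrow> 'a set \<Rightarrow> bool" where
  "transverse L M \<longleftrightarrow> L \<inter> M = {0}"

text \<open>Maximal (positive) triple of Lagrangians: pairwise transverse and the quadratic form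
  v \<mapsto> omega(a, c) on L2, where v = a + c with a in L1, c in L3, is definite.\<close>
definition maslov_form :: "(real^('n::finite + 'n)) set \<Rightarrow> (real^('n + 'n)) set \<Rightarrow> real^('n + 'n) \<Rightarrow> real" where
  "maslov_form L1 L3 v = (let a = (THE a. a \<in> L1 \<and> v - a \<in> L3) in symp a (v - a))"

definition maximal_triple :: "(real^('n::finite + 'n)) set \<Rightarrow> (real^('n + 'n)) set \<Rightarrow> (real^('n + 'n)) set \<Rightarrow> bool" where
  "maximal_triple L1 L2 L3 \<longleftrightarrow>
     transverse L1 L2 \<and> transverse L2 L3 \<and> transverse L1 L3 \<and>
     ((\<forall>v\<in>L2. v \<noteq> 0 \<longrightarrow> maslov_form L1 L3 v > 0) \<or>
      (\<forall>v\<in>L2. v \<noteq> 0 \<longrightarrow> maslov_form L1 L3 v < 0))"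

section \<open>The circle S^1 = boundary of H^2 = RP^1\<close>

definition RP1 :: "(real^2) set set" where
  "RP1 = {L. subspace L \<and> dim L = 1}"

definition line_at :: "real \<Rightarrow> (real^2) set" where
  "line_at t = span {vector [cos t, sin t]}"

definition det2 :: "real^2 \<Rightarrow> real^2 \<Rightarrow> real" where
  "det2 u v = u $ 1 * v $ 2 - u $ 2 * v $ 1"

text \<open>(L1, L2, L3) is positively cyclically ordered on RP^1 (in particular pairwise distinct).\<close>
definition cyc_pos :: "(real^2) set \<Rightarrow> (real^2) set \<Rightarrow> (real^2) set \<Rightarrow> bool" where
  "cyc_pos L1 L2 L3 \<longleftrightarrow> (\<exists>v1 v2 v3. v1 \<in> L1 \<and> v2 \<in> L2 \<and> v3 \<in> L3 \<and>
       det2 v1 v2 * det2 v2 v3 * det2 v3 v1 < 0)"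

section \<open>Topology / metric on the Lagrangian Grassmannian\<close>

text \<open>Embedding of a subspace as its orthogonal projection matrix; the induced (Frobenius)
  distance is the chordal distance of an O(2n)-invariant Riemannian metric.\<close>
definition orthproj :: "(real^'m) set \<Rightarrow> real^'m^'m" where
  "orthproj L = matrix (\<lambda>x. THE y. y \<in> L \<and> (\<forall>z\<in>L. inner (x - y) z = 0))"

text \<open>The positive limit map of rho: continuous, equivariant, positive.\<close>
definition positive_limit_map ::
  "(real^2^2) set \<Rightarrow> (real^2^2 \<Rightarrow> real^('n::finite + 'n)^('n + 'n)) \<Rightarrow> ((real^2) set \<Rightarrow> (real^('n + 'n)) set) \<Rightarrow> bool" where
  "positive_limit_map G r xi \<longleftrightarrow>
     (\<forall>L\<in>RP1. xi L \<in> Lag) \<and>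
     continuous_on UNIV (\<lambda>t. orthproj (xi (line_at t))) \<and>
     (\<forall>g\<in>G. \<forall>L\<in>RP1. xi (act g L) = act (r g) (xi L)) \<and>
     (\<forall>L1\<in>RP1. \<forall>L2\<in>RP1. \<forall>L3\<in>RP1. cyc_pos L1 L2 L3 \<longrightarrow> maximal_triple (xi L1) (xi L2) (xi L3))"

section \<open>Hausdorff measure and ergodic components\<close>

definition hausdorff1 :: "('a::metric_space) set \<Rightarrow> ennreal" where
  "hausdorff1 A = (SUP d\<in>{0<..}. INF U\<in>{U :: nat \<Rightarrow> 'a set. A \<subseteq> (\<Union>i. U i) \<and>
        (\<forall>i. bounded (U i) \<and> diameter (U i) \<le> d)}. (\<Sum>i. ennreal (diameter (U i))))"

text \<open>Arc-length measure m_alpha on the curve C (as a set of Lagrangians), and its measurable sets.\<close>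
definition lag_measure :: "(real^('n::finite + 'n)) set set \<Rightarrow> (real^('n + 'n)) set set \<Rightarrow> ennreal" where
  "lag_measure C A = hausdorff1 (orthproj ` (A \<inter> C))"

definition lag_sets :: "(real^('n::finite + 'n)) set set \<Rightarrow> (real^('n + 'n)) set set set" where
  "lag_sets C = {A. A \<subseteq> C \<and> orthproj ` A \<in> sets borel}"

text \<open>mu restricted to X has exactly k ergodic components under the maps T:
  X splits (up to a null set) into k disjoint invariant measurable sets of positive measure,
  on each of which the action is ergodic.\<close>
definition ergodic_components ::
  "('x set \<Rightarrow> ennreal) \<Rightarrow> 'x set set \<Rightarrow> 'x set \<Rightarrow> ('x \<Rightarrow> 'x) set \<Rightarrow> nat \<Rightarrow> bool" where
  "ergodic_components mu M X T k \<longleftrightarrow>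
     (\<exists>E :: nat \<Rightarrow> 'x set.
        (\<forall>i<k. E i \<in> M \<and> E i \<subseteq> X \<and> (\<forall>t\<in>T. t ` E i = E i) \<and> mu (E i) > 0 \<and>
              (\<forall>A\<in>M. A \<subseteq> E i \<and> (\<forall>t\<in>T. t ` A = A) \<longrightarrow> mu A = 0 \<or> mu (E i - A) = 0)) \<and>
        (\<forall>i<k. \<forall>j<k. i \<noteq> j \<longrightarrow> E i \<inter> E j = {}) \<and>
        mu (X - (\<Union>i<k. E i)) = 0)"

end

theory Submission
  imports Defs "HOL-Analysis.Analysis"
begin

text \<open>
  The limit map splits: if \<open>x, y\<close> lie in \<open>\<xi>(t)\<close>, let \<open>r\<close> tend to \<open>t\<close> and decompose \<open>x, y\<close> along
  \<open>\<xi>(r) \<oplus> \<xi>(s)\<close>; the Maslov form of \<open>(\<xi>(r), \<xi>(t), \<xi>(s))\<close> on \<open>x\<close> and \<open>y\<close> tends to 0, but cocompactness of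
  \<open>\<Gamma>\<close> on triples makes it dominate (up to \<open>\<Gamma>\<close>) the square of the norm, and therefore the \<open>\<Gamma>\<close>-invariant
  numbers \<open>\<omega>\<^sub>i(x, y)\<close> given by the individual \<open>2 \<times> 2\<close> blocks vanish. So \<open>\<xi> = \<xi>\<^sub>1 \<oplus> \<dots> \<oplus> \<xi>\<^sub>n\<close> with equivariant
  circle homeomorphisms \<open>\<xi>\<^sub>i\<close>, which in affine charts are increasing bijections \<open>F\<^sub>i\<close> of the line, and each
  \<open>\<rho>\<^sub>i(\<Gamma>)\<close> is again cocompact. The arc length of a piece of the curve vanishes iff all its images under the
  \<open>F\<^sub>i\<close> are Lebesgue null.

  Each \<open>\<rho>\<^sub>i(\<Gamma>)\<close> is ergodic on the line: blow up an interval on which an invariant set is almost full. The pullbacks of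
  Lebesgue measure by \<open>F\<^sub>i\<close> and \<open>F\<^sub>j\<close> are mutually singular for \<open>i \<noteq> j\<close>: otherwise both maps are almost
  affine on suitable intervals in the parameter \<open>F\<^sub>i + F\<^sub>j\<close>, and blowing up shows that \<open>F\<^sub>j \<circ> F\<^sub>i\<^sup>-\<^sup>1\<close> preserves cross
  ratios, so \<open>\<rho>\<^sub>i\<close> and \<open>\<rho>\<^sub>j\<close> are conjugate. The supports of the \<open>n\<close> pullback measures are the components.
\<close>

section \<open>Open sets and outer measure on the line\<close>

text \<open>One renormalisation serves three times: for the splitting, for ergodicity and for
  rigidity. A zoom at an arbitrarily small scale is a matrix of determinant 1, and cocompactness
  writes it as a group element times a matrix from a bounded set; so, up to the group, the picture
  at every scale belongs to one compact family. The obstacle is that the boundary maps are mere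
  homeomorphisms: there is no derivative to blow up, and different \<open>F i\<close> turn out to be
  mutually singular. For two of them the sum is a parameter in which both are 1-Lipschitz and so
  have densities, and intervals on which a set is almost full take the place of density points. Each
  \<open>rs i\<close> is given as discrete and faithful only; its cocompactness comes from the
  equivariant circle map, because a matrix of determinant 1 is bounded as soon as it sends three
  standard lines to lines that stay uniformly apart. The directions of the splitting are chosen up
  to sign, so continuity is stated for products of their coordinates, which are the entries of
  orthogonal projections.\<close>

lemma open_real_disjoint_intervals:
  fixes U :: "real set"
  assumes "open U" "emeasure lborel U < \<infinity>"
  obtains a b :: "nat \<Rightarrow> real"
  where "\<And>n. a n \<le> b n" "disjoint_family (\<lambda>n. {a n<..<b n})" "(\<Union>n. {a n<..<b n}) = U"
    "(\<Sum>n. ennreal (b n - a n)) = emeasure lborel U"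
proof -
  define D where "D = components U"
  have opn: "open I" if "I \<in> D" for I using that assms(1) open_components D_def by blast
  have pw: "pairwise disjnt D"
    unfolding D_def using pairwise_disjoint_components[of U] by (simp add: pairwise_def disjnt_def)
  have cD: "countable D" by (rule countable_disjoint_open_subsets[OF opn pw])
  have int: "\<exists>a b. a \<le> b \<and> I = {a<..<b}" if I: "I \<in> D" for I
  proof -
    have sub: "I \<subseteq> U" using I D_def in_components_subset by blast
    have "emeasure lborel I \<le> emeasure lborel U"
      by (rule emeasure_mono[OF sub]) (use assms in auto)
    with assms(2) have fin: "emeasure lborel I < \<infinity>" by (rule le_less_trans[rotated])
    have ne: "I \<noteq> {}" using I D_def in_components_nonempty by blast
    have con: "connected I" using I D_def in_components_connected by blast
    have op: "open I" using opn I by blast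
    have ivl: "z \<in> I" if "u \<in> I" "v \<in> I" "u \<le> z" "z \<le> v" for u v z
      using con that unfolding connected_iff_interval by blast
    \<comment> \<open>An unbounded interval contains segments of every length, against its finite
      measure.\<close>
    have bnd: "bounded I"
    proof (rule ccontr)
      assume "\<not> bounded I"
      obtain y where y: "y \<in> I" using ne by blast
      define M where "M = measure lborel I"
      have M: "emeasure lborel I = ennreal M" "M \<ge> 0"
        using fin M_def by (auto simp: emeasure_eq_ennreal_measure)
      obtain x where x: "x \<in> I" "norm x > \<bar>y\<bar> + M + 1"
        using \<open>\<not> bounded I\<close> unfolding bounded_iff by (metis not_le)
      have s: "{min x y..max x y} \<subseteq> I"
      proof
        fix z assume z: "z \<in> {min x y..max x y}"
        have "min x y \<in> I" "max x y \<in> I" using x(1) y by (auto simp: min_def max_def)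
        then show "z \<in> I" by (rule ivl) (use z in auto)
      qed
      have "emeasure lborel {min x y..max x y} \<le> emeasure lborel I"
        by (rule emeasure_mono[OF s]) (use op in auto)
      then have "max x y - min x y \<le> M" using M by (simp add: emeasure_lborel_Icc_eq split: if_splits)
      then show False using x(2) M(2) by (simp add: min_def max_def abs_if split: if_splits)
    qed
    have bb: "bdd_above I" "bdd_below I" using bnd by (auto simp: bounded_imp_bdd_above bounded_imp_bdd_below)
    have "I = {Inf I<..<Sup I}"
    proof (intro set_eqI iffI)
      fix x assume x: "x \<in> I"
      then obtain e where e: "e > 0" "ball x e \<subseteq> I" using op open_contains_ball by blast
      have "x + e/2 \<in> I" "x - e/2 \<in> I" using e by (auto simp: dist_real_def subset_iff)
      then have "x + e/2 \<le> Sup I" "Inf I \<le> x - e/2" using bb by (auto intro: cSup_upper cInf_lower)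
      then show "x \<in> {Inf I<..<Sup I}" using e by auto
    next
      fix x assume x: "x \<in> {Inf I<..<Sup I}"
      then obtain u v where "u \<in> I" "u < x" "v \<in> I" "x < v"
        using ne bb by (metis greaterThanLessThan_iff cInf_less_iff less_cSup_iff)
      then show "x \<in> I" by (intro ivl[of u v x]) auto
    qed
    moreover have "Inf I \<le> Sup I" using ne bb by (simp add: cInf_le_cSup)
    ultimately show ?thesis by blast
  qed
  \<comment> \<open>Indices outside the range of the enumeration get the empty set, so finitely many
    components also form a sequence.\<close>
  define A where "A n = (if n \<in> to_nat_on D ` D then from_nat_into D n else {})" for n
  have A1: "\<exists>a b. a \<le> b \<and> A n = {a<..<b}" for n
  proof (cases "n \<in> to_nat_on D ` D")
    case True
    then have "A n \<in> D" using cD by (auto simp: A_def)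
    then show ?thesis using int by blast
  next
    case False
    then show ?thesis by (intro exI[of _ 0]) (auto simp: A_def)
  qed
  then obtain a b where ab: "\<And>n. a n \<le> b n" "\<And>n. A n = {a n<..<b n}" by metis
  have dj: "disjoint_family A"
    unfolding disjoint_family_on_def
  proof (intro ballI impI)
    fix m n :: nat assume mn: "m \<noteq> n"
    show "A m \<inter> A n = {}"
    proof (cases "m \<in> to_nat_on D ` D \<and> n \<in> to_nat_on D ` D")
      case True
      then obtain S T where "S \<in> D" "T \<in> D" "m = to_nat_on D S" "n = to_nat_on D T" by blast
      then show ?thesis using mn cD pw by (auto simp: A_def pairwise_def disjnt_def)
    qed (auto simp: A_def)
  qed
  have un: "(\<Union>n. A n) = U"
  proof -
    have "(\<Union>n. A n) = \<Union>D" using cD by (auto simp: A_def split: if_splits)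
    then show ?thesis using D_def by simp
  qed
  have "(\<Sum>n. emeasure lborel (A n)) = emeasure lborel (\<Union>n. A n)"
    by (rule suminf_emeasure[OF _ dj]) (auto simp: ab)
  then have sm: "(\<Sum>n. ennreal (b n - a n)) = emeasure lborel U"
    using ab un by simp
  show ?thesis
    by (rule that[OF ab(1) dj[unfolded ab(2)] un[unfolded ab(2)] sm])
qed

lemma outer_open_lborel:
  fixes X :: "real set"
  assumes "X \<in> sets borel" "emeasure lborel X < ennreal m"
  obtains U where "open U" "X \<subseteq> U" "emeasure lborel U < ennreal m"
proof -
  obtain r where r: "emeasure lborel X = ennreal r" "r \<ge> 0"
    using assms(2) by (cases "emeasure lborel X") auto
  have rm: "r < m" using assms(2) r by (simp add: ennreal_less_iff)
  obtain U where U: "open U" "X \<subseteq> U" "emeasure lborel (U - X) < ennreal (m - r)"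
    using outer_regular_lborel[OF assms(1), of "m - r"] rm by auto
  have "emeasure lborel U \<le> emeasure lborel X + emeasure lborel (U - X)"
    using emeasure_subadditive[of X lborel "U - X"] assms(1) U by (simp add: Un_absorb1)
  also have "\<dots> < ennreal r + ennreal (m - r)"
    using U(3) r by (simp add: ennreal_add_left_cancel_less)
  also have "\<dots> = ennreal m" using r rm by (simp flip: ennreal_plus)
  finally show ?thesis using that U by blast
qed

lemma countable_interval_cover_measure:
  fixes c r :: "nat \<Rightarrow> real"
  assumes "\<And>n. r n \<ge> 0" "(\<Sum>n. ennreal (r n)) \<le> ennreal m" "m \<ge> 0"
  shows "emeasure lborel (\<Union>n. {c n - r n..c n + r n}) \<le> ennreal (2 * m)"
proof -
  have "emeasure lborel (\<Union>n. {c n - r n..c n + r n}) \<le> (\<Sum>n. emeasure lborel {c n - r n..c n + r n})"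
    by (rule emeasure_subadditive_countably) auto
  also have "\<dots> = (\<Sum>n. ennreal 2 * ennreal (r n))"
    using assms(1) by (intro suminf_cong) (simp add: ennreal_mult)
  also have "\<dots> = ennreal 2 * (\<Sum>n. ennreal (r n))" by (rule ennreal_suminf_cmult)
  also have "\<dots> \<le> ennreal 2 * ennreal m" using assms(2) by (rule mult_left_mono) simp
  finally show ?thesis by (simp add: ennreal_mult assms(3))
qed

lemma lipschitz_image_cover:
  fixes f :: "real \<Rightarrow> real"
  assumes X: "X \<in> sets borel" "emeasure lborel X < ennreal m" and L: "L \<ge> 0" and m: "m \<ge> 0"
    and lip: "\<And>x y. x \<in> X \<Longrightarrow> y \<in> X \<Longrightarrow> \<bar>f x - f y\<bar> \<le> L * \<bar>x - y\<bar>"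
  obtains T where "T \<in> sets borel" "f ` X \<subseteq> T" "emeasure lborel T \<le> ennreal (2 * (L * m))"
proof -
  obtain U where U: "open U" "X \<subseteq> U" "emeasure lborel U < ennreal m"
    using outer_open_lborel[OF X] by blast
  then have "emeasure lborel U < \<infinity>" using less_trans by fastforce
  then obtain a b :: "nat \<Rightarrow> real"
    where ab: "\<And>n. a n \<le> b n" "disjoint_family (\<lambda>n. {a n<..<b n})" "(\<Union>n. {a n<..<b n}) = U"
    "(\<Sum>n. ennreal (b n - a n)) = emeasure lborel U"
    using open_real_disjoint_intervals[OF U(1)] by blast
  \<comment> \<open>For an interval that misses \<open>X\<close> the choice is arbitrary, which only
    makes \<open>T\<close> larger within the same bound.\<close>
  define c where "c n = f (SOME x. x \<in> X \<inter> {a n<..<b n})" for n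
  define T where "T = (\<Union>n. {c n - L * (b n - a n)..c n + L * (b n - a n)})"
  have "f ` X \<subseteq> T"
  proof
    fix y assume "y \<in> f ` X"
    then obtain x where x: "x \<in> X" "y = f x" by blast
    then obtain n where n: "x \<in> {a n<..<b n}" using U ab(3) by blast
    define x0 where "x0 = (SOME x. x \<in> X \<inter> {a n<..<b n})"
    have x0: "x0 \<in> X \<inter> {a n<..<b n}" unfolding x0_def by (rule someI[of _ x]) (use x n in auto)
    have "\<bar>f x - f x0\<bar> \<le> L * \<bar>x - x0\<bar>" using lip x x0 by auto
    also have "\<dots> \<le> L * (b n - a n)" using x0 n L by (intro mult_left_mono) auto
    finally have "y \<in> {c n - L * (b n - a n)..c n + L * (b n - a n)}"
      unfolding c_def x0_def[symmetric] x(2) by (auto simp: abs_le_iff)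
    then show "y \<in> T" unfolding T_def by blast
  qed
  moreover have "emeasure lborel T \<le> ennreal (2 * (L * m))"
    unfolding T_def
  proof (rule countable_interval_cover_measure)
    show "L * (b n - a n) \<ge> 0" for n using L ab(1) by simp
    show "L * m \<ge> 0" using L m by simp
    have "(\<Sum>n. ennreal (L * (b n - a n))) = ennreal L * emeasure lborel U"
      using L ab(1) by (simp add: ennreal_mult ab(4)[symmetric])
    also have "\<dots> \<le> ennreal L * ennreal m" using U(3) by (intro mult_left_mono) auto
    finally show "(\<Sum>n. ennreal (L * (b n - a n))) \<le> ennreal (L * m)" using L m by (simp add: ennreal_mult)
  qed
  moreover have "T \<in> sets borel" unfolding T_def by auto
  ultimately show ?thesis using that by blast
qed

text \<open>A weak form of the density theorem. Take an open \<open>U\<close> around a bounded part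
  of \<open>A\<close> of measure \<open>r\<close> whose excess is below \<open>e * r\<close>. If
  every component of \<open>U\<close> missed that part in proportion at least \<open>e\<close>, the
  sum over the components would exceed this excess.\<close>

lemma dense_interval:
  fixes A :: "real set"
  assumes A: "A \<in> sets borel" "emeasure lborel A > 0" and e: "(e::real) > 0"
  obtains a b where "a < b" "emeasure lborel ({a<..<b} - A) \<le> ennreal (e * (b - a))"
proof -
  obtain n :: nat where n: "emeasure lborel (A \<inter> {-real n..real n}) > 0"
  proof (rule ccontr)
    assume "\<not> thesis"
    then have z: "emeasure lborel (A \<inter> {-real n..real n}) = 0" for n using that not_gr_zero by blast
    have "A = (\<Union>n. A \<inter> {-real n..real n})"
    proof (intro set_eqI iffI)
      fix x assume "x \<in> A"
      obtain k :: nat where "\<bar>x\<bar> \<le> real k" using real_arch_simple by blast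
      then show "x \<in> (\<Union>n. A \<inter> {-real n..real n})" using \<open>x \<in> A\<close> by (auto simp: abs_le_iff intro!: exI[of _ k])
    qed auto
    also have "emeasure lborel \<dots> = 0" using z A(1) by (intro emeasure_UN_eq_0) auto
    finally show False using A(2) by simp
  qed
  define A' where "A' = A \<inter> {-real n..real n}"
  have A'b: "A' \<in> sets borel" using A(1) A'_def by auto
  have "emeasure lborel A' \<le> emeasure lborel {-real n..real n}" unfolding A'_def by (rule emeasure_mono) auto
  also have "\<dots> < \<infinity>" by simp
  finally have fin: "emeasure lborel A' < \<infinity>" .
  then obtain r where r: "emeasure lborel A' = ennreal r" "r \<ge> 0" by (cases "emeasure lborel A'") auto
  have r0: "r > 0" using n[folded A'_def] r by simp
  obtain U where U: "open U" "A' \<subseteq> U" "emeasure lborel (U - A') < ennreal (e * r)"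
    using outer_regular_lborel[OF A'b, of "e * r"] e r0 by auto
  have "emeasure lborel U \<le> emeasure lborel A' + emeasure lborel (U - A')"
    using emeasure_subadditive[of A' lborel "U - A'"] A'b U by (simp add: Un_absorb1)
  also have "\<dots> < \<infinity>" using fin U(3) by (auto simp: less_top[symmetric] top_unique)
  finally have Ufin: "emeasure lborel U < \<infinity>" .
  obtain a b :: "nat \<Rightarrow> real"
    where ab: "\<And>n. a n \<le> b n" "disjoint_family (\<lambda>n. {a n<..<b n})" "(\<Union>n. {a n<..<b n}) = U"
    "(\<Sum>n. ennreal (b n - a n)) = emeasure lborel U"
    using open_real_disjoint_intervals[OF U(1) Ufin] by blast
  have "\<exists>n. a n < b n \<and> emeasure lborel ({a n<..<b n} - A') \<le> ennreal (e * (b n - a n))"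
  proof (rule ccontr)
    assume con: "\<not> ?thesis"
    have ge: "ennreal (e * (b n - a n)) \<le> emeasure lborel ({a n<..<b n} - A')" for n
    proof (cases "a n < b n")
      case True
      then show ?thesis using con by (auto simp: not_le intro: less_imp_le)
    next
      case False
      then have "a n = b n" using ab(1) by (simp add: order_class.order_eq_iff)
      then show ?thesis by simp
    qed
    have "ennreal (e * r) = ennreal e * emeasure lborel A'" using r e by (simp add: ennreal_mult)
    also have "\<dots> \<le> ennreal e * emeasure lborel U" using U by (intro mult_left_mono emeasure_mono) auto
    also have "\<dots> = (\<Sum>n. ennreal (e * (b n - a n)))" using e ab(1) by (simp add: ennreal_mult ab(4)[symmetric])
    also have "\<dots> \<le> (\<Sum>n. emeasure lborel ({a n<..<b n} - A'))" by (intro suminf_le ge) auto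
    also have "\<dots> = emeasure lborel (\<Union>n. {a n<..<b n} - A')"
      proof (rule suminf_emeasure)
      show "disjoint_family (\<lambda>n. {a n<..<b n} - A')"
        by (rule disjoint_family_on_bisimulation[OF ab(2)]) blast
    qed (use A'b in auto)
    also have "(\<Union>n. {a n<..<b n} - A') = U - A'" using ab(3) by blast
    finally show False using U(3) by simp
  qed
  then obtain k where k: "a k < b k" "emeasure lborel ({a k<..<b k} - A') \<le> ennreal (e * (b k - a k))" by blast
  have "emeasure lborel ({a k<..<b k} - A) \<le> emeasure lborel ({a k<..<b k} - A')"
    unfolding A'_def using A by (intro emeasure_mono) auto
  then show ?thesis using that k order_trans by blast
qed

section \<open>Moebius maps and ergodicity of cocompact groups\<close>

definition mat2 :: "real \<Rightarrow> real \<Rightarrow> real \<Rightarrow> real \<Rightarrow> real^2^2" where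
  "mat2 a b c d = vector [vector [a, b], vector [c, d]]"

lemma mat2_nth [simp]:
  "mat2 a b c d $ 1 $ 1 = a" "mat2 a b c d $ 1 $ 2 = b"
  "mat2 a b c d $ 2 $ 1 = c" "mat2 a b c d $ 2 $ 2 = d"
  by (simp_all add: mat2_def)

lemma det_mat2 [simp]: "det (mat2 a b c d) = a * d - b * c"
  by (simp add: det_2)

lemma mat2_eq_iff: "M = mat2 a b c d \<longleftrightarrow> M$1$1 = a \<and> M$1$2 = b \<and> M$2$1 = c \<and> M$2$2 = d"
  by (auto simp: vec_eq_iff forall_2)

lemma matrix_mul_2_nth: "((A::real^2^2) ** B) $ i $ j = A$i$1 * B$1$j + A$i$2 * B$2$j"
  by (simp add: matrix_matrix_mult_def sum_2)

text \<open>At the pole the value is the junk value 0, so every use carries a nonvanishing denominator.\<close>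
definition mob :: "real^2^2 \<Rightarrow> real \<Rightarrow> real" where
  "mob M x = (M$1$1 * x + M$1$2) / (M$2$1 * x + M$2$2)"

text \<open>The first identity is the cocycle rule for denominators: away from the pole of
  \<open>B\<close>, the product has a pole at \<open>x\<close> exactly when \<open>A\<close> has one
  at \<open>mob B x\<close>.\<close>

lemma mob_mult:
  assumes "B$2$1 * x + B$2$2 \<noteq> 0"
  shows "(A ** B)$2$1 * x + (A ** B)$2$2 = (A$2$1 * mob B x + A$2$2) * (B$2$1 * x + B$2$2)"
    and "mob (A ** B) x = mob A (mob B x)"
proof -
  let ?d = "B$2$1 * x + B$2$2"
  have 1: "(A ** B)$i$1 * x + (A ** B)$i$2 = (A$i$1 * mob B x + A$i$2) * ?d" for i
    unfolding mob_def matrix_mul_2_nth using assms by (simp add: field_simps)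
  show "(A ** B)$2$1 * x + (A ** B)$2$2 = (A$2$1 * mob B x + A$2$2) * ?d" by (rule 1)
  show "mob (A ** B) x = mob A (mob B x)"
    unfolding mob_def[of "A ** B"] mob_def[of A] 1 using assms by simp
qed

text \<open>Source of both the Lipschitz bounds and the invariance of cross ratios, in which every
  denominator cancels.\<close>

lemma mob_diff:
  assumes "det M = 1" "M$2$1 * x + M$2$2 \<noteq> 0" "M$2$1 * y + M$2$2 \<noteq> 0"
  shows "mob M x - mob M y = (x - y) / ((M$2$1 * x + M$2$2) * (M$2$1 * y + M$2$2))"
proof -
  have d: "M$1$1 * M$2$2 = 1 + M$1$2 * M$2$1" using assms(1) by (simp add: det_2)
  have "(M$1$1 * x + M$1$2) * (M$2$1 * y + M$2$2) - (M$1$1 * y + M$1$2) * (M$2$1 * x + M$2$2)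
      = (M$1$1 * M$2$2 - M$1$2 * M$2$1) * (x - y)" by (simp add: algebra_simps)
  also have "\<dots> = x - y" using d by simp
  finally show ?thesis using assms(2,3) unfolding mob_def by (simp add: diff_frac_eq)
qed

lemma negligible_borel_iff: "B \<in> sets borel \<Longrightarrow> negligible B \<longleftrightarrow> emeasure lborel B = 0"
  for B :: "'a::euclidean_space set"
  by (simp add: negligible_iff_emeasure0 emeasure_completion)

lemma negligible_emeasureI:
  fixes X :: "'a::euclidean_space set"
  assumes "\<And>e. e > 0 \<Longrightarrow> \<exists>T\<in>sets borel. X \<subseteq> T \<and> emeasure lborel T \<le> ennreal e"
  shows "negligible X"
  unfolding negligible_outer_le
proof (intro allI impI)
  fix e :: real assume "e > 0"
  then obtain T where T: "T \<in> sets borel" "X \<subseteq> T" "emeasure lborel T \<le> ennreal e" using assms by blast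
  have e: "emeasure lebesgue T = emeasure lborel T" using T(1) by (simp add: emeasure_completion)
  have "T \<in> lmeasurable" using T e by (intro fmeasurableI) (auto intro: le_less_trans)
  moreover have "measure lebesgue T \<le> e"
    using T(3) e \<open>e > 0\<close> by (metis emeasure_eq_measure2 ennreal_le_iff less_imp_le calculation)
  ultimately show "\<exists>T. X \<subseteq> T \<and> T \<in> lmeasurable \<and> measure lebesgue T \<le> e" using T(2) by blast
qed

text \<open>\<open>a - c * x\<close> is the denominator of the inverse matrix at \<open>x\<close>.
  If \<open>c\<close> is above the threshold \<open>1 / (4 * C * (M+1))\<close>, the set lies within
  \<open>\<eta> / \<bar>c\<bar>\<close> of the pole \<open>a / c\<close>. Below the threshold,
  determinant 1 keeps \<open>a\<close> away from 0 and the set is empty.\<close>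

lemma small_denominator_interval:
  fixes a c x M C \<eta> :: real
  assumes C: "C > 0" and M: "M > 0" and ad: "a * d - b * c = 1"
    and bd: "\<bar>a\<bar> \<le> C" "\<bar>b\<bar> \<le> C" "\<bar>c\<bar> \<le> C" "\<bar>d\<bar> \<le> C" and eta: "0 < \<eta>" "\<eta> \<le> 1 / (2 * C)"
  shows "\<exists>p. {x. \<bar>x\<bar> \<le> M \<and> \<bar>a - c * x\<bar> < \<eta>} \<subseteq> {p - 4 * C * (M+1) * \<eta>..p + 4 * C * (M+1) * \<eta>}"
proof (cases "\<bar>c\<bar> \<ge> 1 / (4 * C * (M+1))")
  case True
  have K: "4 * C * (M+1) > 0" using C M by simp
  have c0: "c \<noteq> 0" using True K by (smt (verit) divide_pos_pos)
  have "1 / \<bar>c\<bar> \<le> 4 * C * (M+1)"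
    using True K c0 by (simp add: field_simps)
  then have b1: "\<eta> / \<bar>c\<bar> \<le> 4 * C * (M+1) * \<eta>" using eta by (metis mult.commute mult_left_mono less_imp_le times_divide_eq_right mult.right_neutral)
  have "\<bar>x - a / c\<bar> \<le> 4 * C * (M+1) * \<eta>" if "\<bar>a - c * x\<bar> < \<eta>" for x
  proof -
    have "a - c * x = - c * (x - a / c)" using c0 by (simp add: field_simps)
    then have "\<bar>c\<bar> * \<bar>x - a / c\<bar> < \<eta>" using that by (simp add: abs_mult)
    then have "\<bar>x - a / c\<bar> \<le> \<eta> / \<bar>c\<bar>" using c0 by (simp add: field_simps)
    then show ?thesis using b1 by linarith
  qed
  then show ?thesis by (intro exI[of _ "a / c"]) (auto simp: abs_le_iff algebra_simps)
next
  case False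
  have K: "4 * C * (M+1) > 0" using C M by simp
  have c1: "\<bar>c\<bar> * (M+1) * C < 1/4" using False K by (simp add: field_simps)
  have "1 \<le> \<bar>a * d\<bar> + \<bar>b * c\<bar>" using ad by linarith
  then have "1 \<le> \<bar>a\<bar> * \<bar>d\<bar> + \<bar>b\<bar> * \<bar>c\<bar>" by (simp only: abs_mult)
  also have "\<dots> \<le> \<bar>a\<bar> * C + C * \<bar>c\<bar>" using bd by (intro add_mono mult_mono) auto
  finally have a1: "1 \<le> (\<bar>a\<bar> + \<bar>c\<bar>) * C" by (simp add: algebra_simps)
  have "\<not> (\<bar>x\<bar> \<le> M \<and> \<bar>a - c * x\<bar> < \<eta>)" for x
  proof
    assume x: "\<bar>x\<bar> \<le> M \<and> \<bar>a - c * x\<bar> < \<eta>"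
    have "\<bar>a\<bar> \<le> \<eta> + \<bar>c * x\<bar>" using x by linarith
    then have "\<bar>a\<bar> \<le> \<eta> + \<bar>c\<bar> * \<bar>x\<bar>" by (simp only: abs_mult)
    also have "\<dots> \<le> \<eta> + \<bar>c\<bar> * M" using x by (simp add: mult_left_mono)
    finally have "(\<bar>a\<bar> + \<bar>c\<bar>) * C \<le> (\<eta> + \<bar>c\<bar> * (M+1)) * C" using C by (intro mult_right_mono) (auto simp: algebra_simps)
    also have "\<dots> = \<eta> * C + \<bar>c\<bar> * (M+1) * C" by (simp add: algebra_simps)
    also have "\<dots> < 1/2 + 1/4 + 1/8" using c1 eta C by (simp add: field_simps)
    finally show False using a1 by simp
  qed
  then show ?thesis by blast
qed

text \<open>If the complement of \<open>B\<close> is not null, it nearly fills some interval. The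
  affine map \<open>h\<close> from (-R, R) onto this interval factors as \<open>g ** c\<close> with
  \<open>c\<close> bounded, so \<open>g\<close> moves \<open>B \<inter> {-M..M}\<close>, up to a
  short interval around the pole of the inverse of \<open>c\<close>, into the few points of
  \<open>B\<close> there. Going back through \<open>h\<close> and \<open>c\<close> is Lipschitz with
  a controlled constant, so \<open>B \<inter> {-M..M}\<close> is small.\<close>

lemma cocompact_invariant_zero_one:
  fixes S :: "(real^2^2) set"
  assumes coc: "\<And>h. det h = 1 \<Longrightarrow> \<exists>g\<in>S. \<exists>c. det c = 1 \<and> (\<forall>i j. \<bar>c$i$j\<bar> \<le> C) \<and> h = g ** c"
    and B: "B \<in> sets borel"
    and inv: "\<And>g x. g \<in> S \<Longrightarrow> x \<in> B \<Longrightarrow> g$2$1 * x + g$2$2 \<noteq> 0 \<Longrightarrow> mob g x \<in> B"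
  shows "negligible B \<or> negligible (- B)"
proof (rule disjCI)
  assume "\<not> negligible (- B)"
  then have A: "-B \<in> sets borel" "emeasure lborel (-B) > 0"
    using B negligible_borel_iff[of "-B"] by (auto simp: zero_less_iff_neq_zero)
  obtain c1 :: "real^2^2" where c1: "det c1 = 1" "\<forall>i j. \<bar>c1$i$j\<bar> \<le> C" using coc[of "mat 1"] by (auto)
  have C: "C > 0"
  proof (rule ccontr)
    assume "\<not> C > 0"
    then have "c1$i$j = 0" for i j using c1(2) by (metis abs_le_zero_iff not_le order_trans)
    then show False using c1(1) by (simp add: det_2)
  qed
  have main: "negligible (B \<inter> {-M..M})" if M: "M > 0" for M
  proof (rule negligible_emeasureI)
    fix \<epsilon> :: real assume eps: "\<epsilon> > 0"
    \<comment> \<open>\<open>D\<close> bounds numerator and denominator of the inverse of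
      \<open>c\<close> on \<open>{-M..M}\<close>.\<close>
    define D where "D = C * (M + 1)"
    have D: "D > 0" using C M D_def by simp
    \<comment> \<open>Points at which the inverse of \<open>c\<close> has denominator below
      \<open>\<eta>\<close> are given up; the second bound makes them cost at most half of
      \<open>\<epsilon>\<close>.\<close>
    define \<eta> where "\<eta> = min (1 / (2 * C)) (\<epsilon> / (16 * D))"
    have eta: "0 < \<eta>" "\<eta> \<le> 1 / (2 * C)" "\<eta> \<le> \<epsilon> / (16 * D)" using C D eps by (auto simp: \<eta>_def)
    \<comment> \<open>The remaining points have preimages under \<open>c\<close> of size at most
      \<open>D / \<eta>\<close>, strictly inside (-R, R).\<close>
    define R where "R = 2 * D / \<eta>"
    have R: "R > 0" using D eta R_def by simp
    \<comment> \<open>The image of a set of measure below \<open>2 * e * (b - a)\<close> under a map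
      with Lipschitz constant \<open>D\<^sup>2 / l\<close> costs
      \<open>4 * e * (b - a) * D\<^sup>2 / l\<close>; since \<open>b - a = 2 * R * l\<close>, this
      is half of \<open>\<epsilon>\<close>.\<close>
    define e where "e = \<epsilon> / (16 * D\<^sup>2 * R)"
    have e: "e > 0" using eps D R e_def by simp
    obtain a b where ab: "a < b" "emeasure lborel ({a<..<b} - (-B)) \<le> ennreal (e * (b - a))"
      using dense_interval[OF A e] by blast
    define l where "l = (b - a) / (2 * R)"
    define m where "m = (a + b) / 2"
    have l: "l > 0" using ab R l_def by simp
    \<comment> \<open>The matrix of \<open>y \<mapsto> l * y + m\<close>, scaled to determinant
      1.\<close>
    define h where "h = mat2 (sqrt l) (m / sqrt l) 0 (1 / sqrt l)"
    have "det h = 1" using l by (simp add: h_def)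
    then obtain g c where g: "g \<in> S" and c: "det c = 1" "\<And>i j. \<bar>c$i$j\<bar> \<le> C" and hgc: "h = g ** c"
      using coc by blast
    \<comment> \<open>The denominator of \<open>c\<close> at a preimage of \<open>x\<close> is the
      reciprocal of \<open>c$1$1 - c$2$1 * x\<close>, which \<open>D\<close> bounds; hence the lower
      bound, and with it the Lipschitz constant of \<open>f\<close> on \<open>Z\<close>.\<close>
    define Z where "Z = {z \<in> B \<inter> {a<..<b}. 1 / D \<le> \<bar>c$2$1 * ((z - m) / l) + c$2$2\<bar>}"
    define f where "f z = mob c ((z - m) / l)" for z
    have Zb: "Z \<in> sets borel" unfolding Z_def using B by measurable
    have "emeasure lborel Z \<le> emeasure lborel ({a<..<b} - (-B))"
      unfolding Z_def using B by (intro emeasure_mono) auto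
    also have "\<dots> \<le> ennreal (e * (b - a))" by (rule ab)
    also have "\<dots> < ennreal (2 * e * (b - a))" using e ab by (intro ennreal_lessI) auto
    finally have Zm: "emeasure lborel Z < ennreal (2 * e * (b - a))" .
    have lip: "\<bar>f z - f z'\<bar> \<le> D\<^sup>2 / l * \<bar>z - z'\<bar>" if z: "z \<in> Z" "z' \<in> Z" for z z'
    proof -
      let ?p = "\<lambda>z. c$2$1 * ((z - m) / l) + c$2$2"
      have p: "1 / D \<le> \<bar>?p z\<bar>" "1 / D \<le> \<bar>?p z'\<bar>" using z by (auto simp: Z_def)
      have p0: "\<bar>?p z\<bar> > 0" "\<bar>?p z'\<bar> > 0" using p D by (smt (verit) divide_pos_pos)+
      have "f z - f z' = ((z - m) / l - (z' - m) / l) / (?p z * ?p z')"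
        unfolding f_def by (rule mob_diff[OF c(1)]) (use p0 in auto)
      also have "(z - m) / l - (z' - m) / l = (z - z') / l" by (simp add: diff_divide_distrib)
      finally have "\<bar>f z - f z'\<bar> = (\<bar>z - z'\<bar> / l) * (1 / \<bar>?p z\<bar> * (1 / \<bar>?p z'\<bar>))"
        using l by (simp add: abs_mult)
      also have "\<dots> \<le> (\<bar>z - z'\<bar> / l) * (D * D)"
      proof (intro mult_left_mono mult_mono)
        show "1 / \<bar>?p z\<bar> \<le> D" "1 / \<bar>?p z'\<bar> \<le> D" using p p0 D by (simp_all add: field_simps)
      qed (use l D in auto)
      finally show ?thesis by (simp add: power2_eq_square field_simps)
    qed
    obtain T where T: "T \<in> sets borel" "f ` Z \<subseteq> T" "emeasure lborel T \<le> ennreal (2 * (D\<^sup>2 / l * (2 * e * (b - a))))"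
      by (rule lipschitz_image_cover[OF Zb Zm _ _ lip]) (use l e ab in auto)
    have "2 * (D\<^sup>2 / l * (2 * e * (b - a))) = \<epsilon> / 2"
      unfolding l_def e_def using ab D R by (simp add: field_simps)
    then have Tm: "emeasure lborel T \<le> ennreal (\<epsilon> / 2)" using T(3) by (simp only:)
    obtain p where p: "{x. \<bar>x\<bar> \<le> M \<and> \<bar>c$1$1 - c$2$1 * x\<bar> < \<eta>} \<subseteq> {p - 4 * C * (M+1) * \<eta>..p + 4 * C * (M+1) * \<eta>}"
      using small_denominator_interval[OF C M, of "c$1$1" "c$2$2" "c$1$2" "c$2$1" \<eta>] c eta by (auto simp: det_2)
    define P where "P = {p - 4 * C * (M+1) * \<eta>..p + 4 * C * (M+1) * \<eta>}"
    have "8 * D * \<eta> \<le> \<epsilon> / 2" using eta(3) D by (simp add: field_simps)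
    then have PD: "(p + 4 * C * (M+1) * \<eta>) - (p - 4 * C * (M+1) * \<eta>) \<le> \<epsilon> / 2"
      unfolding D_def by (simp add: algebra_simps)
    have "p - 4 * C * (M+1) * \<eta> \<le> p + 4 * C * (M+1) * \<eta>" using C M eta(1) by simp
    then have Pm: "emeasure lborel P \<le> ennreal (\<epsilon> / 2)"
      unfolding P_def by (simp only: emeasure_lborel_Icc ennreal_leI[OF PD])
    have sub: "B \<inter> {-M..M} \<subseteq> T \<union> P"
    proof
      fix x assume x: "x \<in> B \<inter> {-M..M}"
      then have xM: "\<bar>x\<bar> \<le> M" by auto
      show "x \<in> T \<union> P"
      proof (cases "\<bar>c$1$1 - c$2$1 * x\<bar> < \<eta>")
        case True
        then show ?thesis using p xM P_def by blast
      next
        case False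
        let ?q = "c$1$1 - c$2$1 * x"
        have q: "\<bar>?q\<bar> \<ge> \<eta>" "?q \<noteq> 0" using False eta(1) by auto
        define y where "y = (c$2$2 * x - c$1$2) / ?q"
        have d: "c$1$1 * c$2$2 = 1 + c$1$2 * c$2$1" using c(1) by (simp add: det_2)
        have "(c$2$1 * y + c$2$2) * ?q = c$1$1 * c$2$2 - c$1$2 * c$2$1"
          unfolding y_def using q by (simp add: field_simps)
        then have den: "(c$2$1 * y + c$2$2) * ?q = 1" using d by simp
        have num: "(c$1$1 * y + c$1$2) * ?q = x"
        proof -
          have "(c$1$1 * y + c$1$2) * ?q = (c$1$1 * c$2$2 - c$1$2 * c$2$1) * x"
            unfolding y_def using q by (simp add: field_simps)
          then show ?thesis using d by simp
        qed
        have den0: "c$2$1 * y + c$2$2 \<noteq> 0" using den by auto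
        have mx: "mob c y = x"
        proof -
          have "c$1$1 * y + c$1$2 = (c$1$1 * y + c$1$2) * ((c$2$1 * y + c$2$2) * ?q)" by (simp only: den mult_1_right)
          also have "\<dots> = ((c$1$1 * y + c$1$2) * ?q) * (c$2$1 * y + c$2$2)" by (simp only: mult_ac)
          also have "\<dots> = x * (c$2$1 * y + c$2$2)" by (simp only: num)
          finally have "c$1$1 * y + c$1$2 = x * (c$2$1 * y + c$2$2)" .
          then show ?thesis unfolding mob_def by (simp only: nonzero_mult_div_cancel_right[OF den0])
        qed
        have qD: "\<bar>?q\<bar> \<le> D"
        proof -
          have "\<bar>?q\<bar> \<le> \<bar>c$1$1\<bar> + \<bar>c$2$1\<bar> * \<bar>x\<bar>"
            unfolding abs_mult[symmetric] by linarith
          also have "\<dots> \<le> C + C * M" using c(2) xM C by (intro add_mono mult_mono) auto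
          finally show ?thesis by (simp add: D_def algebra_simps)
        qed
        have nD: "\<bar>c$2$2 * x - c$1$2\<bar> \<le> D"
        proof -
          have "\<bar>c$2$2 * x - c$1$2\<bar> \<le> \<bar>c$1$2\<bar> + \<bar>c$2$2\<bar> * \<bar>x\<bar>"
            unfolding abs_mult[symmetric] by linarith
          also have "\<dots> \<le> C + C * M" using c(2) xM C by (intro add_mono mult_mono) auto
          finally show ?thesis by (simp add: D_def algebra_simps)
        qed
        have "\<bar>y\<bar> \<le> D / \<eta>" unfolding y_def abs_divide using nD q eta(1) D by (intro frac_le) auto
        also have "\<dots> < R" unfolding R_def using D eta(1) by (simp add: divide_strict_right_mono)
        finally have yR: "\<bar>y\<bar> < R" .
        define z where "z = l * y + m"
        have zy: "(z - m) / l = y" using l by (simp add: z_def)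
        have "l * \<bar>y\<bar> < l * R" using yR l by simp
        also have "l * R = (b - a) / 2" using R by (simp add: l_def)
        finally have "\<bar>l * y\<bar> < (b - a) / 2" using l by (simp add: abs_mult)
        then have zab: "z \<in> {a<..<b}" unfolding z_def m_def by (auto simp: abs_less_iff field_simps)
        have h0: "h$2$1 * y + h$2$2 \<noteq> 0" using l by (simp add: h_def)
        have g0: "g$2$1 * x + g$2$2 \<noteq> 0" using h0 mob_mult(1)[OF den0, of g] hgc mx by auto
        have "mob h y = mob g x" using mob_mult(2)[OF den0, of g] hgc mx by simp
        moreover have "mob h y = z" using l by (simp add: mob_def h_def z_def field_simps)
        ultimately have zB: "z \<in> B" using inv[OF g _ g0] x by (simp only: Int_iff)
        have "1 = \<bar>c$2$1 * y + c$2$2\<bar> * \<bar>?q\<bar>" using den by (metis abs_mult abs_one)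
        also have "\<dots> \<le> \<bar>c$2$1 * y + c$2$2\<bar> * D" using qD by (intro mult_left_mono) auto
        finally have "1 / D \<le> \<bar>c$2$1 * y + c$2$2\<bar>" using D by (simp add: field_simps)
        then have "z \<in> Z" using zB zab unfolding Z_def by (simp only: mem_Collect_eq Int_iff zy)
        moreover have "f z = x" using mx unfolding f_def zy by simp
        ultimately show ?thesis using T(2) by blast
      qed
    qed
    have "emeasure lborel (T \<union> P) \<le> emeasure lborel T + emeasure lborel P"
      using T(1) by (intro emeasure_subadditive) (auto simp: P_def)
    also have "\<dots> \<le> ennreal (\<epsilon> / 2) + ennreal (\<epsilon> / 2)" by (rule add_mono[OF Tm Pm])
    also have "\<dots> = ennreal \<epsilon>" using eps by (simp flip: ennreal_plus)
    finally show "\<exists>T\<in>sets borel. B \<inter> {-M..M} \<subseteq> T \<and> emeasure lborel T \<le> ennreal \<epsilon>"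
      using sub T(1) by (intro bexI[of _ "T \<union> P"]) (auto simp: P_def)
  qed
  have "B = (\<Union>n::nat. B \<inter> {-(real n + 1)..real n + 1})"
  proof (intro set_eqI iffI)
    fix x assume "x \<in> B"
    obtain k :: nat where "\<bar>x\<bar> \<le> real k" using real_arch_simple by blast
    then show "x \<in> (\<Union>n::nat. B \<inter> {-(real n + 1)..real n + 1})" using \<open>x \<in> B\<close>
      by (auto simp: abs_le_iff intro!: exI[of _ k])
  qed auto
  also have "negligible \<dots>"
  proof (intro negligible_countable_Union countable_image)
    fix X assume "X \<in> range (\<lambda>n::nat. B \<inter> {-(real n + 1)..real n + 1})"
    then obtain n :: nat where "X = B \<inter> {-(real n + 1)..real n + 1}" by blast
    then show "negligible X" using main[of "real n + 1"] by (simp del: minus_add_distrib)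
  qed auto
  finally show "negligible B" .
qed

section \<open>Pairs of monotone homeomorphisms\<close>

text \<open>Images under \<open>p\<close> are preimages under its inverse, which is monotone and
  therefore Borel.\<close>

lemma strict_mono_surj_image_borel:
  fixes p :: "real \<Rightarrow> real"
  assumes sm: "strict_mono p" and surj: "surj p"
  shows "inv p \<in> borel_measurable borel" "inv p -` X = p ` X"
    "X \<in> sets borel \<Longrightarrow> p ` X \<in> sets borel"
proof -
  have bij: "bij p" using strict_mono_imp_inj_on[OF sm] surj by (rule bijI)
  have "mono (inv p)"
  proof (rule monoI)
    fix x y :: real assume "x \<le> y"
    then have "p (inv p x) \<le> p (inv p y)" using surj by (simp add: surj_f_inv_f)
    then show "inv p x \<le> inv p y" using sm strict_mono_less_eq by blast
  qed
  then show m: "inv p \<in> borel_measurable borel" by (rule borel_measurable_mono)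
  show vim: "inv p -` X = p ` X" using bij by (simp add: bij_vimage_eq_inv_image bij_imp_bij_inv inv_inv_eq)
  show "p ` X \<in> sets borel" if "X \<in> sets borel" using measurable_sets[OF m that] vim by simp
qed

lemma homeo_density:
  fixes p :: "real \<Rightarrow> real"
  assumes sm: "strict_mono p" and surj: "surj p" and lip: "\<And>x y. \<bar>p x - p y\<bar> \<le> \<bar>x - y\<bar>"
  shows "\<exists>w. w \<in> borel_measurable borel \<and> (\<forall>X\<in>sets borel. p ` X \<in> sets borel \<and>
    emeasure lborel (p ` X) = (\<integral>\<^sup>+y. w y * indicator X y \<partial>lborel))"
proof -
  note m = strict_mono_surj_image_borel(1)[OF sm surj] and vim = strict_mono_surj_image_borel(2)[OF sm surj]
    and im = strict_mono_surj_image_borel(3)[OF sm surj]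
  define N where "N = distr lborel borel (inv p)"
  have N: "emeasure N X = emeasure lborel (p ` X)" if "X \<in> sets borel" for X :: "real set"
    unfolding N_def using m that by (subst emeasure_distr) (simp_all add: vim)
  have sN: "sets N = sets borel" by (simp add: N_def)
  have ac: "absolutely_continuous lborel N"
    unfolding absolutely_continuous_def
  proof
    fix X :: "real set" assume "X \<in> null_sets lborel"
    then have X: "X \<in> sets borel" "emeasure lborel X = 0" by auto
    have *: "emeasure lborel (p ` X) \<le> ennreal e" if e: "e > 0" for e
    proof -
      obtain T where "T \<in> sets borel" "p ` X \<subseteq> T" "emeasure lborel T \<le> ennreal (2 * (1 * (e / 2)))"
        by (rule lipschitz_image_cover[OF X(1), of "e/2" 1 p]) (use X e lip in auto)
      then show ?thesis using emeasure_mono[of "p ` X" T lborel] by (auto intro: order_trans)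
    qed
    have "emeasure lborel (p ` X) \<le> 0" by (rule ennreal_le_epsilon) (simp only: * add_0)
    then show "X \<in> null_sets N" using N X sN by auto
  qed
  define w where "w = RN_deriv lborel N"
  have d: "density lborel w = N" unfolding w_def
    by (rule sigma_finite_measure.density_RN_deriv[OF sigma_finite_lborel ac]) (simp add: sN)
  have wm: "w \<in> borel_measurable borel" unfolding w_def using borel_measurable_RN_deriv[of lborel N] by simp
  show ?thesis
  proof (intro exI[of _ w] conjI ballI wm im)
    fix X :: "real set" assume X: "X \<in> sets borel"
    have "emeasure (density lborel w) X = (\<integral>\<^sup>+y. w y * indicator X y \<partial>lborel)"
      by (rule emeasure_density) (use X wm in auto)
    then show "emeasure lborel (p ` X) = (\<integral>\<^sup>+y. w y * indicator X y \<partial>lborel)" using d N[OF X] by simp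
  qed
qed

lemma strict_mono_surj_continuous:
  fixes f :: "real \<Rightarrow> real"
  assumes "strict_mono f" "surj f"
  shows "continuous_on UNIV f"
proof (rule continuous_onI_mono)
  show "open (range f)" using assms(2) by simp
  show "f x \<le> f y" if "x \<le> y" for x y using strict_mono_less_eq[OF assms(1)] that by blast
qed

lemma strict_mono_surj_image_Ioo:
  fixes p :: "real \<Rightarrow> real"
  assumes sm: "strict_mono p" and surj: "surj p"
  shows "p ` {c<..<d} = {p c<..<p d}"
proof (intro set_eqI iffI)
  fix y assume y: "y \<in> {p c<..<p d}"
  obtain x where x: "y = p x" using surj by blast
  then have "c < x" "x < d" using y sm by (auto simp: strict_mono_less)
  then show "y \<in> p ` {c<..<d}" using x by auto
qed (use sm in \<open>auto simp: strict_mono_less\<close>)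

text \<open>The increment of \<open>p\<close> is the integral of \<open>w\<close>. Of the constant
  \<open>5 + v\<close>, 4 bounds the image of the part outside \<open>A\<close> (the measure is
  doubled once to be strict and once by the cover), 1 is the oscillation of \<open>w\<close> on
  \<open>A\<close>, and \<open>v\<close> is the increment lost where \<open>A\<close> is
  missing.\<close>

lemma density_almost_affine:
  fixes p :: "real \<Rightarrow> real"
  assumes sm: "strict_mono p" and surj: "surj p" and lip: "\<And>x y. \<bar>p x - p y\<bar> \<le> \<bar>x - y\<bar>"
    and w: "w \<in> borel_measurable borel"
    and dens: "\<And>X. X \<in> sets borel \<Longrightarrow> emeasure lborel (p ` X) = (\<integral>\<^sup>+y. w y * indicator X y \<partial>lborel)"
    and A: "A \<in> sets borel" "\<And>y. y \<in> A \<Longrightarrow> ennreal (v - e) \<le> w y \<and> w y \<le> ennreal (v + e)"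
    and e: "0 < e" "e < v" and ab: "a < b" "emeasure lborel ({a<..<b} - A) \<le> ennreal (e * (b - a))"
    and y: "a \<le> y" "y \<le> b"
  shows "\<bar>p y - p a - v * (y - a)\<bar> \<le> (5 + v) * e * (b - a)"
proof -
  have mono: "p x \<le> p x'" if "x \<le> x'" for x x' using sm that by (simp add: strict_mono_less_eq)
  let ?J = "{a<..<y}"
  let ?G = "A \<inter> ?J"
  have pJ: "emeasure lborel (p ` ?J) = ennreal (p y - p a)"
    using strict_mono_surj_image_Ioo[OF sm surj, of a y] mono[OF y(1)] by simp
  have un: "p ` ?J = p ` ?G \<union> p ` (?J - A)" by blast
  note meas = strict_mono_surj_image_borel(3)[OF sm surj]
  have bad: "emeasure lborel (?J - A) \<le> ennreal (e * (b - a))"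
    using ab(2) by (rule order_trans[rotated]) (use y A in \<open>auto intro!: emeasure_mono\<close>)
  have "ennreal (e * (b - a)) < ennreal (2 * e * (b - a))" using e ab by (intro ennreal_lessI) auto
  then have bad2: "emeasure lborel (?J - A) < ennreal (2 * e * (b - a))" using bad by (rule le_less_trans[rotated])
  obtain T where T: "T \<in> sets borel" "p ` (?J - A) \<subseteq> T" "emeasure lborel T \<le> ennreal (2 * (1 * (2 * e * (b - a))))"
    by (rule lipschitz_image_cover[OF _ bad2, of 1 p]) (use A e ab lip in auto)
  have pbad: "emeasure lborel (p ` (?J - A)) \<le> ennreal (4 * e * (b - a))"
    using emeasure_mono[OF T(2), of lborel] T(1,3) by (simp add: algebra_simps)
  obtain g where g: "emeasure lborel ?G = ennreal g" "g \<ge> 0"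
  proof -
    have "emeasure lborel ?G \<le> emeasure lborel ?J" by (rule emeasure_mono) auto
    also have "\<dots> < \<infinity>" using y by simp
    finally show ?thesis using that by (cases "emeasure lborel ?G") auto
  qed
  have "emeasure lborel ?J = emeasure lborel ?G + emeasure lborel (?J - A)"
    by (subst plus_emeasure) (use A in \<open>auto intro!: arg_cong[of _ _ "emeasure lborel"]\<close>)
  then have "ennreal (y - a) \<le> ennreal g + ennreal (e * (b - a))" using bad y g by (simp add: add_left_mono)
  then have g1: "y - a \<le> g + e * (b - a)" using g e ab by (simp flip: ennreal_plus add: ennreal_le_iff)
  have "ennreal g \<le> ennreal (y - a)"
    unfolding g(1)[symmetric] using emeasure_mono[of ?G ?J lborel] y by simp
  then have g2: "g \<le> y - a" using y by simp
  have Gm: "?G \<in> sets borel" using A by auto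
  have up: "emeasure lborel (p ` ?G) \<le> ennreal (v + e) * ennreal g"
  proof -
    have "emeasure lborel (p ` ?G) \<le> (\<integral>\<^sup>+y. ennreal (v + e) * indicator ?G y \<partial>lborel)"
      unfolding dens[OF Gm] using A(2) by (intro nn_integral_mono) (auto split: split_indicator)
    also have "\<dots> = ennreal (v + e) * ennreal g" using Gm g by (subst nn_integral_cmult_indicator) auto
    finally show ?thesis .
  qed
  have lo: "ennreal (v - e) * ennreal g \<le> emeasure lborel (p ` ?G)"
  proof -
    have "ennreal (v - e) * ennreal g = (\<integral>\<^sup>+y. ennreal (v - e) * indicator ?G y \<partial>lborel)"
      using Gm g by (subst nn_integral_cmult_indicator) auto
    also have "\<dots> \<le> emeasure lborel (p ` ?G)"
      unfolding dens[OF Gm] using A(2) by (intro nn_integral_mono) (auto split: split_indicator)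
    finally show ?thesis .
  qed
  have "emeasure lborel (p ` ?J) \<le> emeasure lborel (p ` ?G) + emeasure lborel (p ` (?J - A))"
    unfolding un by (rule emeasure_subadditive) (use meas A in auto)
  also have "\<dots> \<le> ennreal (v + e) * ennreal g + ennreal (4 * e * (b - a))" by (rule add_mono[OF up pbad])
  also have "\<dots> = ennreal ((v + e) * g + 4 * e * (b - a))" using e ab g by (simp add: ennreal_mult)
  finally have U: "p y - p a \<le> (v + e) * g + 4 * e * (b - a)"
    unfolding pJ using e ab g by (subst (asm) ennreal_le_iff) auto
  have "ennreal ((v - e) * g) \<le> emeasure lborel (p ` ?G)" using lo e g by (simp add: ennreal_mult)
  also have "\<dots> \<le> emeasure lborel (p ` ?J)" by (rule emeasure_mono) (use meas in auto)
  finally have Lw: "(v - e) * g \<le> p y - p a"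
    unfolding pJ using mono[OF y(1)] by (subst (asm) ennreal_le_iff) auto
  have eg: "e * g \<le> e * (b - a)" using g2 y e by (intro mult_left_mono) auto
  have vg: "v * g \<le> v * (y - a)" using g2 e by (intro mult_left_mono) auto
  have vg2: "v * (y - a) \<le> v * g + v * e * (b - a)"
    using mult_left_mono[OF g1, of v] e by (simp add: algebra_simps)
  have "e * (b - a) \<ge> 0" "v * e * (b - a) \<ge> 0" using e ab by auto
  then show ?thesis using U Lw eg vg vg2 by (simp add: algebra_simps abs_le_iff)
qed

text \<open>Otherwise every value in \<open>Q\<close> has a neighbourhood with null preimage in
  \<open>A\<close>, and by Lindelof countably many of them exhaust \<open>A\<close>.\<close>

lemma essential_value:
  fixes u :: "real \<Rightarrow> 'a::second_countable_topology"
  assumes A: "emeasure lborel A > 0" "A \<in> sets borel" and u: "u \<in> borel_measurable borel"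
    and uA: "\<And>y. y \<in> A \<Longrightarrow> u y \<in> Q"
  obtains v where "v \<in> Q" "\<And>V. open V \<Longrightarrow> v \<in> V \<Longrightarrow> emeasure lborel (A \<inter> u -` V) > 0"
proof (rule ccontr)
  note hyp = that
  assume nt: "\<not> thesis"
  have "\<exists>V. open V \<and> v \<in> V \<and> emeasure lborel (A \<inter> u -` V) = 0" if v: "v \<in> Q" for v
    using hyp[OF v] nt not_gr_zero by blast
  then obtain V where V: "\<And>v. v \<in> Q \<Longrightarrow> open (V v) \<and> v \<in> V v \<and> emeasure lborel (A \<inter> u -` V v) = 0"
    by metis
  obtain F where F: "F \<subseteq> V ` Q" "countable F" "\<Union>F = \<Union>(V ` Q)"
    using Lindelof[of "V ` Q"] V by auto
  have pm: "u -` W \<in> sets borel" if "open W" for W using measurable_sets[OF u, of W] that by simp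
  have "A \<subseteq> (\<Union>W\<in>F. A \<inter> u -` W)"
  proof
    fix y assume y: "y \<in> A"
    have "u y \<in> \<Union>F" unfolding F(3) using V[OF uA[OF y]] uA[OF y] by blast
    then show "y \<in> (\<Union>W\<in>F. A \<inter> u -` W)" using y by blast
  qed
  moreover have "(\<Union>W\<in>F. A \<inter> u -` W) \<in> null_sets lborel"
  proof -
    have "(\<Union>W\<in>F. A \<inter> u -` W) \<in> null_sets lborel"
    proof (rule null_sets_UN'[OF F(2)])
      fix W assume "W \<in> F"
      then obtain v where "v \<in> Q" "W = V v" using F(1) by blast
      then show "A \<inter> u -` W \<in> null_sets lborel" using V[of v] pm A by auto
    qed
    then show ?thesis .
  qed
  ultimately have "emeasure lborel A = 0"
    using A(2) null_sets_subset[of _ lborel A] by (metis null_setsD1 sets_lborel)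
  then show False using A by simp
qed

text \<open>With respect to \<open>s = F1 + F2\<close> both maps are 1-Lipschitz and have densities
  \<open>w1\<close> and \<open>w2\<close>. Since no Borel set separates them, both densities are
  positive on a set of positive measure. Near an essential value of the pair they are almost
  constant on most of an interval, which is rescaled to \<open>{-R..R}\<close>.\<close>

lemma homeo_pair_almost_affine:
  fixes F1 F2 :: "real \<Rightarrow> real"
  assumes F1: "strict_mono F1" "surj F1" and F2: "strict_mono F2" "surj F2"
    and nsing: "\<not> (\<exists>D\<in>sets borel. negligible (F1 ` (- D)) \<and> negligible (F2 ` D))"
    and R: "R \<ge> 1"
  obtains X a1 l1 a2 l2 where "l1 > 0" "l2 > 0"
    "\<And>z. \<bar>z\<bar> \<le> R \<Longrightarrow> \<bar>F1 (X z) - (a1 + l1 * z)\<bar> \<le> l1 / R"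
    "\<And>z. \<bar>z\<bar> \<le> R \<Longrightarrow> \<bar>F2 (X z) - (a2 + l2 * z)\<bar> \<le> l2 / R"
proof -
  note c = strict_mono_surj_continuous[OF F1] strict_mono_surj_continuous[OF F2]
  define s where "s x = F1 x + F2 x" for x
  have lt1: "F1 x < F1 y \<longleftrightarrow> x < y" and lt2: "F2 x < F2 y \<longleftrightarrow> x < y" for x y
    using F1 F2 by (auto simp: strict_mono_less)
  have sms: "strict_mono s" by (rule strict_monoI) (auto simp: s_def lt1 lt2 intro: add_strict_mono)
  have cs: "continuous_on UNIV s" unfolding s_def by (intro continuous_intros c)
  have surjs: "surj s"
    unfolding surj_def
  proof
    fix y
    obtain x1 x2 where x: "F1 x1 = y/2" "F2 x2 = y/2" using F1(2) F2(2) by (metis surjD)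
    have "s (min x1 x2) \<le> y" "y \<le> s (max x1 x2)"
      using x strict_mono_mono[OF F1(1)] strict_mono_mono[OF F2(1)] unfolding s_def
      by (auto simp: min_def max_def mono_def) (smt (verit) field_sum_of_halves)+
    moreover have "min x1 x2 \<le> max x1 x2" by simp
    ultimately obtain x where "s x = y"
      using IVT'[of s "min x1 x2" y "max x1 x2"] continuous_on_subset[OF cs subset_UNIV] by blast
    then show "\<exists>x. y = s x" by blast
  qed
  define t where "t = inv s"
  have st: "s (t y) = y" for y using surjs by (simp add: t_def surj_f_inv_f)
  have ts: "t (s x) = x" for x using sms by (simp add: t_def strict_mono_imp_inj_on inv_f_f)
  have tlt: "t x < t y \<longleftrightarrow> x < y" for x y using strict_mono_less[OF sms, of "t x" "t y"] st by simp
  have surjt: "surj t" using ts by (metis surjI)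
  define p where "p = F1 \<circ> t"
  define q where "q = F2 \<circ> t"
  have pq: "p y + q y = y" for y using st[of y] by (simp add: p_def q_def s_def)
  have smp: "strict_mono p" and smq: "strict_mono q"
    by (auto intro!: strict_monoI simp: p_def q_def lt1 lt2 tlt)
  have surjp: "surj p" and surjq: "surj q" unfolding p_def q_def using F1(2) F2(2) surjt by (metis comp_surj)+
  have lippq: "\<bar>p x - p y\<bar> \<le> \<bar>x - y\<bar> \<and> \<bar>q x - q y\<bar> \<le> \<bar>x - y\<bar>" for x y
  proof (cases "x \<le> y")
    case True
    then have "p x \<le> p y" "q x \<le> q y" using smp smq by (simp_all add: strict_mono_less_eq)
    then show ?thesis using pq[of x] pq[of y] by linarith
  next
    case False
    then have "p y \<le> p x" "q y \<le> q x" using smp smq by (simp_all add: strict_mono_less_eq)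
    then show ?thesis using pq[of x] pq[of y] by linarith
  qed
  note lipp = lippq[THEN conjunct1] and lipq = lippq[THEN conjunct2]
  obtain w1 where w1: "w1 \<in> borel_measurable borel" and wd1: "\<forall>X\<in>sets borel. p ` X \<in> sets borel \<and>
    emeasure lborel (p ` X) = (\<integral>\<^sup>+y. w1 y * indicator X y \<partial>lborel)"
    using homeo_density[OF smp surjp lipp] by (elim exE conjE)
  note im1 = wd1[rule_format, THEN conjunct1] and d1 = wd1[rule_format, THEN conjunct2]
  obtain w2 where w2: "w2 \<in> borel_measurable borel" and wd2: "\<forall>X\<in>sets borel. q ` X \<in> sets borel \<and>
    emeasure lborel (q ` X) = (\<integral>\<^sup>+y. w2 y * indicator X y \<partial>lborel)"
    using homeo_density[OF smq surjq lipq] by (elim exE conjE)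
  note im2 = wd2[rule_format, THEN conjunct1] and d2 = wd2[rule_format, THEN conjunct2]
  \<comment> \<open>An infinite density on a non-null set would give a bounded interval an image of
    infinite length.\<close>
  have fin: "emeasure lborel {y. w y = \<infinity>} = 0"
    if sm: "strict_mono r" and sj: "surj r" and w: "w \<in> borel_measurable borel"
      and d: "\<And>X. X \<in> sets borel \<Longrightarrow> emeasure lborel (r ` X) = (\<integral>\<^sup>+y. w y * indicator X y \<partial>lborel)"
      and im: "\<And>X. X \<in> sets borel \<Longrightarrow> r ` X \<in> sets borel" for r :: "real \<Rightarrow> real" and w :: "real \<Rightarrow> ennreal"
  proof -
    have wm: "{y. w y = \<infinity>} \<in> sets borel" using w by measurable
    have z: "emeasure lborel ({y. w y = \<infinity>} \<inter> {-real n<..<real n}) = 0" for n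
    proof -
      let ?X = "{y. w y = \<infinity>} \<inter> {-real n<..<real n}"
      have "(\<integral>\<^sup>+y. \<infinity> * indicator ?X y \<partial>lborel) = (\<integral>\<^sup>+y. w y * indicator ?X y \<partial>lborel)"
        by (intro nn_integral_cong) (auto split: split_indicator)
      also have "\<dots> = emeasure lborel (r ` ?X)" using d[of ?X] wm by auto
      also have "\<dots> \<le> emeasure lborel (r ` {-real n<..<real n})" using im by (intro emeasure_mono) auto
      also have "\<dots> < \<infinity>" unfolding strict_mono_surj_image_Ioo[OF sm sj]
        using strict_mono_less_eq[OF sm, of "-real n" "real n"] by simp
      finally have "\<infinity> * emeasure lborel ?X < \<infinity>" using wm by (subst (asm) nn_integral_cmult_indicator) auto
      then show ?thesis by (simp add: ennreal_mult_less_top)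
    qed
    have "{y. w y = \<infinity>} = (\<Union>n. {y. w y = \<infinity>} \<inter> {-real n<..<real n})"
    proof (intro set_eqI iffI)
      fix x assume "x \<in> {y. w y = \<infinity>}"
      obtain k :: nat where "\<bar>x\<bar> < real k" using reals_Archimedean2[of "\<bar>x\<bar>"] by (elim exE)
      then have "x \<in> {y. w y = \<infinity>} \<inter> {-real k<..<real k}" using \<open>x \<in> {y. w y = \<infinity>}\<close> by auto
      then show "x \<in> (\<Union>n. {y. w y = \<infinity>} \<inter> {-real n<..<real n})" by (rule UN_I[OF UNIV_I])
    qed (rule UN_E, assumption, rule IntD1)
    also have "emeasure lborel \<dots> = 0" using z wm by (intro emeasure_UN_eq_0) auto
    finally show ?thesis .
  qed
  have fin1: "emeasure lborel {y. w1 y = \<infinity>} = 0" by (rule fin[OF smp surjp w1 d1 im1])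
  have fin2: "emeasure lborel {y. w2 y = \<infinity>} = 0" by (rule fin[OF smq surjq w2 d2 im2])
  define A0 where "A0 = {y. 0 < w1 y \<and> 0 < w2 y}"
  have A0b: "A0 \<in> sets borel" unfolding A0_def using w1 w2 by measurable
  have A0p: "emeasure lborel A0 \<noteq> 0"
  proof
    assume null: "emeasure lborel A0 = 0"
    \<comment> \<open>If the densities are almost nowhere both positive, the zero set of
      \<open>w2\<close> separates: \<open>q\<close> makes it null, and \<open>p\<close> makes its
      complement null.\<close>
    define D' where "D' = {y. w2 y = 0}"
    have D'b: "D' \<in> sets borel" unfolding D'_def using w2 by measurable
    have "emeasure lborel (q ` D') = 0"
    proof -
      have "w2 y * indicator D' y = 0" for y by (simp add: D'_def split: split_indicator)
      then have "(\<integral>\<^sup>+y. w2 y * indicator D' y \<partial>lborel) = (\<integral>\<^sup>+(y::real). 0 \<partial>lborel)" by (simp only:)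
      then show ?thesis unfolding d2[OF D'b] by simp
    qed
    then have nq: "negligible (q ` D')" using im2 D'b by (simp add: negligible_borel_iff)
    have "AE y in lborel. y \<notin> A0" using null A0b by (intro AE_I[of _ _ A0]) auto
    then have "AE y in lborel. w1 y * indicator (- D') y = 0"
      by (rule AE_mp) (auto simp: A0_def D'_def zero_less_iff_neq_zero split: split_indicator)
    then have "(\<integral>\<^sup>+y. w1 y * indicator (- D') y \<partial>lborel) = 0"
      using D'b w1 by (subst nn_integral_0_iff_AE) auto
    then have "emeasure lborel (p ` (- D')) = 0"
      using d1[of "- D'"] D'b by simp
    then have np: "negligible (p ` (- D'))" using im1 D'b by (simp add: negligible_borel_iff)
    define D where "D = s -` D'"
    have "D \<in> sets borel" unfolding D_def
      using measurable_sets[OF borel_measurable_continuous_onI[OF cs] D'b] by simp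
    moreover have "F1 ` (- D) = p ` (- D')"
    proof -
      have "t ` (- D') = - D"
      proof (intro set_eqI iffI)
        fix x assume "x \<in> - D"
        then show "x \<in> t ` (- D')" unfolding D_def using ts[of x] by (intro image_eqI[of _ t "s x"]) auto
      qed (auto simp: D_def st)
      then show ?thesis by (metis p_def image_comp)
    qed
    moreover have "F2 ` D = q ` D'"
    proof -
      have "t ` D' = D"
      proof (intro set_eqI iffI)
        fix x assume "x \<in> D"
        then show "x \<in> t ` D'" unfolding D_def using ts[of x] by (intro image_eqI[of _ t "s x"]) auto
      qed (auto simp: D_def st)
      then show ?thesis by (metis q_def image_comp)
    qed
    ultimately show False using nsing np nq by auto
  qed
  define A where "A = A0 - ({y. w1 y = \<infinity>} \<union> {y. w2 y = \<infinity>})"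
  have nb: "{y. w1 y = \<infinity>} \<in> sets borel" "{y. w2 y = \<infinity>} \<in> sets borel" using w1 w2 by measurable
  have Ab: "A \<in> sets borel" unfolding A_def using A0b nb by auto
  have "{y. w1 y = \<infinity>} \<union> {y. w2 y = \<infinity>} \<in> null_sets lborel" using fin1 fin2 nb by (intro null_sets.Un) auto
  then have "emeasure lborel A = emeasure lborel A0" unfolding A_def using A0b by (intro emeasure_Diff_null_set) auto
  then have Ap: "emeasure lborel A > 0" using A0p by (simp add: zero_less_iff_neq_zero)
  define u where "u y = (enn2real (w1 y), enn2real (w2 y))" for y
  have um: "u \<in> borel_measurable borel" unfolding u_def using w1 w2 by measurable
  have uA: "u y \<in> {0<..} \<times> {0<..}" if "y \<in> A" for y
    using that unfolding u_def A_def A0_def by (auto simp: enn2real_positive_iff less_top)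
  obtain v where v: "v \<in> {0<..} \<times> {0<..}" "\<And>V. open V \<Longrightarrow> v \<in> V \<Longrightarrow> emeasure lborel (A \<inter> u -` V) > 0"
    using essential_value[OF Ap Ab um uA] by blast
  obtain v1 v2 where v12: "v = (v1, v2)" "v1 > 0" "v2 > 0" using v(1) by (cases v) auto
  \<comment> \<open>The error \<open>(5 + v) * e * (b - a)\<close> of
    \<open>density_almost_affine\<close>, with \<open>b - a = 2 * R * l\<close>, must not exceed
    \<open>v * l / R\<close>; this asks for \<open>2 * R\<^sup>2 * (5 + v) * e \<le> v\<close>. The
    4 in place of 2 leaves room, and \<open>R \<ge> 1\<close> gives \<open>e < v\<close>.\<close>
  define e where "e = min (v1 / (4 * R\<^sup>2 * (5 + v1))) (v2 / (4 * R\<^sup>2 * (5 + v2)))"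
  have e0: "e > 0" using v12 R by (auto simp: e_def)
  have eb: "2 * R\<^sup>2 * (5 + x) * e \<le> x" "e < x" if x: "x > 0" "e \<le> x / (4 * R\<^sup>2 * (5 + x))" for x
  proof -
    have "4 * R\<^sup>2 * (5 + x) > 0" using x R by simp
    then have "4 * R\<^sup>2 * (5 + x) * e \<le> x" using x(2) by (simp only: pos_le_divide_eq mult.commute)
    moreover have "2 * R\<^sup>2 * (5 + x) * e \<ge> 0" using x R e0 by simp
    ultimately show "2 * R\<^sup>2 * (5 + x) * e \<le> x" by linarith
    have R2: "R\<^sup>2 \<ge> 1" using R by simp
    then have "x / (4 * R\<^sup>2 * (5 + x)) \<le> x / 4"
    proof (intro divide_left_mono)
      have "4 * 1 * 1 \<le> 4 * R\<^sup>2 * (5 + x)" using x R2 by (intro mult_mono) auto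
      then show "4 \<le> 4 * R\<^sup>2 * (5 + x)" by simp
    qed (use x R in auto)
    then show "e < x" using x by linarith
  qed
  have e1: "2 * R\<^sup>2 * (5 + v1) * e \<le> v1" "e < v1" using eb[of v1] v12 by (auto simp: e_def)
  have e2: "2 * R\<^sup>2 * (5 + v2) * e \<le> v2" "e < v2" using eb[of v2] v12 by (auto simp: e_def)
  define V where "V = {v1 - e<..<v1 + e} \<times> {v2 - e<..<v2 + e}"
  have V: "open V" "v \<in> V" using e0 v12 by (auto simp: V_def intro: open_Times)
  define A' where "A' = A \<inter> u -` V"
  have A'p: "emeasure lborel A' > 0" unfolding A'_def by (rule v(2)[OF V])
  have A'b: "A' \<in> sets borel" unfolding A'_def using Ab measurable_sets[OF um, of V] V(1) by auto
  have cell: "ennreal (v1 - e) \<le> w1 y \<and> w1 y \<le> ennreal (v1 + e)" "ennreal (v2 - e) \<le> w2 y \<and> w2 y \<le> ennreal (v2 + e)"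
    if "y \<in> A'" for y
  proof -
    have "w1 y = ennreal (enn2real (w1 y))" "w2 y = ennreal (enn2real (w2 y))"
      using that by (auto simp: A'_def A_def less_top)
    moreover have "v1 - e < enn2real (w1 y)" "enn2real (w1 y) < v1 + e" "v2 - e < enn2real (w2 y)" "enn2real (w2 y) < v2 + e"
      using that by (auto simp: A'_def V_def u_def)
    ultimately show "ennreal (v1 - e) \<le> w1 y \<and> w1 y \<le> ennreal (v1 + e)" "ennreal (v2 - e) \<le> w2 y \<and> w2 y \<le> ennreal (v2 + e)"
      by (metis ennreal_leI less_imp_le)+
  qed
  obtain a b where ab: "a < b" "emeasure lborel ({a<..<b} - A') \<le> ennreal (e * (b - a))"
    using dense_interval[OF A'b A'p e0] by blast
  define m where "m = (a + b) / 2"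
  define l where "l = (b - a) / (2 * R)"
  have l: "l > 0" "b - a = 2 * R * l" using ab R by (auto simp: l_def)
  have aff: "\<bar>r (m + l * z) - ((r a + x * (m - a)) + x * l * z)\<bar> \<le> x * l / R"
    if z: "\<bar>z\<bar> \<le> R" and x: "2 * R\<^sup>2 * (5 + x) * e \<le> x"
      and r: "\<And>y. a \<le> y \<Longrightarrow> y \<le> b \<Longrightarrow> \<bar>r y - r a - x * (y - a)\<bar> \<le> (5 + x) * e * (b - a)" for z x r
  proof -
    have "\<bar>l * z\<bar> \<le> l * R" using z l by (simp add: abs_mult)
    also have "l * R = (b - a) / 2" using R by (simp add: l_def)
    finally have in_ab: "a \<le> m + l * z" "m + l * z \<le> b" unfolding m_def by (auto simp: abs_le_iff field_simps)
    have "\<bar>r (m + l * z) - ((r a + x * (m - a)) + x * l * z)\<bar> = \<bar>r (m + l * z) - r a - x * (m + l * z - a)\<bar>"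
      by (simp add: algebra_simps)
    also have "\<dots> \<le> (5 + x) * e * (2 * R * l)" using r[OF in_ab] l by simp
    also have "\<dots> = (2 * R\<^sup>2 * (5 + x) * e) * (l / R)" using R by (simp add: power2_eq_square field_simps)
    also have "\<dots> \<le> x * (l / R)" using x l R by (intro mult_right_mono) auto
    finally show ?thesis by simp
  qed
  show ?thesis
  proof (rule that[of "v1 * l" "v2 * l" "\<lambda>z. t (m + l * z)" "p a + v1 * (m - a)" "q a + v2 * (m - a)"])
    fix z assume z: "\<bar>z\<bar> \<le> R"
    show "\<bar>F1 (t (m + l * z)) - (p a + v1 * (m - a) + v1 * l * z)\<bar> \<le> v1 * l / R"
      using aff[of z v1 p, OF z e1(1) density_almost_affine[OF smp surjp lipp w1 d1 A'b cell(1) e0 e1(2) ab]]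
      by (simp add: p_def)
    show "\<bar>F2 (t (m + l * z)) - (q a + v2 * (m - a) + v2 * l * z)\<bar> \<le> v2 * l / R"
      using aff[of z v2 q, OF z e2(1) density_almost_affine[OF smq surjq lipq w2 d2 A'b cell(2) e0 e2(2) ab]]
      by (simp add: q_def)
  qed (use v12 l in auto)
qed

section \<open>Rigidity\<close>

text \<open>Cross-multiplication gives a quadratic polynomial with infinitely many roots. Its
  vanishing coefficients say that the adjugate of \<open>M\<close> times \<open>N\<close> is a
  scalar matrix, and equal determinants fix the scalar up to sign.\<close>

lemma mob_eq_imp_eq:
  fixes M N :: "real^2^2"
  assumes det: "det M = det N" "det M \<noteq> 0" and fin: "finite E"
    and eq: "\<And>x. x \<notin> E \<Longrightarrow> M$2$1 * x + M$2$2 \<noteq> 0 \<Longrightarrow> N$2$1 * x + N$2$2 \<noteq> 0 \<Longrightarrow> mob M x = mob N x"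
  shows "N = M \<or> N = - M"
proof -
  define a b c d where m: "a = M$1$1" "b = M$1$2" "c = M$2$1" "d = M$2$2"
  define a' b' c' d' where n: "a' = N$1$1" "b' = N$1$2" "c' = N$2$1" "d' = N$2$2"
  have D: "a * d - b * c = a' * d' - b' * c'" "a * d - b * c \<noteq> 0" using det by (simp_all add: m n det_2)
  define q where "q = [:b * d' - b' * d, a * d' + b * c' - a' * d - b' * c, a * c' - a' * c:]"
  have lin: "finite {x. u * x + v = 0}" if "u \<noteq> 0 \<or> v \<noteq> 0" for u v :: real
  proof -
    have "finite {x. poly [:v, u:] x = 0}" using that by (intro poly_roots_finite) auto
    then show ?thesis by (simp add: algebra_simps)
  qed
  have f1: "finite {x. c * x + d = 0}" "finite {x. c' * x + d' = 0}" using D by (auto intro!: lin)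
  have "poly q x = 0" if "x \<notin> E \<union> {x. c * x + d = 0} \<union> {x. c' * x + d' = 0}" for x
  proof -
    have nz: "c * x + d \<noteq> 0" "c' * x + d' \<noteq> 0" using that by auto
    have "(a * x + b) / (c * x + d) = (a' * x + b') / (c' * x + d')"
      using eq[of x] that by (auto simp: mob_def m n)
    then have "(a * x + b) * (c' * x + d') = (a' * x + b') * (c * x + d)" using nz by (simp add: frac_eq_eq)
    then show ?thesis unfolding q_def by (simp add: algebra_simps)
  qed
  then have "- (E \<union> {x. c * x + d = 0} \<union> {x. c' * x + d' = 0}) \<subseteq> {x. poly q x = 0}" by blast
  moreover have "infinite (- (E \<union> {x. c * x + d = 0} \<union> {x. c' * x + d' = 0}))"
    using fin f1 by (metis finite_UnI finite_compl infinite_UNIV_char_0)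
  ultimately have "q = 0" using poly_roots_finite finite_subset by blast
  then have z: "b * d' - b' * d = 0" "a * d' + b * c' - a' * d - b' * c = 0" "a * c' - a' * c = 0"
    by (simp_all add: q_def)
  \<comment> \<open>The upper left entry of the adjugate of \<open>M\<close> times \<open>N\<close>;
    \<open>p2\<close> identifies it with the lower right one.\<close>
  define p where "p = d * a' - b * c'"
  define \<Delta> where "\<Delta> = a * d - b * c"
  have p2: "p = a * d' - c * b'" using z(2) by (simp add: p_def algebra_simps)
  have e1: "\<Delta> * a' = a * p + b * (a * c' - a' * c)" by (simp add: \<Delta>_def p_def algebra_simps)
  have e2: "\<Delta> * b' = b * p - a * (b * d' - b' * d)" unfolding p2 by (simp add: \<Delta>_def algebra_simps)
  have e3: "\<Delta> * c' = c * p + d * (a * c' - a' * c)" by (simp add: \<Delta>_def p_def algebra_simps)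
  have e4: "\<Delta> * d' = d * p - c * (b * d' - b' * d)" unfolding p2 by (simp add: \<Delta>_def algebra_simps)
  have E: "\<Delta> * a' = a * p" "\<Delta> * b' = b * p" "\<Delta> * c' = c * p" "\<Delta> * d' = d * p"
    using e1 e2 e3 e4 z by simp_all
  have "\<Delta> * \<Delta> * \<Delta> = (\<Delta> * a') * (\<Delta> * d') - (\<Delta> * b') * (\<Delta> * c')"
  proof -
    have "(\<Delta> * a') * (\<Delta> * d') - (\<Delta> * b') * (\<Delta> * c') = \<Delta> * \<Delta> * (a' * d' - b' * c')" by (simp add: algebra_simps)
    then show ?thesis using D(1) \<Delta>_def by simp
  qed
  also have "\<dots> = \<Delta> * (p * p)" unfolding E by (simp add: \<Delta>_def algebra_simps)
  finally have "\<Delta> * (\<Delta> * \<Delta>) = \<Delta> * (p * p)" by (simp add: mult.assoc)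
  then have "p * p = \<Delta> * \<Delta>" using D(2) \<Delta>_def by simp
  then have "p = \<Delta> \<or> p = - \<Delta>" by (metis square_eq_iff)
  moreover have D0: "\<Delta> \<noteq> 0" using D(2) \<Delta>_def by simp
  ultimately have "(a' = a \<and> b' = b \<and> c' = c \<and> d' = d) \<or> (a' = -a \<and> b' = -b \<and> c' = -c \<and> d' = -d)"
  proof (elim disjE)
    assume "p = \<Delta>"
    then have "\<Delta> * a' = \<Delta> * a" "\<Delta> * b' = \<Delta> * b" "\<Delta> * c' = \<Delta> * c" "\<Delta> * d' = \<Delta> * d" using E by (simp_all add: mult.commute)
    then show ?thesis using D0 by simp
  next
    assume "p = - \<Delta>"
    then have "\<Delta> * a' = \<Delta> * (-a)" "\<Delta> * b' = \<Delta> * (-b)" "\<Delta> * c' = \<Delta> * (-c)" "\<Delta> * d' = \<Delta> * (-d)" using E by (simp_all add: mult.commute)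
    then show ?thesis using D0 by (simp only: mult_cancel_left simp_thms)
  qed
  then show ?thesis by (auto simp: vec_eq_iff forall_2 m n)
qed

text \<open>An increasing bijection fixes infinity, so letting \<open>d\<close> tend to infinity
  turns cross ratios into simple ratios, and these determine \<open>f\<close> from two values. The
  exceptional point \<open>p\<close> is recovered by continuity.\<close>

lemma cross_ratio_preserving_affine:
  fixes f :: "real \<Rightarrow> real"
  assumes sm: "strict_mono f" and surj: "surj f"
    and cr: "\<And>a b c d. a \<noteq> p \<Longrightarrow> b \<noteq> p \<Longrightarrow> c \<noteq> p \<Longrightarrow> d \<noteq> p \<Longrightarrow>
      (f a - f b) * (f c - f d) * ((a - d) * (c - b)) = (a - b) * (c - d) * ((f a - f d) * (f c - f b))"
  shows "\<exists>\<alpha> \<beta>. \<alpha> > 0 \<and> (\<forall>x. f x = \<alpha> * x + \<beta>)"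
proof -
  note cont = strict_mono_surj_continuous[OF sm surj]
  have top: "filterlim f at_top at_top"
    unfolding filterlim_at_top
  proof
    fix Z obtain x where "f x = Z" using surj by (metis surjD)
    then show "eventually (\<lambda>y. Z \<le> f y) at_top"
      using sm by (intro eventually_at_top_linorderI[of x]) (auto simp: strict_mono_less_eq)
  qed
  have dil: "(f a - f b) * (c - b) = (a - b) * (f c - f b)" if "a \<noteq> p" "b \<noteq> p" "c \<noteq> p" for a b c
  proof -
    have inf1: "((\<lambda>d. inverse d) \<longlongrightarrow> (0::real)) at_top" by (rule tendsto_inverse_0_at_top) (rule filterlim_ident)
    have inf2: "((\<lambda>d. inverse (f d)) \<longlongrightarrow> 0) at_top" by (rule tendsto_inverse_0_at_top[OF top])
    \<comment> \<open>The given identity divided by \<open>f d * d\<close>, in a form in which only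
      the inverses of \<open>d\<close> and \<open>f d\<close> vary.\<close>
    have ev: "eventually (\<lambda>d. (f a - f b) * (f c * inverse (f d) - 1) * ((a * inverse d - 1) * (c - b))
        = (a - b) * (c * inverse d - 1) * ((f a * inverse (f d) - 1) * (f c - f b))) at_top"
      using eventually_gt_at_top[of "max p 0"] filterlim_at_top_dense[THEN iffD1, OF top, rule_format, of 0]
    proof eventually_elim
      case (elim d)
      then have d: "d \<noteq> p" "d > 0" "f d > 0" by auto
      have "(f a - f b) * (f c * inverse (f d) - 1) * ((a * inverse d - 1) * (c - b))
        = ((f a - f b) * (f c - f d) * ((a - d) * (c - b))) / (f d * d)" using d by (simp add: field_simps)
      also have "\<dots> = ((a - b) * (c - d) * ((f a - f d) * (f c - f b))) / (f d * d)" using cr[of a b c d] that d by simp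
      also have "\<dots> = (a - b) * (c * inverse d - 1) * ((f a * inverse (f d) - 1) * (f c - f b))"
        using d by (simp add: field_simps)
      finally show ?case .
    qed
    have l: "((\<lambda>d. (f a - f b) * (f c * inverse (f d) - 1) * ((a * inverse d - 1) * (c - b)))
      \<longlongrightarrow> (f a - f b) * (f c * 0 - 1) * ((a * 0 - 1) * (c - b))) at_top"
      by (intro tendsto_intros inf1 inf2)
    have r: "((\<lambda>d. (a - b) * (c * inverse d - 1) * ((f a * inverse (f d) - 1) * (f c - f b)))
      \<longlongrightarrow> (a - b) * (c * 0 - 1) * ((f a * 0 - 1) * (f c - f b))) at_top"
      by (intro tendsto_intros inf1 inf2)
    have "(f a - f b) * (f c * 0 - 1) * ((a * 0 - 1) * (c - b)) = (a - b) * (c * 0 - 1) * ((f a * 0 - 1) * (f c - f b))"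
      by (rule tendsto_unique[OF _ l]) (simp, rule tendsto_cong[THEN iffD2, OF ev r])
    then show ?thesis by (simp add: algebra_simps)
  qed
  define \<alpha> where "\<alpha> = f (p + 2) - f (p + 1)"
  define \<beta> where "\<beta> = f (p + 1) - \<alpha> * (p + 1)"
  have a0: "\<alpha> > 0" using sm by (simp add: \<alpha>_def strict_mono_less)
  have off: "f x = \<alpha> * x + \<beta>" if "x \<noteq> p" for x
    using dil[of x "p + 1" "p + 2"] that by (simp add: \<alpha>_def \<beta>_def algebra_simps)
  have "f p = \<alpha> * p + \<beta>"
  proof -
    have "(\<lambda>n. p + inverse (real (Suc n))) \<longlonglongrightarrow> p + 0" by (intro tendsto_intros LIMSEQ_inverse_real_of_nat)
    then have lim: "(\<lambda>n. p + inverse (real (Suc n))) \<longlonglongrightarrow> p" by simp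
    have "(\<lambda>n. f (p + inverse (real (Suc n)))) \<longlonglongrightarrow> f p"
      by (rule continuous_on_tendsto_compose[OF cont lim]) auto
    moreover have "(\<lambda>n. f (p + inverse (real (Suc n)))) = (\<lambda>n. \<alpha> * (p + inverse (real (Suc n))) + \<beta>)"
      by (rule ext, rule off) simp
    moreover have "(\<lambda>n. \<alpha> * (p + inverse (real (Suc n))) + \<beta>) \<longlonglongrightarrow> \<alpha> * p + \<beta>"
      by (intro tendsto_intros lim)
    ultimately show ?thesis using LIMSEQ_unique by metis
  qed
  then have "f x = \<alpha> * x + \<beta>" for x using off by (cases "x = p") simp_all
  then show ?thesis using a0 by blast
qed

text \<open>At scale \<open>k\<close> both maps are close to affine ones. The affine map for
  \<open>F1\<close> equals \<open>s1 (g k) ** c k\<close> with \<open>c k\<close> bounded, so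
  equivariance under \<open>g k\<close> brings \<open>f = F2 \<circ> inv F1\<close> from a tiny
  interval to a bounded position. There \<open>f\<close> after \<open>c k\<close> is nearly the
  Moebius map inverse to \<open>s2 (g k)\<close> after an affine map. These maps may diverge with
  \<open>k\<close>, but cross ratios do not see them; in the limit \<open>f\<close> preserves cross
  ratios.\<close>

lemma cocompact_homeo_rigidity:
  fixes G :: "(real^2^2) set" and s1 s2 :: "real^2^2 \<Rightarrow> real^2^2" and F1 F2 :: "real \<Rightarrow> real"
  assumes F1: "strict_mono F1" "surj F1"
    and F2: "strict_mono F2" "surj F2"
    and det: "\<And>g. g \<in> G \<Longrightarrow> det (s2 g) = 1"
    and eq1: "\<And>g x. g \<in> G \<Longrightarrow> g$2$1 * x + g$2$2 \<noteq> 0 \<longleftrightarrow> s1 g$2$1 * F1 x + s1 g$2$2 \<noteq> 0"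
       "\<And>g x. g \<in> G \<Longrightarrow> g$2$1 * x + g$2$2 \<noteq> 0 \<Longrightarrow> F1 (mob g x) = mob (s1 g) (F1 x)"
    and eq2: "\<And>g x. g \<in> G \<Longrightarrow> g$2$1 * x + g$2$2 \<noteq> 0 \<longleftrightarrow> s2 g$2$1 * F2 x + s2 g$2$2 \<noteq> 0"
       "\<And>g x. g \<in> G \<Longrightarrow> g$2$1 * x + g$2$2 \<noteq> 0 \<Longrightarrow> F2 (mob g x) = mob (s2 g) (F2 x)"
    and coc: "\<And>h. det h = 1 \<Longrightarrow> \<exists>g\<in>G. \<exists>c. det c = 1 \<and> (\<forall>i j. \<bar>c$i$j\<bar> \<le> C) \<and> h = s1 g ** c"
    and nsing: "\<not> (\<exists>D\<in>sets borel. negligible (F1 ` (- D)) \<and> negligible (F2 ` D))"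
  shows "\<exists>\<alpha> \<beta>. \<alpha> > 0 \<and> (\<forall>x. F2 x = \<alpha> * F1 x + \<beta>)"
proof -
  have "\<exists>X a1 l1 a2 l2 g c. l1 > 0 \<and> l2 > 0 \<and>
    (\<forall>z. \<bar>z\<bar> \<le> real k + 1 \<longrightarrow> \<bar>F1 (X z) - (a1 + l1 * z)\<bar> \<le> l1 / (real k + 1)) \<and>
    (\<forall>z. \<bar>z\<bar> \<le> real k + 1 \<longrightarrow> \<bar>F2 (X z) - (a2 + l2 * z)\<bar> \<le> l2 / (real k + 1)) \<and>
    g \<in> G \<and> det c = 1 \<and> (\<forall>i j. \<bar>c$i$j\<bar> \<le> C) \<and> mat2 (sqrt l1) (a1 / sqrt l1) 0 (1 / sqrt l1) = s1 g ** c" for k :: nat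
  proof -
    have k: "real k + 1 \<ge> 1" by simp
    obtain X a1 l1 a2 l2 where 1: "l1 > 0" "l2 > 0"
      "\<And>z. \<bar>z\<bar> \<le> real k + 1 \<Longrightarrow> \<bar>F1 (X z) - (a1 + l1 * z)\<bar> \<le> l1 / (real k + 1)"
      "\<And>z. \<bar>z\<bar> \<le> real k + 1 \<Longrightarrow> \<bar>F2 (X z) - (a2 + l2 * z)\<bar> \<le> l2 / (real k + 1)"
      by (rule homeo_pair_almost_affine[OF F1 F2 nsing k]) metis
    \<comment> \<open>The matrix of \<open>z \<mapsto> a1 + l1 * z\<close>, scaled to determinant
      1.\<close>
    have "det (mat2 (sqrt l1) (a1 / sqrt l1) 0 (1 / sqrt l1)) = 1" using 1(1) by simp
    from coc[OF this] obtain g c where "g \<in> G" "det c = 1" "\<forall>i j. \<bar>c$i$j\<bar> \<le> C"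
      "mat2 (sqrt l1) (a1 / sqrt l1) 0 (1 / sqrt l1) = s1 g ** c" by blast
    with 1 show ?thesis by blast
  qed
  then obtain X a1 l1 a2 l2 g c where l: "\<And>k. l1 k > 0" "\<And>k. l2 k > 0"
    and X1: "\<And>k z. \<bar>z\<bar> \<le> real k + 1 \<Longrightarrow> \<bar>F1 (X k z) - (a1 k + l1 k * z)\<bar> \<le> l1 k / (real k + 1)"
    and X2: "\<And>k z. \<bar>z\<bar> \<le> real k + 1 \<Longrightarrow> \<bar>F2 (X k z) - (a2 k + l2 k * z)\<bar> \<le> l2 k / (real k + 1)"
    and g: "\<And>k. g k \<in> G" and c: "\<And>k. det (c k) = 1" "\<And>k i j. \<bar>c k$i$j\<bar> \<le> C"
    and hgc: "\<And>k. mat2 (sqrt (l1 k)) (a1 k / sqrt (l1 k)) 0 (1 / sqrt (l1 k)) = s1 (g k) ** c k" by metis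
  \<comment> \<open>The same point \<open>X k z\<close> in the two rescaled coordinates. Both tend
    to \<open>z\<close>, whatever \<open>X k z\<close> itself does.\<close>
  define P where "P k z = (F1 (X k z) - a1 k) / l1 k" for k z
  define Q where "Q k z = (F2 (X k z) - a2 k) / l2 k" for k z
  have PQ: "\<bar>P k z - z\<bar> \<le> inverse (real (Suc k))" "\<bar>Q k z - z\<bar> \<le> inverse (real (Suc k))" if "\<bar>z\<bar> \<le> real k + 1" for k z
  proof -
    have "P k z - z = (F1 (X k z) - (a1 k + l1 k * z)) / l1 k" unfolding P_def using l[of k] by (simp add: field_simps)
    then have "\<bar>P k z - z\<bar> \<le> (l1 k / (real k + 1)) / l1 k"
      using X1[OF that] l[of k] by (simp add: abs_mult divide_right_mono del: divide_divide_eq_left)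
    also have "(l1 k / (real k + 1)) / l1 k = inverse (real (Suc k))"
      using l[of k] by (simp add: inverse_eq_divide add.commute less_imp_neq[symmetric])
    finally show "\<bar>P k z - z\<bar> \<le> inverse (real (Suc k))" .
    have "Q k z - z = (F2 (X k z) - (a2 k + l2 k * z)) / l2 k" unfolding Q_def using l[of k] by (simp add: field_simps)
    then have "\<bar>Q k z - z\<bar> \<le> (l2 k / (real k + 1)) / l2 k"
      using X2[OF that] l[of k] by (simp add: abs_mult divide_right_mono del: divide_divide_eq_left)
    also have "(l2 k / (real k + 1)) / l2 k = inverse (real (Suc k))"
      using l[of k] by (simp add: inverse_eq_divide add.commute less_imp_neq[symmetric])
    finally show "\<bar>Q k z - z\<bar> \<le> inverse (real (Suc k))" .
  qed
  have limz: "(\<lambda>k. Y k z) \<longlonglongrightarrow> z"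
    if "\<And>k. \<bar>z\<bar> \<le> real k + 1 \<Longrightarrow> \<bar>Y k z - z\<bar> \<le> inverse (real (Suc k))" for Y :: "nat \<Rightarrow> real \<Rightarrow> real" and z
  proof (rule Lim_transform_bound[THEN LIM_zero_cancel])
    show "(\<lambda>k. inverse (real (Suc k))) \<longlonglongrightarrow> 0" by (rule LIMSEQ_inverse_real_of_nat)
    obtain n :: nat where n: "\<bar>z\<bar> \<le> real n" using real_arch_simple by blast
    show "eventually (\<lambda>k. norm (Y k z - z) \<le> norm (inverse (real (Suc k)))) sequentially"
      using eventually_ge_at_top[of n]
    proof eventually_elim
      case (elim k)
      then have "\<bar>z\<bar> \<le> real k + 1" using n by linarith
      from that[OF this] show ?case by simp
    qed
  qed
  have limP: "(\<lambda>k. P k z) \<longlonglongrightarrow> z" and limQ: "(\<lambda>k. Q k z) \<longlonglongrightarrow> z" for z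
    by (rule limz, erule PQ(1), rule limz, erule PQ(2))
  define K where "K = {-C..C} \<times> {-C..C} \<times> {-C..C} \<times> {-C..C}"
  have "compact K" unfolding K_def by (intro compact_Times compact_Icc)
  then have seqK: "seq_compact K" by (rule compact_imp_seq_compact)
  have Kin: "\<forall>k. (c k$1$1, c k$1$2, c k$2$1, c k$2$2) \<in> K"
    unfolding K_def using c(2) by (simp add: abs_le_iff minus_le_iff)
  obtain L r where r: "strict_mono (r :: nat \<Rightarrow> nat)"
    and L: "((\<lambda>k. (c k$1$1, c k$1$2, c k$2$1, c k$2$2)) \<circ> r) \<longlonglongrightarrow> L"
    using seq_compactE[OF seqK Kin] by blast
  obtain u11 u12 u21 u22 where Lu: "L = (u11, u12, u21, u22)" by (cases L)
  have cl: "(\<lambda>k. c (r k)$1$1) \<longlonglongrightarrow> u11" "(\<lambda>k. c (r k)$1$2) \<longlonglongrightarrow> u12"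
       "(\<lambda>k. c (r k)$2$1) \<longlonglongrightarrow> u21" "(\<lambda>k. c (r k)$2$2) \<longlonglongrightarrow> u22"
    using L[unfolded Lu o_def, THEN tendsto_fst] L[unfolded Lu o_def, THEN tendsto_snd, THEN tendsto_fst]
      L[unfolded Lu o_def, THEN tendsto_snd, THEN tendsto_snd, THEN tendsto_fst]
      L[unfolded Lu o_def, THEN tendsto_snd, THEN tendsto_snd, THEN tendsto_snd] by simp_all
  define U where "U = mat2 u11 u12 u21 u22"
  have "(\<lambda>k. det (c (r k))) \<longlonglongrightarrow> u11 * u22 - u12 * u21" unfolding det_2 by (intro tendsto_intros cl)
  then have detU: "det U = 1" unfolding U_def det_mat2 c(1) by (rule LIMSEQ_unique[OF _ tendsto_const])
  define f where "f y = F2 (inv F1 y)" for y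
  have iF: "F1 (inv F1 y) = y" "inv F1 (F1 x) = x" for x y
    using F1 by (simp_all add: surj_f_inv_f strict_mono_imp_inj_on)
  have smi: "strict_mono (inv F1)" by (rule strict_monoI) (use strict_mono_less[OF F1(1)] iF(1) in \<open>metis\<close>)
  have surji: "surj (inv F1)" using iF(2) by (metis surjI)
  have conti: "continuous_on UNIV (inv F1)"
    by (rule strict_mono_surj_continuous[OF smi surji])
  have smf: "strict_mono f" unfolding f_def
    using strict_monoD[OF smi] strict_monoD[OF F2(1)] by (intro strict_monoI) blast
  have surjf: "surj f" using comp_surj[OF surji F2(2)] by (simp add: f_def o_def)
  have contf: "continuous_on UNIV f"
    unfolding f_def by (rule continuous_on_compose2[OF strict_mono_surj_continuous[OF F2] conti]) auto
  have lim: "(\<lambda>k. f (mob (c (r k)) (P (r k) z))) \<longlonglongrightarrow> f (mob U z)"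
    "eventually (\<lambda>k. c (r k)$2$1 * P (r k) z + c (r k)$2$2 \<noteq> 0) sequentially"
    if z: "U$2$1 * z + U$2$2 \<noteq> 0" for z
  proof -
    have Pr: "(\<lambda>k. P (r k) z) \<longlonglongrightarrow> z" using LIMSEQ_subseq_LIMSEQ[OF limP r] by (simp add: o_def)
    have dn: "(\<lambda>k. c (r k)$2$1 * P (r k) z + c (r k)$2$2) \<longlonglongrightarrow> U$2$1 * z + U$2$2"
      unfolding U_def mat2_nth by (intro tendsto_intros cl Pr)
    have nm: "(\<lambda>k. c (r k)$1$1 * P (r k) z + c (r k)$1$2) \<longlonglongrightarrow> U$1$1 * z + U$1$2"
      unfolding U_def mat2_nth by (intro tendsto_intros cl Pr)
    have "(\<lambda>k. mob (c (r k)) (P (r k) z)) \<longlonglongrightarrow> mob U z"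
      unfolding mob_def by (rule tendsto_divide[OF nm dn z])
    then show "(\<lambda>k. f (mob (c (r k)) (P (r k) z))) \<longlonglongrightarrow> f (mob U z)"
      by (rule continuous_on_tendsto_compose[OF contf]) auto
    show "eventually (\<lambda>k. c (r k)$2$1 * P (r k) z + c (r k)$2$2 \<noteq> 0) sequentially"
      using tendsto_imp_eventually_ne[OF dn z] .
  qed
  \<comment> \<open>The point \<open>x\<close> with \<open>F1 x = mob (c k) (P k z)\<close> is moved
    by \<open>g k\<close> to \<open>X k z\<close>, since \<open>s1 (g k) ** c k\<close> is the
    affine map and \<open>P k z\<close> the rescaled coordinate of that point. Applying
    \<open>F2\<close> gives the equation for \<open>f\<close>.\<close>
  have image: "\<exists>\<delta>. \<delta> \<noteq> 0 \<and> mob (s2 (g k)) (f (mob (c k) (P k z))) = a2 k + l2 k * Q k z \<and>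
      \<delta> = s2 (g k)$2$1 * f (mob (c k) (P k z)) + s2 (g k)$2$2"
    if nz: "c k$2$1 * P k z + c k$2$2 \<noteq> 0" for k z
  proof -
    let ?h = "mat2 (sqrt (l1 k)) (a1 k / sqrt (l1 k)) 0 (1 / sqrt (l1 k))"
    define x where "x = inv F1 (mob (c k) (P k z))"
    have Fx: "F1 x = mob (c k) (P k z)" by (simp add: x_def iF)
    have h0: "?h$2$1 * P k z + ?h$2$2 \<noteq> 0" using l[of k] by simp
    have s0: "s1 (g k)$2$1 * F1 x + s1 (g k)$2$2 \<noteq> 0"
      using h0 mob_mult(1)[OF nz, of "s1 (g k)"] unfolding hgc Fx by auto
    then have g0: "g k$2$1 * x + g k$2$2 \<noteq> 0" using eq1(1)[OF g] by blast
    have "F1 (mob (g k) x) = mob ?h (P k z)"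
      unfolding eq1(2)[OF g g0] hgc mob_mult(2)[OF nz] Fx ..
    also have "\<dots> = (sqrt (l1 k) * sqrt (l1 k)) * P k z + a1 k" using l(1)[of k] by (simp add: mob_def field_simps)
    also have "\<dots> = l1 k * P k z + a1 k" using l(1)[of k] by simp
    also have "\<dots> = F1 (X k z)" using l(1)[of k] by (simp add: P_def)
    finally have "mob (g k) x = X k z" using iF(2) by metis
    then have "mob (s2 (g k)) (F2 x) = F2 (X k z)" using eq2(2)[OF g g0] by simp
    also have "\<dots> = a2 k + l2 k * Q k z" using l(2)[of k] by (simp add: Q_def)
    finally show ?thesis using eq2(1)[OF g] g0 by (auto simp: f_def x_def)
  qed
  \<comment> \<open>By \<open>mob_diff\<close> each difference of the \<open>y\<close> is one of the
    \<open>Q k z\<close> times \<open>l2 k\<close> and two denominators; each of the four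
    denominators occurs once on either side.\<close>
  have crk: "(y1 - y2) * (y3 - y4) * ((Q k z1 - Q k z4) * (Q k z3 - Q k z2))
        = (Q k z1 - Q k z2) * (Q k z3 - Q k z4) * ((y1 - y4) * (y3 - y2))"
    if "c k$2$1 * P k z1 + c k$2$2 \<noteq> 0" "c k$2$1 * P k z2 + c k$2$2 \<noteq> 0"
      "c k$2$1 * P k z3 + c k$2$2 \<noteq> 0" "c k$2$1 * P k z4 + c k$2$2 \<noteq> 0"
      and y: "y1 = f (mob (c k) (P k z1))" "y2 = f (mob (c k) (P k z2))"
        "y3 = f (mob (c k) (P k z3))" "y4 = f (mob (c k) (P k z4))" for k z1 z2 z3 z4 y1 y2 y3 y4
  proof -
    let ?d = "\<lambda>y. s2 (g k)$2$1 * y + s2 (g k)$2$2"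
    have i: "?d y1 \<noteq> 0" "?d y2 \<noteq> 0" "?d y3 \<noteq> 0" "?d y4 \<noteq> 0"
      "mob (s2 (g k)) y1 = a2 k + l2 k * Q k z1" "mob (s2 (g k)) y2 = a2 k + l2 k * Q k z2"
      "mob (s2 (g k)) y3 = a2 k + l2 k * Q k z3" "mob (s2 (g k)) y4 = a2 k + l2 k * Q k z4"
      using image[OF that(1)] image[OF that(2)] image[OF that(3)] image[OF that(4)] unfolding y by auto
    have df: "y - y' = l2 k * (q - q') * (?d y * ?d y')"
      if "?d y \<noteq> 0" "?d y' \<noteq> 0" "mob (s2 (g k)) y = a2 k + l2 k * q" "mob (s2 (g k)) y' = a2 k + l2 k * q'" for y y' q q'
    proof -
      have "l2 k * (q - q') = mob (s2 (g k)) y - mob (s2 (g k)) y'" unfolding that(3,4) by (simp add: right_diff_distrib)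
      also have "\<dots> = (y - y') / (?d y * ?d y')" by (rule mob_diff[OF det[OF g] that(1,2)])
      finally show ?thesis using that(1,2) by simp
    qed
    show ?thesis
      unfolding df[OF i(1,2,5,6)] df[OF i(3,4,7,8)] df[OF i(1,4,5,8)] df[OF i(3,2,7,6)] by (simp only: mult_ac)
  qed
  have crU: "(f (mob U z1) - f (mob U z2)) * (f (mob U z3) - f (mob U z4)) * ((z1 - z4) * (z3 - z2))
        = (z1 - z2) * (z3 - z4) * ((f (mob U z1) - f (mob U z4)) * (f (mob U z3) - f (mob U z2)))"
    if n: "U$2$1 * z1 + U$2$2 \<noteq> 0" "U$2$1 * z2 + U$2$2 \<noteq> 0" "U$2$1 * z3 + U$2$2 \<noteq> 0" "U$2$1 * z4 + U$2$2 \<noteq> 0"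
    for z1 z2 z3 z4
  proof -
    let ?y = "\<lambda>k z. f (mob (c (r k)) (P (r k) z))"
    have Qr: "(\<lambda>k. Q (r k) z) \<longlonglongrightarrow> z" for z using LIMSEQ_subseq_LIMSEQ[OF limQ r] by (simp add: o_def)
    have ev: "eventually (\<lambda>k. (?y k z1 - ?y k z2) * (?y k z3 - ?y k z4) * ((Q (r k) z1 - Q (r k) z4) * (Q (r k) z3 - Q (r k) z2))
        = (Q (r k) z1 - Q (r k) z2) * (Q (r k) z3 - Q (r k) z4) * ((?y k z1 - ?y k z4) * (?y k z3 - ?y k z2))) sequentially"
      using lim(2)[OF n(1)] lim(2)[OF n(2)] lim(2)[OF n(3)] lim(2)[OF n(4)]
      by eventually_elim (rule crk[OF _ _ _ _ refl refl refl refl])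
    have L1: "(\<lambda>k. (?y k z1 - ?y k z2) * (?y k z3 - ?y k z4) * ((Q (r k) z1 - Q (r k) z4) * (Q (r k) z3 - Q (r k) z2)))
      \<longlonglongrightarrow> (f (mob U z1) - f (mob U z2)) * (f (mob U z3) - f (mob U z4)) * ((z1 - z4) * (z3 - z2))"
      by (intro tendsto_intros lim(1) n Qr)
    have L2: "(\<lambda>k. (Q (r k) z1 - Q (r k) z2) * (Q (r k) z3 - Q (r k) z4) * ((?y k z1 - ?y k z4) * (?y k z3 - ?y k z2)))
      \<longlonglongrightarrow> (z1 - z2) * (z3 - z4) * ((f (mob U z1) - f (mob U z4)) * (f (mob U z3) - f (mob U z2)))"
      by (intro tendsto_intros lim(1) n Qr)
    show ?thesis by (rule tendsto_unique[OF _ L1]) (simp, rule tendsto_cong[THEN iffD2, OF ev L2])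
  qed
  \<comment> \<open>The image of infinity, the one value that \<open>U\<close> does not take at
    finite points. If \<open>U$2$1 = 0\<close>, division yields 0, and excluding that point does no
    harm.\<close>
  define p where "p = U$1$1 / U$2$1"
  have hit: "\<exists>z. U$2$1 * z + U$2$2 \<noteq> 0 \<and> mob U z = y" if "y \<noteq> p" for y
  proof -
    have d: "U$1$1 * U$2$2 - U$1$2 * U$2$1 = 1" using detU by (simp add: det_2)
    define q where "q = U$1$1 - U$2$1 * y"
    have q: "q \<noteq> 0"
    proof
      assume "q = 0"
      then have e: "U$1$1 = U$2$1 * y" by (simp add: q_def)
      then have "U$2$1 \<noteq> 0" using d by auto
      then show False using e that by (simp add: p_def)
    qed
    define z where "z = (U$2$2 * y - U$1$2) / q"
    have zq: "z * q = U$2$2 * y - U$1$2" using q by (simp add: z_def)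
    have "(U$2$1 * z + U$2$2) * q = U$2$1 * (z * q) + U$2$2 * q" by (simp add: algebra_simps)
    also have "\<dots> = U$1$1 * U$2$2 - U$1$2 * U$2$1" unfolding zq unfolding q_def by (simp add: algebra_simps)
    finally have den: "(U$2$1 * z + U$2$2) * q = 1" using d by simp
    have "(U$1$1 * z + U$1$2) * q = U$1$1 * (z * q) + U$1$2 * q" by (simp add: algebra_simps)
    also have "\<dots> = (U$1$1 * U$2$2 - U$1$2 * U$2$1) * y" unfolding zq unfolding q_def by (simp add: algebra_simps)
    finally have num: "(U$1$1 * z + U$1$2) * q = y" using d by simp
    have den0: "U$2$1 * z + U$2$2 \<noteq> 0" using den by auto
    have "mob U z = ((U$1$1 * z + U$1$2) * q) / ((U$2$1 * z + U$2$2) * q)"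
      unfolding mob_def by (rule mult_divide_mult_cancel_right[OF q, symmetric])
    also have "\<dots> = y" unfolding den num by simp
    finally show ?thesis using den0 by blast
  qed
  have cr: "(f a - f b) * (f c - f d) * ((a - d) * (c - b)) = (a - b) * (c - d) * ((f a - f d) * (f c - f b))"
    if ne: "a \<noteq> p" "b \<noteq> p" "c \<noteq> p" "d \<noteq> p" for a b c d
  proof -
    let ?d = "\<lambda>z. U$2$1 * z + U$2$2"
    obtain z1 z2 z3 z4 where z: "?d z1 \<noteq> 0" "mob U z1 = a" "?d z2 \<noteq> 0" "mob U z2 = b"
      "?d z3 \<noteq> 0" "mob U z3 = c" "?d z4 \<noteq> 0" "mob U z4 = d" using hit ne by metis
    have df: "mob U x - mob U y = (x - y) * (inverse (?d x) * inverse (?d y))" if "?d x \<noteq> 0" "?d y \<noteq> 0" for x y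
      using mob_diff[OF detU that] by (simp add: divide_inverse)
    have e: "a - b = (z1 - z2) * (inverse (?d z1) * inverse (?d z2))" "c - d = (z3 - z4) * (inverse (?d z3) * inverse (?d z4))"
      "a - d = (z1 - z4) * (inverse (?d z1) * inverse (?d z4))" "c - b = (z3 - z2) * (inverse (?d z3) * inverse (?d z2))"
      using df[OF z(1,3)] df[OF z(5,7)] df[OF z(1,7)] df[OF z(5,3)] z by simp_all
    let ?i = "inverse (?d z1) * inverse (?d z2) * inverse (?d z3) * inverse (?d z4)"
    have "(f a - f b) * (f c - f d) * ((a - d) * (c - b))
      = (f a - f b) * (f c - f d) * ((z1 - z4) * (z3 - z2)) * ?i" unfolding e by (simp only: mult_ac)
    also have "\<dots> = (z1 - z2) * (z3 - z4) * ((f a - f d) * (f c - f b)) * ?i"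
      using crU[OF z(1,3,5,7)] z by simp
    also have "\<dots> = (a - b) * (c - d) * ((f a - f d) * (f c - f b))" unfolding e by (simp only: mult_ac)
    finally show ?thesis .
  qed
  obtain \<alpha> \<beta> where ab: "\<alpha> > 0" "\<forall>x. f x = \<alpha> * x + \<beta>"
    using cross_ratio_preserving_affine[OF smf surjf cr] by blast
  have "F2 x = \<alpha> * F1 x + \<beta>" for x using ab(2)[rule_format, of "F1 x"] by (simp add: f_def iF(2))
  then show ?thesis using ab(1) by blast
qed

section \<open>One-dimensional Hausdorff measure zero\<close>

text \<open>The mesh bound comes for free: in a cover of total diameter at most \<open>d\<close>
  every piece has diameter at most \<open>d\<close>.\<close>

lemma hausdorff1_zeroI:
  assumes "\<And>e. e > 0 \<Longrightarrow> \<exists>U :: nat \<Rightarrow> 'a::metric_space set. S \<subseteq> (\<Union>i. U i) \<and> (\<forall>i. bounded (U i)) \<and>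
     (\<Sum>i. ennreal (diameter (U i))) \<le> ennreal e"
  shows "hausdorff1 S = 0"
proof -
  have "(INF U\<in>{U :: nat \<Rightarrow> 'a set. S \<subseteq> (\<Union>i. U i) \<and>
        (\<forall>i. bounded (U i) \<and> diameter (U i) \<le> d)}. (\<Sum>i. ennreal (diameter (U i)))) \<le> 0" if d: "d > 0" for d
  proof (rule ennreal_le_epsilon)
    fix e :: real assume e: "0 < e"
    define e' where "e' = min e d"
    have e': "e' > 0" "e' \<le> e" "e' \<le> d" using e d by (auto simp: e'_def)
    obtain U :: "nat \<Rightarrow> 'a set" where U: "S \<subseteq> (\<Union>i. U i)" "\<forall>i. bounded (U i)"
      "(\<Sum>i. ennreal (diameter (U i))) \<le> ennreal e'" using assms[OF e'(1)] by blast
    have "diameter (U i) \<le> d" for i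
    proof -
      have "ennreal (diameter (U i)) \<le> (\<Sum>i. ennreal (diameter (U i)))"
        using sum_le_suminf[of "\<lambda>i. ennreal (diameter (U i))" "{i}"] by simp
      also have "\<dots> \<le> ennreal d" using U(3) e'(3) by (meson ennreal_leI order_trans)
      finally show ?thesis using d by simp
    qed
    then have "(INF U\<in>{U :: nat \<Rightarrow> 'a set. S \<subseteq> (\<Union>i. U i) \<and>
        (\<forall>i. bounded (U i) \<and> diameter (U i) \<le> d)}. (\<Sum>i. ennreal (diameter (U i)))) \<le> (\<Sum>i. ennreal (diameter (U i)))"
      using U by (intro INF_lower) auto
    also have "\<dots> \<le> ennreal e" using U(3) e'(2) by (meson ennreal_leI order_trans)
    finally show "(INF U\<in>{U :: nat \<Rightarrow> 'a set. S \<subseteq> (\<Union>i. U i) \<and>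
        (\<forall>i. bounded (U i) \<and> diameter (U i) \<le> d)}. (\<Sum>i. ennreal (diameter (U i)))) \<le> 0 + ennreal e" by simp
  qed
  then have "hausdorff1 S \<le> 0" unfolding hausdorff1_def by (intro SUP_least) auto
  then show ?thesis by simp
qed

lemma hausdorff1_zeroD:
  fixes S :: "'a::metric_space set"
  assumes "hausdorff1 S = 0" "e > 0"
  shows "\<exists>U :: nat \<Rightarrow> 'a set. S \<subseteq> (\<Union>i. U i) \<and> (\<forall>i. bounded (U i)) \<and> (\<Sum>i. ennreal (diameter (U i))) < ennreal e"
proof -
  let ?I = "INF U\<in>{U :: nat \<Rightarrow> 'a set. S \<subseteq> (\<Union>i. U i) \<and>
        (\<forall>i. bounded (U i) \<and> diameter (U i) \<le> 1)}. (\<Sum>i. ennreal (diameter (U i)))"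
  have "?I \<le> hausdorff1 S" unfolding hausdorff1_def by (rule SUP_upper) auto
  also have "\<dots> < ennreal e" using assms by simp
  finally obtain U :: "nat \<Rightarrow> 'a set" where "U \<in> {U. S \<subseteq> (\<Union>i. U i) \<and> (\<forall>i. bounded (U i) \<and> diameter (U i) \<le> 1)}"
    "(\<Sum>i. ennreal (diameter (U i))) < ennreal e" unfolding INF_less_iff by (elim bexE)
  then show ?thesis by (intro exI[of _ U]) auto
qed

lemma hausdorff1_zero_imp_negligible:
  fixes \<Phi> :: "'b \<Rightarrow> 'a::metric_space" and F :: "'b \<Rightarrow> real"
  assumes h: "hausdorff1 (\<Phi> ` X) = 0" and C: "C \<ge> 0"
    and lip: "\<And>x y. x \<in> X \<Longrightarrow> y \<in> X \<Longrightarrow> \<bar>F x - F y\<bar> \<le> C * dist (\<Phi> x) (\<Phi> y)"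
  shows "negligible (F ` X)"
proof (rule negligible_emeasureI)
  fix e :: real assume e: "e > 0"
  \<comment> \<open>\<open>C + 1\<close> in place of \<open>C\<close> covers the case
    \<open>C = 0\<close>.\<close>
  define e' where "e' = e / (2 * (C + 1))"
  have e': "e' > 0" using e C by (simp add: e'_def)
  obtain U where U: "\<Phi> ` X \<subseteq> (\<Union>i::nat. U i)" "\<forall>i. bounded (U i)" "(\<Sum>i. ennreal (diameter (U i))) < ennreal e'"
    using hausdorff1_zeroD[OF h e'] by blast
  define c where "c n = F (SOME x. x \<in> X \<and> \<Phi> x \<in> U n)" for n
  define r where "r n = C * diameter (U n)" for n
  define T where "T = (\<Union>n. {c n - r n..c n + r n})"
  have "F ` X \<subseteq> T"
  proof
    fix y assume "y \<in> F ` X"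
    then obtain x where x: "x \<in> X" "y = F x" by blast
    then obtain n where n: "\<Phi> x \<in> U n" using U(1) by blast
    define x0 where "x0 = (SOME x. x \<in> X \<and> \<Phi> x \<in> U n)"
    have x0: "x0 \<in> X \<and> \<Phi> x0 \<in> U n" unfolding x0_def by (rule someI[of _ x]) (use x n in auto)
    have "\<bar>F x - F x0\<bar> \<le> C * dist (\<Phi> x) (\<Phi> x0)" using lip x x0 by blast
    also have "\<dots> \<le> C * diameter (U n)"
      using x0 n U(2) C by (intro mult_left_mono diameter_bounded_bound) auto
    finally have "y \<in> {c n - r n..c n + r n}"
      unfolding c_def x0_def[symmetric] r_def x(2) by (auto simp: abs_le_iff)
    then show "y \<in> T" unfolding T_def by blast
  qed
  moreover have "emeasure lborel T \<le> ennreal (2 * (C * e'))"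
    unfolding T_def
  proof (rule countable_interval_cover_measure)
    have d0: "diameter (U n) \<ge> 0" for n using U(2) diameter_ge_0 by blast
    show "r n \<ge> 0" for n using C d0 by (simp add: r_def)
    show "C * e' \<ge> 0" using C e' by simp
    have "(\<Sum>n. ennreal (r n)) = ennreal C * (\<Sum>n. ennreal (diameter (U n)))"
      unfolding r_def using C d0 by (simp add: ennreal_mult)
    also have "\<dots> \<le> ennreal C * ennreal e'" using U(3) by (intro mult_left_mono) auto
    finally show "(\<Sum>n. ennreal (r n)) \<le> ennreal (C * e')" using C e' by (simp add: ennreal_mult)
  qed
  moreover have "2 * (C * e') \<le> e" unfolding e'_def using C e by (simp add: field_simps)
  moreover have "T \<in> sets borel" unfolding T_def by auto
  ultimately show "\<exists>T\<in>sets borel. F ` X \<subseteq> T \<and> emeasure lborel T \<le> ennreal e"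
    by (meson ennreal_leI order_trans)
qed

lemma negligible_open_cover:
  fixes N :: "real set"
  assumes "negligible N" "e > 0"
  shows "\<exists>V. open V \<and> N \<subseteq> V \<and> emeasure lborel V < ennreal e"
proof -
  have "N \<in> sets lebesgue" using assms(1) by (simp add: negligible_imp_sets)
  then obtain V where V: "open V" "N \<subseteq> V" "V - N \<in> lmeasurable" "emeasure lebesgue (V - N) < ennreal e"
    using sets_lebesgue_outer_open[OF _ assms(2)] by metis
  have "emeasure lborel V = emeasure lebesgue V" using V(1) by (simp add: emeasure_completion)
  also have "\<dots> = emeasure lebesgue ((V - N) \<union> N)" using V(2) by (simp add: Un_absorb2)
  also have "\<dots> = emeasure lebesgue (V - N)"
    by (rule emeasure_Un_null_set) (use V assms(1) in \<open>auto simp: negligible_iff_null_sets\<close>)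
  finally show ?thesis using V by auto
qed

text \<open>One cover must serve all \<open>F i\<close> at once. The components of the common open
  set \<open>W\<close> do: for each \<open>i\<close> their images are disjoint intervals inside
  \<open>V i\<close>, so their lengths add up to less than \<open>e'\<close>. The diameter of a
  piece of the curve is at most \<open>K\<close> times the sum over \<open>i\<close> of these
  lengths.\<close>

lemma negligible_imp_hausdorff1_zero:
  fixes \<Phi> :: "real \<Rightarrow> 'a::metric_space" and F :: "'n::finite \<Rightarrow> real \<Rightarrow> real"
  assumes F: "\<And>i. strict_mono (F i)" "\<And>i. surj (F i)" and K: "K \<ge> 0"
    and lip: "\<And>x y. dist (\<Phi> x) (\<Phi> y) \<le> K * (\<Sum>i\<in>UNIV. \<bar>F i x - F i y\<bar>)"
    and neg: "\<And>i. negligible (F i ` X)" and S: "S \<subseteq> insert p (\<Phi> ` X)"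
  shows "hausdorff1 S = 0"
proof (rule hausdorff1_zeroI)
  fix e :: real assume e: "e > 0"
  define N where "N = real CARD('n)"
  define e' where "e' = e / (K * N + 1)"
  have N: "N \<ge> 0" by (simp add: N_def)
  have KN: "K * N \<ge> 0" using K N by simp
  have e': "e' > 0" using e KN by (simp add: e'_def)
  have "\<exists>V. open V \<and> F i ` X \<subseteq> V \<and> emeasure lborel V < ennreal e'" for i
    by (rule negligible_open_cover[OF neg e'])
  then obtain V where V: "\<And>i. open (V i)" "\<And>i. F i ` X \<subseteq> V i" "\<And>i. emeasure lborel (V i) < ennreal e'" by metis
  \<comment> \<open>\<open>W\<close> may have infinite Lebesgue measure. In the coordinate
    \<open>F i0\<close> it becomes a subset of \<open>V i0\<close> of finite measure, so it is cut
    into intervals there.\<close>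
  define W where "W = (\<Inter>i. F i -` V i)"
  have cF: "continuous_on UNIV (F i)" for i by (rule strict_mono_surj_continuous[OF F])
  have oW: "open W" unfolding W_def using V(1) cF by (intro open_INT) (auto intro: open_vimage)
  have XW: "X \<subseteq> W" unfolding W_def using V(2) by blast
  obtain i0 :: 'n where True by blast
  have less: "F i x < F i y \<longleftrightarrow> x < y" for i x y by (rule strict_mono_less[OF F(1)])
  have iF: "F i0 (inv (F i0) y) = y" for y using F(2) by (simp add: surj_f_inv_f)
  have iF2: "inv (F i0) (F i0 y) = y" for y using F(1) by (simp add: inv_f_f strict_mono_imp_inj_on)
  have smi: "strict_mono (inv (F i0))" using less[of i0] iF by (intro strict_monoI) metis
  have surji: "surj (inv (F i0))" using iF2 by (metis surjI)
  have "F i0 ` W = inv (F i0) -` W"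
  proof (intro set_eqI iffI)
    fix y assume "y \<in> inv (F i0) -` W"
    then show "y \<in> F i0 ` W" using iF[of y] by (intro image_eqI[of _ _ "inv (F i0) y"]) auto
  qed (auto simp: iF2)
  then have oFW: "open (F i0 ` W)"
    using open_vimage[OF oW strict_mono_surj_continuous[OF smi surji]] by simp
  have "F i0 ` W \<subseteq> V i0" unfolding W_def by blast
  then have "emeasure lborel (F i0 ` W) \<le> emeasure lborel (V i0)" using V(1) by (intro emeasure_mono) auto
  also have "\<dots> < \<infinity>" using V(3)[of i0] by (rule less_trans) simp
  finally have fin: "emeasure lborel (F i0 ` W) < \<infinity>" .
  have "\<exists>(a :: nat \<Rightarrow> real) b. (\<forall>n. a n \<le> b n) \<and> disjoint_family (\<lambda>n. {a n<..<b n}) \<and> (\<Union>n. {a n<..<b n}) = F i0 ` W"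
    by (rule open_real_disjoint_intervals[OF oFW fin]) blast
  then obtain a b :: "nat \<Rightarrow> real" where ab: "\<And>n. a n \<le> b n" "disjoint_family (\<lambda>n. {a n<..<b n})"
    "(\<Union>n. {a n<..<b n}) = F i0 ` W" by blast
  define \<alpha> where "\<alpha> n = inv (F i0) (a n)" for n
  define \<beta> where "\<beta> n = inv (F i0) (b n)" for n
  have \<alpha>\<beta>: "\<alpha> n \<le> \<beta> n" for n unfolding \<alpha>_def \<beta>_def using ab(1) strict_mono_less_eq[OF smi] by blast
  have J: "F i0 ` {\<alpha> n<..<\<beta> n} = {a n<..<b n}" for n
    unfolding strict_mono_surj_image_Ioo[OF F] \<alpha>_def \<beta>_def iF ..
  have Jd: "{\<alpha> m<..<\<beta> m} \<inter> {\<alpha> n<..<\<beta> n} = {}" if "m \<noteq> n" for m n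
  proof (rule ccontr)
    assume "\<not> ?thesis"
    then obtain x where "x \<in> {\<alpha> m<..<\<beta> m}" "x \<in> {\<alpha> n<..<\<beta> n}" by blast
    then have "F i0 x \<in> {a m<..<b m} \<inter> {a n<..<b n}" unfolding J[symmetric] by blast
    then show False using disjoint_family_onD[OF ab(2) _ _ that] by auto
  qed
  have JW: "{\<alpha> n<..<\<beta> n} \<subseteq> W" for n
  proof
    fix x assume "x \<in> {\<alpha> n<..<\<beta> n}"
    then have "F i0 x \<in> F i0 ` W" unfolding ab(3)[symmetric] using J[of n] by blast
    then obtain y where "y \<in> W" "F i0 x = F i0 y" by blast
    then show "x \<in> W" using strict_mono_eq[OF F(1)] by metis
  qed
  have WJ: "W \<subseteq> (\<Union>n. {\<alpha> n<..<\<beta> n})"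
  proof
    fix x assume "x \<in> W"
    then have "F i0 x \<in> (\<Union>n. {a n<..<b n})" unfolding ab(3) by blast
    then obtain n where "F i0 x \<in> F i0 ` {\<alpha> n<..<\<beta> n}" unfolding J by blast
    then obtain y where "y \<in> {\<alpha> n<..<\<beta> n}" "F i0 x = F i0 y" by blast
    then show "x \<in> (\<Union>n. {\<alpha> n<..<\<beta> n})" using strict_mono_eq[OF F(1)] by auto
  qed
  have len: "(\<Sum>n. ennreal (F i (\<beta> n) - F i (\<alpha> n))) \<le> ennreal e'" for i
  proof -
    have le: "F i (\<alpha> n) \<le> F i (\<beta> n)" for n using \<alpha>\<beta> strict_mono_less_eq[OF F(1)] by blast
    have dj: "disjoint_family (\<lambda>n. F i ` {\<alpha> n<..<\<beta> n})"
      unfolding disjoint_family_on_def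
    proof (intro ballI impI)
      fix m n :: nat assume "m \<noteq> n"
      then show "F i ` {\<alpha> m<..<\<beta> m} \<inter> F i ` {\<alpha> n<..<\<beta> n} = {}"
        using Jd by (simp add: image_Int[OF strict_mono_imp_inj_on[OF F(1)], symmetric])
    qed
    have "(\<Sum>n. ennreal (F i (\<beta> n) - F i (\<alpha> n))) = (\<Sum>n. emeasure lborel (F i ` {\<alpha> n<..<\<beta> n}))"
      unfolding strict_mono_surj_image_Ioo[OF F] using le by simp
    also have "\<dots> = emeasure lborel (\<Union>n. F i ` {\<alpha> n<..<\<beta> n})"
      by (rule suminf_emeasure[OF _ dj]) (auto simp: strict_mono_surj_image_Ioo[OF F])
    also have "\<dots> \<le> emeasure lborel (V i)"
    proof (rule emeasure_mono)
      show "(\<Union>n. F i ` {\<alpha> n<..<\<beta> n}) \<subseteq> V i"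
      proof
        fix y assume "y \<in> (\<Union>n. F i ` {\<alpha> n<..<\<beta> n})"
        then obtain n x where "x \<in> {\<alpha> n<..<\<beta> n}" "y = F i x" by blast
        then show "y \<in> V i" using JW[of n] unfolding W_def by blast
      qed
    qed (use V(1) in simp)
    finally show ?thesis using V(3)[of i] by simp
  qed
  \<comment> \<open>Index 0 takes care of the extra point \<open>p\<close> at no cost in
    diameter.\<close>
  define U where "U n = (case n of 0 \<Rightarrow> {p} | Suc n \<Rightarrow> \<Phi> ` {\<alpha> n<..<\<beta> n})" for n
  define D where "D n = K * (\<Sum>i\<in>UNIV. F i (\<beta> n) - F i (\<alpha> n))" for n
  have inc: "\<bar>F i x - F i y\<bar> \<le> F i (\<beta> n) - F i (\<alpha> n)" if "x \<in> {\<alpha> n<..<\<beta> n}" "y \<in> {\<alpha> n<..<\<beta> n}" for x y n i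
  proof -
    have "F i (\<alpha> n) < F i x" "F i x < F i (\<beta> n)" "F i (\<alpha> n) < F i y" "F i y < F i (\<beta> n)" using that less by auto
    then show ?thesis by linarith
  qed
  have dD: "dist (\<Phi> x) (\<Phi> y) \<le> D n" if "x \<in> {\<alpha> n<..<\<beta> n}" "y \<in> {\<alpha> n<..<\<beta> n}" for x y n
  proof -
    have "dist (\<Phi> x) (\<Phi> y) \<le> K * (\<Sum>i\<in>UNIV. \<bar>F i x - F i y\<bar>)" by (rule lip)
    also have "\<dots> \<le> D n" unfolding D_def using K inc[OF that] by (intro mult_left_mono sum_mono) auto
    finally show ?thesis .
  qed
  have D0: "D n \<ge> 0" for n unfolding D_def
    using K \<alpha>\<beta> strict_mono_less_eq[OF F(1)] by (intro mult_nonneg_nonneg sum_nonneg) auto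
  have bd: "bounded (\<Phi> ` {\<alpha> n<..<\<beta> n})" for n
  proof (cases "{\<alpha> n<..<\<beta> n} = {}")
    case False
    then obtain x where "x \<in> {\<alpha> n<..<\<beta> n}" by blast
    then show ?thesis unfolding bounded_def using dD by blast
  qed simp
  have diam: "diameter (\<Phi> ` {\<alpha> n<..<\<beta> n}) \<le> D n" for n
  proof (cases "{\<alpha> n<..<\<beta> n} = {}")
    case False
    then show ?thesis unfolding diameter_def using dD by (auto intro!: cSUP_least)
  qed (use D0 in simp)
  have "S \<subseteq> (\<Union>n. U n)"
  proof
    fix y assume "y \<in> S"
    then consider "y = p" | x where "x \<in> X" "y = \<Phi> x" using S by blast
    then show "y \<in> (\<Union>n. U n)"
    proof cases
      case 1
      then have "y \<in> U 0" by (simp add: U_def)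
      then show ?thesis by blast
    next
      case 2
      then obtain n where "x \<in> {\<alpha> n<..<\<beta> n}" using XW WJ by blast
      then have "y \<in> U (Suc n)" using 2 by (simp add: U_def)
      then show ?thesis by blast
    qed
  qed
  moreover have "\<forall>n. bounded (U n)" using bd by (simp add: U_def split: nat.split)
  moreover have "(\<Sum>n. ennreal (diameter (U n))) \<le> ennreal e"
  proof -
    have "(\<Sum>n. ennreal (diameter (U n))) = (\<Sum>n. ennreal (diameter (U (Suc n)))) + ennreal (diameter (U 0))"
      using suminf_offset[of "\<lambda>n. ennreal (diameter (U n))" 1] by simp
    also have "\<dots> = (\<Sum>n. ennreal (diameter (\<Phi> ` {\<alpha> n<..<\<beta> n})))" by (simp add: U_def)
    also have "\<dots> \<le> (\<Sum>n. ennreal (D n))" using diam by (intro suminf_le ennreal_leI) auto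
    also have "\<dots> = (\<Sum>n. \<Sum>i\<in>UNIV. ennreal K * ennreal (F i (\<beta> n) - F i (\<alpha> n)))"
    proof (rule suminf_cong)
      fix n
      have le: "F i (\<alpha> n) \<le> F i (\<beta> n)" for i using \<alpha>\<beta> strict_mono_less_eq[OF F(1)] by blast
      show "ennreal (D n) = (\<Sum>i\<in>UNIV. ennreal K * ennreal (F i (\<beta> n) - F i (\<alpha> n)))"
        unfolding D_def using K le by (simp add: ennreal_mult sum_nonneg sum_distrib_left[symmetric] sum_ennreal)
    qed
    also have "\<dots> = (\<Sum>i\<in>UNIV. \<Sum>n. ennreal K * ennreal (F i (\<beta> n) - F i (\<alpha> n)))"
      by (rule suminf_sum) auto
    also have "\<dots> \<le> (\<Sum>i\<in>(UNIV::'n set). ennreal (K * e'))"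
      using len K e' by (intro sum_mono) (simp add: ennreal_mult mult_left_mono)
    also have "\<dots> = ennreal (N * (K * e'))" using K e' by (simp add: N_def ennreal_mult ennreal_of_nat_eq_real_of_nat)
    also have "\<dots> \<le> ennreal e"
    proof (rule ennreal_leI)
      have "N * (K * e') = (K * N) * e / (K * N + 1)" by (simp add: e'_def)
      also have "\<dots> \<le> e" using KN e by (simp add: field_simps)
      finally show "N * (K * e') \<le> e" .
    qed
    finally show ?thesis .
  qed
  ultimately show "\<exists>U :: nat \<Rightarrow> 'a set. S \<subseteq> (\<Union>i. U i) \<and> (\<forall>i. bounded (U i)) \<and> (\<Sum>i. ennreal (diameter (U i))) \<le> ennreal e"
    by blast
qed

section \<open>Projections and lines in the plane\<close>

text \<open>Existence and uniqueness of the foot of the perpendicular give the definite description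
  in \<open>orthproj\<close> a meaning, and linearity makes \<open>matrix\<close> represent
  it.\<close>

lemma orthproj_eqI:
  fixes L :: "(real^'m) set"
  assumes L: "subspace L" and y: "y \<in> L" "\<And>z. z \<in> L \<Longrightarrow> inner (x - y) z = 0"
  shows "orthproj L *v x = y"
proof -
  let ?P = "\<lambda>x y. y \<in> L \<and> (\<forall>z\<in>L. inner (x - y) z = 0)"
  have uniq: "a = b" if "?P x a" "?P x b" for x a b
  proof -
    have "a - b \<in> L" using that L by (simp add: subspace_diff)
    then have "inner (x - b) (a - b) = 0" "inner (x - a) (a - b) = 0" using that by blast+
    then have "inner (a - b) (a - b) = 0" by (simp add: inner_diff_left)
    then show ?thesis by simp
  qed
  have ex: "\<exists>y. ?P x y" for x
  proof -
    obtain y z where "y \<in> span L" "\<And>w. w \<in> span L \<Longrightarrow> orthogonal z w" "x = y + z"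
      using orthogonal_subspace_decomp_exists[of L x] by metis
    then show ?thesis using L by (auto simp: orthogonal_def span_eq_iff[THEN iffD2])
  qed
  define f where "f x = (THE y. ?P x y)" for x
  have fP: "?P x (f x)" for x unfolding f_def using theI'[of "?P x"] ex uniq by blast
  have f_eq: "f x = y" if "?P x y" for x y using uniq fP that by blast
  have "linear f"
  proof (rule linearI)
    show "f (a + b) = f a + f b" for a b
    proof (rule f_eq, intro conjI ballI)
      show "f a + f b \<in> L" using fP L by (simp add: subspace_add)
      fix z assume "z \<in> L"
      then have "inner (a - f a) z = 0" "inner (b - f b) z = 0" using fP by blast+
      then show "inner (a + b - (f a + f b)) z = 0" by (simp add: inner_diff_left inner_add_left)
    qed
    show "f (c *\<^sub>R a) = c *\<^sub>R f a" for c a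
    proof (rule f_eq, intro conjI ballI)
      show "c *\<^sub>R f a \<in> L" using fP L by (simp add: subspace_scale)
      fix z assume "z \<in> L"
      then have "inner (a - f a) z = 0" using fP by blast
      then show "inner (c *\<^sub>R a - c *\<^sub>R f a) z = 0" by (simp add: inner_diff_left)
    qed
  qed
  moreover have "orthproj L = matrix f" unfolding orthproj_def f_def ..
  ultimately have "orthproj L *v x = f x" by (simp add: matrix_works)
  moreover have "f x = y" by (rule f_eq) (use y in auto)
  ultimately show ?thesis by simp
qed

lemma orthproj_props:
  fixes L :: "(real^'m) set"
  assumes L: "subspace L"
  shows orthproj_in: "orthproj L *v x \<in> L"
    and orthproj_fix_iff: "orthproj L *v x = x \<longleftrightarrow> x \<in> L"
proof -
  obtain y z where "y \<in> span L" "\<And>w. w \<in> span L \<Longrightarrow> orthogonal z w" "x = y + z"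
    using orthogonal_subspace_decomp_exists[of L x] by metis
  then have "y \<in> L" "\<And>w. w \<in> L \<Longrightarrow> inner (x - y) w = 0"
    using L by (auto simp: orthogonal_def span_eq_iff[THEN iffD2])
  then show in_L: "orthproj L *v x \<in> L" using orthproj_eqI[OF L] by metis
  show "orthproj L *v x = x \<longleftrightarrow> x \<in> L" using orthproj_eqI[OF L, of x x] in_L by auto
qed

lemma orthproj_inj:
  assumes "subspace L" "subspace M" "orthproj L = orthproj M"
  shows "L = M"
  using orthproj_fix_iff[OF assms(1)] orthproj_fix_iff[OF assms(2)] assms(3) by (intro set_eqI) simp

lemma span_singleton_scale:
  assumes "c \<noteq> 0"
  shows "span {c *\<^sub>R u} = span {u :: 'a::real_vector}"
proof (rule subset_antisym)
  show "span {c *\<^sub>R u} \<subseteq> span {u}" by (rule span_minimal) (auto intro: span_scale span_base)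
  have "u = (1 / c) *\<^sub>R (c *\<^sub>R u)" using assms by simp
  then have "u \<in> span {c *\<^sub>R u}" by (metis span_scale span_base singletonI)
  then show "span {u} \<subseteq> span {c *\<^sub>R u}" by (intro span_minimal) auto
qed

lemma det2_eq_0_iff:
  fixes u v :: "real^2"
  assumes "u \<noteq> 0"
  shows "det2 u v = 0 \<longleftrightarrow> (\<exists>c. v = c *\<^sub>R u)"
proof
  assume d: "det2 u v = 0"
  define N where "N = (u$1)\<^sup>2 + (u$2)\<^sup>2"
  have N: "N \<noteq> 0" using assms by (auto simp: N_def vec_eq_iff forall_2 sum_power2_eq_zero_iff)
  define c where "c = (u$1 * v$1 + u$2 * v$2) / N"
  have e: "u$1 * v$2 = u$2 * v$1" using d by (simp add: det2_def)
  have "N * v$1 = (u$1 * v$1 + u$2 * v$2) * u$1"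
  proof -
    have "N * v$1 = u$1 * u$1 * v$1 + u$2 * (u$2 * v$1)" by (simp add: N_def power2_eq_square algebra_simps)
    then show ?thesis unfolding e[symmetric] by (simp add: algebra_simps)
  qed
  moreover have "N * v$2 = (u$1 * v$1 + u$2 * v$2) * u$2"
  proof -
    have "N * v$2 = u$1 * (u$1 * v$2) + u$2 * u$2 * v$2" by (simp add: N_def power2_eq_square algebra_simps)
    then show ?thesis unfolding e by (simp add: algebra_simps)
  qed
  ultimately have "v$1 = c * u$1" "v$2 = c * u$2" using N by (simp_all add: c_def eq_divide_eq mult.commute)
  then show "\<exists>c. v = c *\<^sub>R u" by (intro exI[of _ c]) (simp add: vec_eq_iff forall_2)
qed (auto simp: det2_def)

lemma det2_linear:
  "det2 (c *\<^sub>R u) v = c * det2 u v" "det2 u (c *\<^sub>R v) = c * det2 u v"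
  "det2 (u + u') v = det2 u v + det2 u' v" "det2 u (v + v') = det2 u v + det2 u v'"
  "det2 u u = 0" "det2 v u = - det2 u v"
  by (simp_all add: det2_def algebra_simps)

lemma matrix_vector_mult_2: "((M::real^2^2) *v x) $ i = M$i$1 * x$1 + M$i$2 * x$2"
  by (simp add: matrix_vector_mult_def sum_2)

lemma det2_matrix: "det2 (M *v u) (M *v v) = det M * det2 u v"
  by (simp add: det2_def matrix_vector_mult_2 det_2 algebra_simps)

lemma det_nz_mult_nz:
  fixes M :: "real^2^2"
  assumes "det M \<noteq> 0" "u \<noteq> 0"
  shows "M *v u \<noteq> 0"
proof
  assume "M *v u = 0"
  moreover obtain N where "N ** M = mat 1" using assms(1) by (auto simp: invertible_det_nz[symmetric] invertible_def)
  ultimately have "u = N *v 0" by (metis matrix_vector_mul_assoc matrix_vector_mul_lid)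
  then show False using assms(2) by (simp add: matrix_vector_mult_0_right)
qed

lemma RP1_eq: "RP1 = {span {u} | u. u \<noteq> 0}"
proof (intro set_eqI iffI)
  fix L :: "(real^2) set" assume "L \<in> RP1"
  then have L: "subspace L" "dim L = 1" by (auto simp: RP1_def)
  obtain B where B: "B \<subseteq> L" "independent B" "L \<subseteq> span B" "card B = dim L"
    using basis_exists[of L] by metis
  then obtain u where "B = {u}" using L(2) card_1_singletonE by metis
  moreover have "span B = L" using B L(1) by (metis span_minimal subset_antisym)
  ultimately show "L \<in> {span {u} | u. u \<noteq> 0}" using B(2) by auto
next
  fix L :: "(real^2) set" assume "L \<in> {span {u} | u. u \<noteq> 0}"
  then obtain u where u: "L = span {u}" "u \<noteq> 0" by blast
  then show "L \<in> RP1" by (simp add: RP1_def)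
qed

lemma act_span: "act g (span {u}) = span {g *v u}"
  unfolding act_def using linear_span_image[OF matrix_vector_mul_linear[of g], of "{u}"] by simp

lemma span_eq_line_at_arctan:
  fixes u :: "real^2"
  assumes "u$1 \<noteq> 0"
  shows "span {u} = line_at (arctan (u$2 / u$1))"
proof -
  let ?t = "arctan (u$2 / u$1)"
  have c: "cos ?t > 0" by (simp add: cos_arctan add_pos_nonneg)
  have s: "sin ?t = cos ?t * (u$2 / u$1)"
    using tan_arctan[of "u$2 / u$1"] c by (simp add: tan_def field_simps)
  have "vector [cos ?t, sin ?t] = (cos ?t / u$1) *\<^sub>R u"
    unfolding s using assms by (simp add: vec_eq_iff forall_2)
  then show ?thesis unfolding line_at_def using c assms by (simp add: span_singleton_scale)
qed

lemma span_eq_line_at_arctan':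
  fixes u :: "real^2"
  assumes "u$2 \<noteq> 0"
  shows "span {u} = line_at (pi / 2 - arctan (u$1 / u$2))"
proof -
  let ?t = "arctan (u$1 / u$2)"
  have c: "cos ?t > 0" by (simp add: cos_arctan add_pos_nonneg)
  have s: "sin ?t = cos ?t * (u$1 / u$2)"
    using tan_arctan[of "u$1 / u$2"] c by (simp add: tan_def field_simps)
  have cs: "cos (pi / 2 - ?t) = sin ?t" "sin (pi / 2 - ?t) = cos ?t" by (simp_all add: cos_diff sin_diff)
  have "vector [cos (pi / 2 - ?t), sin (pi / 2 - ?t)] = (cos ?t / u$2) *\<^sub>R u"
    unfolding cs s using assms by (simp add: vec_eq_iff forall_2)
  then show ?thesis unfolding line_at_def using c assms by (simp add: span_singleton_scale)
qed

text \<open>The angle of a line has no continuous choice on the whole punctured plane; two arctan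
  charts on open sets replace it.\<close>

lemma continuous_on_span_singleton:
  fixes f :: "(real^2) set \<Rightarrow> 'b::topological_space"
  assumes "continuous_on UNIV (\<lambda>t. f (line_at t))"
  shows "continuous_on (- {0}) (\<lambda>u. f (span {u}))"
proof -
  let ?A = "{u :: real^2. u$1 \<noteq> 0}" and ?B = "{u :: real^2. u$2 \<noteq> 0}"
  have op: "open ?A" "open ?B" by (intro open_Collect_neq continuous_intros)+
  have 1: "continuous_on ?A (\<lambda>u. f (line_at (arctan (u$2 / u$1))))"
    by (rule continuous_on_compose2[OF assms]) (auto intro!: continuous_intros)
  have 2: "continuous_on ?B (\<lambda>u. f (line_at (pi / 2 - arctan (u$1 / u$2))))"
    by (rule continuous_on_compose2[OF assms]) (auto intro!: continuous_intros)
  have "continuous_on ?A (\<lambda>u. f (span {u}))"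
    using 1 by (rule continuous_on_eq) (simp add: span_eq_line_at_arctan)
  moreover have "continuous_on ?B (\<lambda>u. f (span {u}))"
    using 2 by (rule continuous_on_eq) (simp add: span_eq_line_at_arctan')
  ultimately have "continuous_on (?A \<union> ?B) (\<lambda>u. f (span {u}))" by (rule continuous_on_open_Un[OF op])
  moreover have "?A \<union> ?B = - {0}" by (auto simp: vec_eq_iff forall_2)
  ultimately show ?thesis by simp
qed

lemma continuous_on_matrix_vector_mult [continuous_intros]:
  fixes A :: "'a::topological_space \<Rightarrow> real^'n^'m"
  assumes "continuous_on S A" "continuous_on S x"
  shows "continuous_on S (\<lambda>t. A t *v x t)"
  unfolding matrix_vector_mult_def
  by (intro continuous_on_vec_lambda continuous_intros assms)

text \<open>For projections, a fixed-point equation says that a vector lies in a subspace depending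
  on \<open>k\<close>. Written this way the condition is closed, so the unit vectors satisfying it
  form a compact set, on which \<open>\<psi>\<close> has no zero; homogeneity does the rest.\<close>

lemma uniform_lower_bound:
  fixes A B C :: "'a::metric_space \<Rightarrow> real^'m^'m" and \<psi> :: "real^'m \<Rightarrow> real^'m \<Rightarrow> real"
  assumes K: "compact K" and cont: "continuous_on K A" "continuous_on K B" "continuous_on K C"
    and \<psi>: "continuous_on UNIV (\<lambda>(v, w). \<psi> v w)" and hom: "\<And>c v w. \<psi> (c *\<^sub>R v) (c *\<^sub>R w) = c\<^sup>2 * \<psi> v w"
    and nz: "\<And>k v w. k \<in> K \<Longrightarrow> A k *v v = v \<Longrightarrow> B k *v w = w \<Longrightarrow> C k *v (v + w) = v + w \<Longrightarrow>
      \<psi> v w = 0 \<Longrightarrow> v = 0 \<and> w = 0"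
  shows "\<exists>\<delta>>0. \<forall>k\<in>K. \<forall>v w. A k *v v = v \<longrightarrow> B k *v w = w \<longrightarrow> C k *v (v + w) = v + w \<longrightarrow>
      \<delta> * ((norm v)\<^sup>2 + (norm w)\<^sup>2) \<le> \<bar>\<psi> v w\<bar>"
proof -
  define D where "D = K \<times> sphere (0 :: (real^'m) \<times> (real^'m)) 1"
  have cD: "compact D" unfolding D_def by (intro compact_Times K compact_sphere)
  have clD: "closed D" using cD by (rule compact_imp_closed)
  define Z where "Z = {p \<in> D. A (fst p) *v fst (snd p) = fst (snd p) \<and> B (fst p) *v snd (snd p) = snd (snd p) \<and>
      C (fst p) *v (fst (snd p) + snd (snd p)) = fst (snd p) + snd (snd p)}"
  have comp: "continuous_on D (\<lambda>p. Q (fst p))" if "continuous_on K Q" for Q :: "'a \<Rightarrow> real^'m^'m"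
    by (rule continuous_on_compose2[OF that]) (auto simp: D_def intro!: continuous_intros)
  have closedeq: "closed {p \<in> D. f p = g p}"
    if "continuous_on D f" "continuous_on D g" for f g :: "_ \<Rightarrow> real^'m"
  proof -
    have "closed (D \<inter> (\<lambda>p. f p - g p) -` {0})"
      by (rule continuous_closed_preimage[OF continuous_on_diff[OF that] clD]) simp
    moreover have "D \<inter> (\<lambda>p. f p - g p) -` {0} = {p \<in> D. f p = g p}" by auto
    ultimately show ?thesis by simp
  qed
  have Zeq: "Z = {p \<in> D. A (fst p) *v fst (snd p) = fst (snd p)} \<inter> {p \<in> D. B (fst p) *v snd (snd p) = snd (snd p)} \<inter>
      {p \<in> D. C (fst p) *v (fst (snd p) + snd (snd p)) = fst (snd p) + snd (snd p)}"
    unfolding Z_def by blast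
  have "closed Z" unfolding Zeq
    by (intro closed_Int closedeq continuous_intros comp cont)
  moreover have "Z = D \<inter> Z" unfolding Z_def by blast
  ultimately have cZ: "compact Z" using compact_Int_closed[OF cD, of Z] by simp
  let ?f = "\<lambda>p. \<bar>\<psi> (fst (snd p)) (snd (snd p))\<bar>"
  have cf: "continuous_on Z ?f"
  proof -
    have "continuous_on Z (\<lambda>p. (\<lambda>(v, w). \<psi> v w) (snd p))"
      by (rule continuous_on_compose2[OF \<psi>]) (auto intro!: continuous_intros)
    then show ?thesis by (intro continuous_on_rabs) (simp add: case_prod_beta)
  qed
  have "\<exists>\<delta>>0. \<forall>p\<in>Z. \<delta> \<le> ?f p"
  proof (cases "Z = {}")
    case True
    then show ?thesis by (intro exI[of _ 1]) auto
  next
    case False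
    then obtain p0 where p0: "p0 \<in> Z" "\<And>p. p \<in> Z \<Longrightarrow> ?f p0 \<le> ?f p"
      using continuous_attains_inf[OF cZ False cf] by blast
    have "?f p0 > 0"
    proof (rule ccontr)
      assume "\<not> ?f p0 > 0"
      then have "fst (snd p0) = 0 \<and> snd (snd p0) = 0"
        using nz[of "fst p0" "fst (snd p0)" "snd (snd p0)"] p0(1) by (auto simp: Z_def D_def)
      then have "snd p0 = 0" by (simp add: prod_eq_iff)
      then show False using p0(1) by (auto simp: Z_def D_def)
    qed
    then show ?thesis using p0(2) by blast
  qed
  then obtain \<delta> where \<delta>: "\<delta> > 0" "\<And>p. p \<in> Z \<Longrightarrow> \<delta> \<le> ?f p" by blast
  have "\<delta> * ((norm v)\<^sup>2 + (norm w)\<^sup>2) \<le> \<bar>\<psi> v w\<bar>"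
    if k: "k \<in> K" and vw: "A k *v v = v" "B k *v w = w" "C k *v (v + w) = v + w" for k v w
  proof (cases "v = 0 \<and> w = 0")
    case True
    then show ?thesis by simp
  next
    case False
    define N where "N = sqrt ((norm v)\<^sup>2 + (norm w)\<^sup>2)"
    have sq: "(norm v)\<^sup>2 + (norm w)\<^sup>2 > 0"
      using False by (auto simp: sum_power2_gt_zero_iff)
    then have N: "N > 0" "N\<^sup>2 = (norm v)\<^sup>2 + (norm w)\<^sup>2" by (auto simp: N_def)
    have "norm ((1/N) *\<^sub>R v, (1/N) *\<^sub>R w) = 1"
    proof -
      have "norm ((1/N) *\<^sub>R v, (1/N) *\<^sub>R w) = norm ((1/N) *\<^sub>R (v, w))" by (simp only: scaleR_Pair)
      also have "\<dots> = (1/N) * norm (v, w)" using N(1) by (simp only: norm_scaleR) simp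
      also have "norm (v, w) = N" by (simp add: norm_Pair N_def)
      finally show ?thesis using N(1) by simp
    qed
    moreover have "A k *v ((1/N) *\<^sub>R v) = (1/N) *\<^sub>R v" "B k *v ((1/N) *\<^sub>R w) = (1/N) *\<^sub>R w"
      "C k *v ((1/N) *\<^sub>R v + (1/N) *\<^sub>R w) = (1/N) *\<^sub>R v + (1/N) *\<^sub>R w"
      using vw by (simp_all add: matrix_vector_mult_scaleR flip: scaleR_add_right)
    ultimately have "(k, (1/N) *\<^sub>R v, (1/N) *\<^sub>R w) \<in> Z" using k by (simp add: Z_def D_def)
    from \<delta>(2)[OF this] have "\<delta> \<le> \<bar>(1/N)\<^sup>2 * \<psi> v w\<bar>" by (simp add: hom)
    also have "\<dots> = \<bar>\<psi> v w\<bar> / N\<^sup>2" by (simp add: abs_mult power_divide)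
    finally show ?thesis using sq unfolding N(2) by (simp only: pos_le_divide_eq)
  qed
  then show ?thesis using \<delta>(1) by blast
qed

section \<open>Symplectic blocks and maximal triples\<close>

definition pick :: "'n \<Rightarrow> 2 \<Rightarrow> 'n + 'n" where
  "pick i a = (if a = 1 then Inl i else Inr i)"

text \<open>Projection to the \<open>i\<close>-th symplectic coordinate plane, on which
  \<open>rho_diag\<close> acts through \<open>rs i\<close>; \<open>emb\<close> is the inclusion of
  that plane.\<close>

definition blk :: "'n::finite \<Rightarrow> real^('n + 'n) \<Rightarrow> real^2" where
  "blk i x = (\<chi> a. x $ pick i a)"

definition emb :: "'n::finite \<Rightarrow> real^2 \<Rightarrow> real^('n + 'n)" where
  "emb i p = (\<chi> r. case r of Inl j \<Rightarrow> if j = i then p$1 else 0 | Inr j \<Rightarrow> if j = i then p$2 else 0)"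

lemma pick_simps [simp]: "pick i 1 = Inl i" "pick i 2 = Inr i"
  by (simp_all add: pick_def)

lemma blk_nth [simp]: "blk i x $ a = x $ pick i a"
  by (simp add: blk_def)

lemma blk_eqI: "(\<And>i. blk i x = blk i y) \<Longrightarrow> x = y"
proof -
  assume eq: "\<And>i. blk i x = blk i y"
  have "x $ r = y $ r" for r
  proof (cases r)
    case (Inl i)
    then show ?thesis using arg_cong[OF eq[of i], of "\<lambda>v. v$1"] by simp
  next
    case (Inr i)
    then show ?thesis using arg_cong[OF eq[of i], of "\<lambda>v. v$2"] by simp
  qed
  then show "x = y" by (simp add: vec_eq_iff)
qed

lemma blk_linear [simp]:
  "blk i (x + y) = blk i x + blk i y" "blk i (x - y) = blk i x - blk i y" "blk i (c *\<^sub>R x) = c *\<^sub>R blk i x" "blk i 0 = 0"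
  by (simp_all add: vec_eq_iff)

lemma blk_emb: "blk j (emb i p) = (if j = i then p else 0)"
  by (simp add: vec_eq_iff emb_def forall_2)

lemma blk_sum: "blk i (\<Sum>j\<in>A. f j) = (\<Sum>j\<in>A. blk i (f j))"
  by (simp add: vec_eq_iff)

lemma symp_blk: "symp x y = (\<Sum>i\<in>UNIV. det2 (blk i x) (blk i y))"
  by (simp add: symp_def det2_def)

lemma sum_UNIV_Plus: "(\<Sum>r\<in>(UNIV :: ('n::finite + 'n) set). f r) = (\<Sum>i\<in>UNIV. f (Inl i)) + (\<Sum>i\<in>UNIV. f (Inr i))"
  unfolding UNIV_Plus_UNIV[symmetric] by (subst sum.Plus) simp_all

lemma inner_blk: "inner x y = (\<Sum>i\<in>UNIV. inner (blk i x) (blk i y))"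
  by (simp add: inner_vec_def sum_UNIV_Plus sum_2 sum.distrib)

lemma blk_rho_diag: "blk i (rho_diag rs g *v x) = rs i g *v blk i x"
  unfolding vec_eq_iff forall_2
  by (simp add: matrix_vector_mult_def sum_UNIV_Plus rho_diag_def sum_2 if_distrib[of "\<lambda>a. a * _"] cong: if_cong)

lemma symp_linear:
  "symp (x + y) z = symp x z + symp y z" "symp x (y + z) = symp x y + symp x z"
  "symp (c *\<^sub>R x) z = c * symp x z" "symp z (c *\<^sub>R x) = c * symp z x" "symp x x = 0" "symp y x = - symp x y"
  unfolding symp_blk blk_linear
  by (simp_all add: det2_def sum.distrib[symmetric] sum_distrib_left sum_negf[symmetric] algebra_simps)

lemma symp_rho_diag:
  assumes "\<And>i. det (rs i g) = 1"
  shows "symp (rho_diag rs g *v x) (rho_diag rs g *v y) = symp x y"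
  by (simp add: symp_blk blk_rho_diag det2_matrix assms)

lemma abs_det2_le: "\<bar>det2 p q\<bar> \<le> 2 * norm p * norm q"
proof -
  have "\<bar>det2 p q\<bar> \<le> \<bar>p$1\<bar> * \<bar>q$2\<bar> + \<bar>p$2\<bar> * \<bar>q$1\<bar>"
    unfolding det2_def abs_mult[symmetric] by linarith
  also have "\<dots> \<le> norm p * norm q + norm p * norm q"
    by (intro add_mono mult_mono component_le_norm_cart) auto
  finally show ?thesis by simp
qed

lemma norm_blk_le: "norm (blk i x) \<le> norm x"
proof -
  have "inner (blk i x) (blk i x) \<le> (\<Sum>i\<in>UNIV. inner (blk i x) (blk i x))"
    by (rule member_le_sum) auto
  then show ?thesis unfolding norm_eq_sqrt_inner inner_blk[of x x] by simp
qed

lemma abs_symp_le: "\<bar>symp x (y :: real^('n::finite + 'n))\<bar> \<le> 2 * real CARD('n) * norm x * norm y"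
proof -
  have "\<bar>symp x y\<bar> \<le> (\<Sum>i\<in>UNIV. \<bar>det2 (blk i x) (blk i y)\<bar>)" unfolding symp_blk by (rule sum_abs)
  also have "\<dots> \<le> (\<Sum>i\<in>(UNIV::'n set). 2 * norm x * norm y)"
  proof (rule sum_mono)
    fix i :: 'n
    have "\<bar>det2 (blk i x) (blk i y)\<bar> \<le> 2 * norm (blk i x) * norm (blk i y)" by (rule abs_det2_le)
    also have "\<dots> \<le> 2 * norm x * norm y" by (intro mult_mono norm_blk_le) auto
    finally show "\<bar>det2 (blk i x) (blk i y)\<bar> \<le> 2 * norm x * norm y" .
  qed
  finally show ?thesis by simp
qed

lemma Lag_complement:
  fixes L M :: "(real^('n::finite + 'n)) set"
  assumes "L \<in> Lag" "M \<in> Lag" "L \<inter> M = {0}"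
  shows "\<exists>a\<in>L. \<exists>c\<in>M. x = a + c"
proof -
  have s: "subspace L" "subspace M" "dim L = CARD('n)" "dim M = CARD('n)" using assms by (auto simp: Lag_def)
  have "dim {a + c | a c. a \<in> L \<and> c \<in> M} + dim (L \<inter> M) = dim L + dim M" by (rule dim_sums_Int[OF s(1,2)])
  then have "dim {a + c | a c. a \<in> L \<and> c \<in> M} = DIM(real^('n + 'n))" using s assms(3) by simp
  then have "span {a + c | a c. a \<in> L \<and> c \<in> M} = UNIV" by (simp only: dim_eq_full)
  moreover have "subspace {a + c | a c. a \<in> L \<and> c \<in> M}" using subspace_sums[OF s(1,2)] by simp
  ultimately have "{a + c | a c. a \<in> L \<and> c \<in> M} = UNIV" by (simp add: span_eq_iff[THEN iffD2])
  then have "x \<in> {a + c | a c. a \<in> L \<and> c \<in> M}" by simp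
  then show ?thesis by blast
qed

text \<open>\<open>symp a c\<close> is the Maslov form at \<open>a + c\<close>, and a form that is
  definite, of either sign, has no nonzero isotropic vector.\<close>

lemma maximal_triple_nondegenerate:
  assumes m: "maximal_triple L1 L2 L3" and s: "subspace L1" "subspace L3"
    and ac: "a \<in> L1" "c \<in> L3" "a + c \<in> L2" "symp a c = 0"
  shows "a = 0 \<and> c = 0"
proof -
  have t: "L1 \<inter> L3 = {0}" using m by (simp add: maximal_triple_def transverse_def)
  have "(THE a'. a' \<in> L1 \<and> a + c - a' \<in> L3) = a"
  proof (rule the_equality)
    fix a' assume a': "a' \<in> L1 \<and> a + c - a' \<in> L3"
    have "a + c - a' - c \<in> L3" using a' ac s by (simp only: subspace_diff)
    then have "a - a' \<in> L3" by (simp add: algebra_simps)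
    moreover have "a - a' \<in> L1" using a' ac s by (simp add: subspace_diff)
    ultimately have "a - a' \<in> L1 \<inter> L3" by blast
    then show "a' = a" using t by simp
  qed (use ac in simp)
  then have "maslov_form L1 L3 (a + c) = 0" using ac(4) by (simp add: maslov_form_def)
  then have "a + c = 0" using m ac(3) unfolding maximal_triple_def by force
  then have "a = - c" by (simp add: eq_neg_iff_add_eq_0)
  then have "a \<in> L1 \<inter> L3" using ac s by (simp add: subspace_neg)
  then show ?thesis using t \<open>a = - c\<close> by auto
qed

text \<open>Reversing the triple changes the sign of the product of the three determinants.\<close>

lemma cyc_pos_span:
  fixes u1 u2 u3 :: "real^2"
  assumes "det2 u1 u2 \<noteq> 0" "det2 u2 u3 \<noteq> 0" "det2 u3 u1 \<noteq> 0"
  shows "cyc_pos (span {u1}) (span {u2}) (span {u3}) \<or> cyc_pos (span {u3}) (span {u2}) (span {u1})"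
proof -
  have u: "u1 \<in> span {u1}" "u2 \<in> span {u2}" "u3 \<in> span {u3}" by (auto intro: span_base)
  have "det2 u1 u2 * det2 u2 u3 * det2 u3 u1 \<noteq> 0" using assms by simp
  moreover have "det2 u3 u2 * det2 u2 u1 * det2 u1 u3 = - (det2 u1 u2 * det2 u2 u3 * det2 u3 u1)"
    by (simp add: det2_linear(6)[of u3 u2] det2_linear(6)[of u2 u1] det2_linear(6)[of u1 u3])
  ultimately have "det2 u1 u2 * det2 u2 u3 * det2 u3 u1 < 0 \<or> det2 u3 u2 * det2 u2 u1 * det2 u1 u3 < 0" by linarith
  then show ?thesis unfolding cyc_pos_def using u by blast
qed

section \<open>The limit map as a continuous equivariant family of Lagrangians\<close>

locale limit_map =
  fixes G :: "(real^2^2) set" and rs :: "'n::finite \<Rightarrow> real^2^2 \<Rightarrow> real^2^2"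
    and xi :: "(real^2) set \<Rightarrow> (real^('n + 'n)) set"
  assumes sg: "surface_group G" and fr: "\<And>i. fuchsian_rep G (rs i)"
    and plm: "positive_limit_map G (rho_diag rs) xi"
begin

definition xi_proj :: "real^2 \<Rightarrow> real^('n + 'n)^('n + 'n)" where
  "xi_proj u = orthproj (xi (span {u}))"

lemma det_G: "g \<in> G \<Longrightarrow> det g = 1" using sg by (simp add: surface_group_def)
lemma mult_G: "g \<in> G \<Longrightarrow> h \<in> G \<Longrightarrow> g ** h \<in> G" using sg by (simp add: surface_group_def)
lemma inv_G: "g \<in> G \<Longrightarrow> matrix_inv g \<in> G" using sg by (simp add: surface_group_def)
lemma one_G: "mat 1 \<in> G" using sg by (simp add: surface_group_def)
lemma det_rs: "g \<in> G \<Longrightarrow> det (rs i g) = 1" using fr[of i] by (simp add: fuchsian_rep_def)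
lemma mult_rs: "g \<in> G \<Longrightarrow> h \<in> G \<Longrightarrow> rs i (g ** h) = rs i g ** rs i h" using fr[of i] by (simp add: fuchsian_rep_def)

lemma inv_G_mult:
  assumes "g \<in> G"
  shows "matrix_inv g ** g = mat 1" "g ** matrix_inv g = mat 1"
proof -
  have "invertible g" using det_G[OF assms] by (simp add: invertible_det_nz)
  then have "g ** matrix_inv g = mat 1 \<and> matrix_inv g ** g = mat 1"
    unfolding invertible_def matrix_inv_def by (rule someI_ex)
  then show "matrix_inv g ** g = mat 1" "g ** matrix_inv g = mat 1" by simp_all
qed

lemma rs_one: "rs i (mat 1) = mat 1"
proof -
  have "invertible (rs i (mat 1))" using det_rs[OF one_G] by (simp add: invertible_det_nz)
  then obtain N where N: "N ** rs i (mat 1) = mat 1" by (auto simp: invertible_def)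
  have "rs i (mat 1) ** rs i (mat 1) = rs i (mat 1)" using mult_rs[OF one_G one_G, of i] by simp
  then have "N ** rs i (mat 1) ** rs i (mat 1) = N ** rs i (mat 1)" by (simp only: matrix_mul_assoc[symmetric])
  then show ?thesis unfolding N by simp
qed

lemmas plm_props = plm[unfolded positive_limit_map_def]
lemmas xi_in_Lag = plm_props[THEN conjunct1, rule_format]
lemmas xi_continuous = plm_props[THEN conjunct2, THEN conjunct1]
lemmas xi_equivariant = plm_props[THEN conjunct2, THEN conjunct2, THEN conjunct1, rule_format]
lemmas xi_positive = plm_props[THEN conjunct2, THEN conjunct2, THEN conjunct2, rule_format]

lemma span_in_RP1: "u \<noteq> 0 \<Longrightarrow> span {u} \<in> RP1"
  unfolding RP1_eq by (intro CollectI exI[of _ u] conjI refl)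

lemma xi_Lag: "u \<noteq> 0 \<Longrightarrow> xi (span {u}) \<in> Lag"
  by (rule xi_in_Lag[OF span_in_RP1])

lemma xi_subspace: "u \<noteq> 0 \<Longrightarrow> subspace (xi (span {u}))"
  using xi_Lag[of u] by (simp add: Lag_def)

lemma continuous_xi_proj: "continuous_on (- {0}) xi_proj"
  unfolding xi_proj_def
  by (rule continuous_on_span_singleton[of "\<lambda>L. orthproj (xi L)"]) (rule xi_continuous)

lemma xi_proj_fix: "u \<noteq> 0 \<Longrightarrow> xi_proj u *v v = v \<longleftrightarrow> v \<in> xi (span {u})"
  unfolding xi_proj_def by (rule orthproj_fix_iff[OF xi_subspace])

lemma xi_act: "g \<in> G \<Longrightarrow> u \<noteq> 0 \<Longrightarrow> xi (span {g *v u}) = act (rho_diag rs g) (xi (span {u}))"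
  unfolding act_span[symmetric] by (rule xi_equivariant[OF _ span_in_RP1])

lemma rho_in_xi:
  assumes "g \<in> G" "u \<noteq> 0" "v \<in> xi (span {u})"
  shows "rho_diag rs g *v v \<in> xi (span {g *v u})"
  unfolding xi_act[OF assms(1,2)] act_def using assms(3) by (rule imageI)

lemma xi_maximal:
  assumes "det2 u1 u2 \<noteq> 0" "det2 u2 u3 \<noteq> 0" "det2 u3 u1 \<noteq> 0"
  shows "maximal_triple (xi (span {u1})) (xi (span {u2})) (xi (span {u3})) \<or>
    maximal_triple (xi (span {u3})) (xi (span {u2})) (xi (span {u1}))"
proof -
  have "u1 \<noteq> 0" "u2 \<noteq> 0" "u3 \<noteq> 0" using assms by (auto simp: det2_def)
  then have "span {u1} \<in> RP1" "span {u2} \<in> RP1" "span {u3} \<in> RP1" by (blast intro: span_in_RP1)+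
  then show ?thesis using cyc_pos_span[OF assms] xi_positive by blast
qed

lemma xi_transverse:
  assumes "det2 u1 u2 \<noteq> 0"
  shows "xi (span {u1}) \<inter> xi (span {u2}) = {0}"
proof -
  \<comment> \<open>Positivity speaks of triples; the sum supplies a third line.\<close>
  have "det2 u2 (u1 + u2) \<noteq> 0" "det2 (u1 + u2) u1 \<noteq> 0"
    using assms by (simp_all add: det2_def algebra_simps)
  from xi_maximal[OF assms this] show ?thesis by (auto simp: maximal_triple_def transverse_def)
qed

lemma xi_nondegenerate:
  assumes "det2 u1 u2 \<noteq> 0" "det2 u2 u3 \<noteq> 0" "det2 u3 u1 \<noteq> 0"
    and "a \<in> xi (span {u1})" "c \<in> xi (span {u3})" "a + c \<in> xi (span {u2})" "symp a c = 0"
  shows "a = 0 \<and> c = 0"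
proof -
  have u: "u1 \<noteq> 0" "u3 \<noteq> 0" using assms by (auto simp: det2_def)
  from xi_maximal[OF assms(1-3)] show ?thesis
  proof
    assume "maximal_triple (xi (span {u1})) (xi (span {u2})) (xi (span {u3}))"
    then show ?thesis by (rule maximal_triple_nondegenerate[OF _ xi_subspace[OF u(1)] xi_subspace[OF u(2)] assms(4-7)])
  next
    assume m: "maximal_triple (xi (span {u3})) (xi (span {u2})) (xi (span {u1}))"
    have "c + a \<in> xi (span {u2})" "symp c a = 0" using assms(6,7) symp_linear(6)[of c a] by (simp_all add: add.commute)
    then show ?thesis using maximal_triple_nondegenerate[OF m xi_subspace[OF u(2)] xi_subspace[OF u(1)] assms(5,4)] by blast
  qed
qed

lemma continuous_on_xi_proj_comp:
  assumes "continuous_on K f" "\<And>k. k \<in> K \<Longrightarrow> f k \<noteq> 0"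
  shows "continuous_on K (\<lambda>k. xi_proj (f k))"
  by (rule continuous_on_compose2[OF continuous_xi_proj assms(1)]) (use assms(2) in auto)

lemma cocompact_set:
  "\<exists>K. compact K \<and> (\<forall>k\<in>K. det k = 1) \<and> (\<forall>h::real^2^2. det h = 1 \<longrightarrow> (\<exists>g\<in>G. \<exists>k\<in>K. h = g ** k))"
proof -
  have "\<exists>K. compact K \<and> (\<forall>h::real^2^2. det h = 1 \<longrightarrow> (\<exists>g\<in>G. \<exists>k\<in>K. h = g ** k))"
    using sg unfolding surface_group_def by (elim conjE)
  then obtain K0 where K0: "compact K0" "\<forall>h::real^2^2. det h = 1 \<longrightarrow> (\<exists>g\<in>G. \<exists>k\<in>K0. h = g ** k)"
    by blast
  define K where "K = K0 \<inter> {k. det k = 1}"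
  have "closed {k :: real^2^2. det k = 1}"
    unfolding det_2 by (intro closed_Collect_eq continuous_intros)
  then have "compact K" unfolding K_def using K0(1) by (rule compact_Int_closed[rotated])
  moreover have "\<exists>g\<in>G. \<exists>k\<in>K. h = g ** k" if h: "det h = 1" for h
  proof -
    obtain g k where gk: "g \<in> G" "k \<in> K0" "h = g ** k" using K0(2) h by blast
    then have "det k = 1" using h det_G[of g] by (simp add: det_mul)
    then show ?thesis using gk unfolding K_def by blast
  qed
  moreover have "\<forall>k\<in>K. det k = 1" unfolding K_def by simp
  ultimately show ?thesis by (intro exI[of _ K] conjI allI impI)
qed

section \<open>Splitting of the limit map\<close>

text \<open>Elements of the group contract any two vectors of \<open>xi (span {u})\<close> at the
  same time to arbitrarily small norm (\<open>shrink\<close>), while the determinants of their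
  blocks are invariant under the group.\<close>

lemma blk_det2_zero:
  assumes u: "u \<noteq> 0" and xy: "x \<in> xi (span {u})" "y \<in> xi (span {u})"
  shows "det2 (blk i x) (blk i y) = 0"
proof -
  obtain K where K: "compact K" "\<forall>k\<in>K. det k = 1" "\<forall>h::real^2^2. det h = 1 \<longrightarrow> (\<exists>g\<in>G. \<exists>k\<in>K. h = g ** k)"
    using cocompact_set by blast
  let ?e1 = "vector [1, 0] :: real^2" and ?e2 = "vector [0, 1] :: real^2" and ?r = "vector [1, 1] :: real^2"
  have dk: "det2 (k *v p) (k *v q) = det2 p q" if "k \<in> K" for k p q using K(2) that by (simp add: det2_matrix)
  have kne: "k *v p \<noteq> 0" if "k \<in> K" "p \<noteq> 0" for k p
    using K(2) that det_nz_mult_nz[of k p] by simp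
  have ne: "?e1 \<noteq> 0" "?e2 \<noteq> 0" "?r \<noteq> 0" by (simp_all add: vec_eq_iff forall_2)
  have cont: "continuous_on K (\<lambda>k. xi_proj (k *v p))" if "p \<noteq> 0" for p
    by (rule continuous_on_xi_proj_comp) (use kne that in \<open>auto intro!: continuous_intros\<close>)
  have csymp: "continuous_on UNIV (\<lambda>(v, w). symp v w :: real)" for v :: "real^('n+'n)"
    unfolding symp_def case_prod_beta by (intro continuous_intros)
  \<comment> \<open>The standard triple of lines, moved by the compact set \<open>K\<close>: on it
    nondegeneracy of the Maslov form is uniform.\<close>
  have "\<exists>\<delta>>0. \<forall>k\<in>K. \<forall>v w. xi_proj (k *v ?r) *v v = v \<longrightarrow> xi_proj (k *v ?e2) *v w = w \<longrightarrow>
      xi_proj (k *v ?e1) *v (v + w) = v + w \<longrightarrow> \<delta> * ((norm v)\<^sup>2 + (norm w)\<^sup>2) \<le> \<bar>symp v w\<bar>"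
  proof (rule uniform_lower_bound[OF K(1) cont[OF ne(3)] cont[OF ne(2)] cont[OF ne(1)] csymp])
    show "symp (c *\<^sub>R v) (c *\<^sub>R w) = c\<^sup>2 * symp v w" for c v w by (simp add: symp_linear(3,4) power2_eq_square)
    fix k v w assume k: "k \<in> K" and vw: "xi_proj (k *v ?r) *v v = v" "xi_proj (k *v ?e2) *v w = w"
      "xi_proj (k *v ?e1) *v (v + w) = v + w" "symp v w = 0"
    have "v \<in> xi (span {k *v ?r})" "w \<in> xi (span {k *v ?e2})" "v + w \<in> xi (span {k *v ?e1})"
      using vw kne[OF k] ne xi_proj_fix by blast+
    moreover have "det2 (k *v ?r) (k *v ?e1) \<noteq> 0" "det2 (k *v ?e1) (k *v ?e2) \<noteq> 0" "det2 (k *v ?e2) (k *v ?r) \<noteq> 0"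
      unfolding dk[OF k] by (simp_all add: det2_def)
    ultimately show "v = 0 \<and> w = 0" using xi_nondegenerate vw(4) by blast
  qed
  then obtain \<delta>1 where \<delta>1: "\<delta>1 > 0" "\<And>k v w. k \<in> K \<Longrightarrow> xi_proj (k *v ?r) *v v = v \<Longrightarrow> xi_proj (k *v ?e2) *v w = w \<Longrightarrow>
      xi_proj (k *v ?e1) *v (v + w) = v + w \<Longrightarrow> \<delta>1 * ((norm v)\<^sup>2 + (norm w)\<^sup>2) \<le> \<bar>symp v w\<bar>" by blast
  define N where "N = (u$1)\<^sup>2 + (u$2)\<^sup>2"
  have N: "N \<noteq> 0" using u by (auto simp: N_def vec_eq_iff forall_2 sum_power2_eq_zero_iff)
  \<comment> \<open>A matrix of determinant 1 with first column \<open>u\<close>; the second column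
    gives a transverse direction \<open>s\<close>.\<close>
  define h0 where "h0 = mat2 (u$1) (- u$2 / N) (u$2) (u$1 / N)"
  have "det h0 = ((u$1)\<^sup>2 + (u$2)\<^sup>2) / N" unfolding h0_def det_mat2 by (simp add: power2_eq_square add_divide_distrib)
  then have "det h0 = N / N" by (simp only: N_def[symmetric])
  then have dh0: "det h0 = 1" using N by simp
  have h0e1: "h0 *v ?e1 = u" by (simp add: vec_eq_iff forall_2 matrix_vector_mult_2 h0_def)
  define s where "s = h0 *v ?e2"
  \<comment> \<open>\<open>p \<tau>\<close> is \<open>u + \<tau> *\<^sub>R s\<close>: it tends to
    \<open>u\<close> and stays uniformly transverse to \<open>s\<close>.\<close>
  define p where "p \<tau> = h0 *v (vector [1, \<tau>] :: real^2)" for \<tau>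
  have dps: "det2 (p \<tau>) s = 1" for \<tau> unfolding p_def s_def det2_matrix dh0 by (simp add: det2_def)
  have pne: "p \<tau> \<noteq> 0" for \<tau> using dps[of \<tau>] by (auto simp: det2_def)
  have sne: "s \<noteq> 0" using dps[of 0] by (auto simp: det2_def)
  have p0: "p 0 = u" unfolding p_def by (rule h0e1)
  have cp: "continuous_on UNIV p"
  proof -
    have "p = (\<lambda>\<tau>. u + \<tau> *\<^sub>R s)"
      by (rule ext) (simp add: p_def s_def h0_def vec_eq_iff forall_2 matrix_vector_mult_2 algebra_simps)
    then show ?thesis by (auto intro!: continuous_intros)
  qed
  have cPp: "continuous_on UNIV (\<lambda>\<tau>. xi_proj (p \<tau>))" by (rule continuous_on_xi_proj_comp[OF cp]) (rule pne)
  \<comment> \<open>Uniform transversality of the two Lagrangians, up to and including the limit 0.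
    The identity as third projection imposes no condition on the sum.\<close>
  have "\<exists>\<delta>>0. \<forall>k\<in>{0..1::real}. \<forall>v w. xi_proj (p k) *v v = v \<longrightarrow> xi_proj s *v w = w \<longrightarrow> mat 1 *v (v + w) = v + w \<longrightarrow>
      \<delta> * ((norm v)\<^sup>2 + (norm w)\<^sup>2) \<le> \<bar>(norm (v + w))\<^sup>2\<bar>"
  proof (rule uniform_lower_bound[OF compact_Icc continuous_on_subset[OF cPp subset_UNIV] continuous_on_const continuous_on_const])
    show "continuous_on UNIV (\<lambda>(v :: real^('n+'n), w). (norm (v + w))\<^sup>2)"
      unfolding case_prod_beta by (intro continuous_intros)
    show "(norm (c *\<^sub>R v + c *\<^sub>R w))\<^sup>2 = c\<^sup>2 * (norm (v + w))\<^sup>2" for c :: real and v w :: "real^('n+'n)"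
      by (simp add: power_mult_distrib flip: scaleR_add_right)
    fix k :: real and v w :: "real^('n+'n)"
    assume vw: "xi_proj (p k) *v v = v" "xi_proj s *v w = w" "(norm (v + w))\<^sup>2 = 0"
    have v: "v \<in> xi (span {p k})" and w: "w \<in> xi (span {s})" using vw xi_proj_fix[OF pne] xi_proj_fix[OF sne] by blast+
    have vw0: "v = - w" using vw(3) by (simp add: eq_neg_iff_add_eq_0)
    then have "v \<in> xi (span {s})" using w xi_subspace[OF sne] by (simp add: subspace_neg)
    then have "v \<in> xi (span {p k}) \<inter> xi (span {s})" using v by blast
    also have "\<dots> = {0}" by (rule xi_transverse) (simp add: dps)
    finally show "v = 0 \<and> w = 0" using vw0 by auto
  qed
  then obtain \<delta>2 where \<delta>2: "\<delta>2 > 0" "\<And>\<tau> v w. 0 \<le> \<tau> \<Longrightarrow> \<tau> \<le> 1 \<Longrightarrow> xi_proj (p \<tau>) *v v = v \<Longrightarrow> xi_proj s *v w = w \<Longrightarrow>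
      \<delta>2 * ((norm v)\<^sup>2 + (norm w)\<^sup>2) \<le> (norm (v + w))\<^sup>2" by fastforce
  define S where "S = 2 * real CARD('n)"
  have S: "S \<ge> 0" by (simp add: S_def)
  define E where "E \<tau> z = norm (z - xi_proj (p \<tau>) *v z)" for \<tau> z
  have decomp: "\<exists>a c. a \<in> xi (span {p \<tau>}) \<and> c \<in> xi (span {s}) \<and> z = a + c \<and> \<bar>symp a c\<bar> \<le> S * norm z * (E \<tau> z / sqrt \<delta>2)"
    if \<tau>: "0 \<le> \<tau>" "\<tau> \<le> 1" for \<tau> z
  proof -
    have Lp: "xi (span {p \<tau>}) \<in> Lag" "xi (span {s}) \<in> Lag" using xi_Lag pne sne by blast+
    have "xi (span {p \<tau>}) \<inter> xi (span {s}) = {0}" by (rule xi_transverse) (simp add: dps)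
    \<comment> \<open>Only the error of projecting \<open>z\<close> is decomposed, so the component
      \<open>c\<close> is controlled by \<open>E \<tau> z\<close>. This error tends to 0 for
      \<open>z\<close> in \<open>xi (span {u})\<close>.\<close>
    then obtain a' c where a': "a' \<in> xi (span {p \<tau>})" and c: "c \<in> xi (span {s})" and e: "z - xi_proj (p \<tau>) *v z = a' + c"
      using Lag_complement[OF Lp, of "z - xi_proj (p \<tau>) *v z"] by blast
    define a where "a = xi_proj (p \<tau>) *v z + a'"
    have "xi_proj (p \<tau>) *v z \<in> xi (span {p \<tau>})" unfolding xi_proj_def by (rule orthproj_in[OF xi_subspace[OF pne]])
    then have a: "a \<in> xi (span {p \<tau>})" unfolding a_def using a' xi_subspace[OF pne] by (simp add: subspace_add)
    have z: "z = a + c" using e by (simp add: a_def algebra_simps)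
    have "\<delta>2 * ((norm a')\<^sup>2 + (norm c)\<^sup>2) \<le> (norm (a' + c))\<^sup>2"
      using \<delta>2(2)[OF \<tau>, of a' c] a' c xi_proj_fix[OF pne[of \<tau>], of a'] xi_proj_fix[OF sne, of c] by simp
    moreover have "\<delta>2 * (norm c)\<^sup>2 \<le> \<delta>2 * ((norm a')\<^sup>2 + (norm c)\<^sup>2)" using \<delta>2(1) by simp
    ultimately have "\<delta>2 * (norm c)\<^sup>2 \<le> (norm (a' + c))\<^sup>2" by (rule order_trans[rotated])
    then have "(sqrt \<delta>2 * norm c)\<^sup>2 \<le> (E \<tau> z)\<^sup>2"
      using \<delta>2(1) by (simp add: E_def e power_mult_distrib)
    then have "sqrt \<delta>2 * norm c \<le> E \<tau> z" by (rule power2_le_imp_le) (simp add: E_def)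
    then have nc: "norm c \<le> E \<tau> z / sqrt \<delta>2" using \<delta>2(1) by (simp add: field_simps)
    have "symp a c = symp z c" unfolding z symp_linear(1) symp_linear(5) by simp
    then have "\<bar>symp a c\<bar> \<le> S * norm z * norm c" using abs_symp_le[of z c] by (simp add: S_def)
    also have "\<dots> \<le> S * norm z * (E \<tau> z / sqrt \<delta>2)" using S nc by (intro mult_left_mono) auto
    finally show ?thesis using a c z by blast
  qed
  have shrink: "\<exists>g\<in>G. \<forall>z\<in>xi (span {u}). \<delta>1 * (norm (rho_diag rs g *v z))\<^sup>2 \<le> 2 * (S * norm z * (E \<tau> z / sqrt \<delta>2))"
    if \<tau>: "0 < \<tau>" "\<tau> \<le> 1" for \<tau>
  proof -
    \<comment> \<open>With \<open>l * \<tau> = 1 / l\<close>, the diagonal matrix sends the line of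
      (1, 1) to that of \<open>(1, \<tau>)\<close> and fixes the axes. So \<open>h0 ** D\<close>
      takes the standard triple to the lines of \<open>p \<tau>\<close>, \<open>s\<close> and
      \<open>u\<close>.\<close>
    define l where "l = 1 / sqrt \<tau>"
    have l: "l > 0" "l * \<tau> = 1 / l" using \<tau> by (auto simp: l_def real_div_sqrt)
    define D where "D = mat2 l 0 0 (1 / l)"
    have "det (h0 ** D) = 1" using l dh0 by (simp add: det_mul D_def)
    then obtain g k where gk: "g \<in> G" "k \<in> K" "h0 ** D = g ** k" using K(3) by blast
    define g' where "g' = matrix_inv g"
    have g': "g' \<in> G" using inv_G gk(1) by (simp add: g'_def)
    have "g' ** (h0 ** D) = k" unfolding gk(3) g'_def by (simp add: matrix_mul_assoc inv_G_mult[OF gk(1)])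
    then have kq: "k *v q = g' *v (h0 *v (D *v q))" for q by (metis matrix_vector_mul_assoc)
    have De: "D *v ?r = l *\<^sub>R vector [1, \<tau>]" "D *v ?e2 = (1 / l) *\<^sub>R ?e2" "D *v ?e1 = l *\<^sub>R ?e1"
      using l(2) by (simp_all add: vec_eq_iff forall_2 matrix_vector_mult_2 D_def)
    have sp: "span {k *v ?r} = span {g' *v p \<tau>}" "span {k *v ?e2} = span {g' *v s}" "span {k *v ?e1} = span {g' *v u}"
      unfolding kq De matrix_vector_mult_scaleR p_def s_def h0e1 using l(1) by (simp_all add: span_singleton_scale)
    show ?thesis
    proof (rule bexI[OF _ g'], rule ballI)
      fix z assume z: "z \<in> xi (span {u})"
      obtain a c where ac: "a \<in> xi (span {p \<tau>})" "c \<in> xi (span {s})" "z = a + c"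
        "\<bar>symp a c\<bar> \<le> S * norm z * (E \<tau> z / sqrt \<delta>2)" using decomp[of \<tau> z] \<tau> by auto
      let ?R = "\<lambda>v. rho_diag rs g' *v v"
      have "?R a \<in> xi (span {k *v ?r})" "?R c \<in> xi (span {k *v ?e2})" "?R z \<in> xi (span {k *v ?e1})"
        unfolding sp using rho_in_xi[OF g'] pne sne u ac z by blast+
      then have "xi_proj (k *v ?r) *v ?R a = ?R a" "xi_proj (k *v ?e2) *v ?R c = ?R c" "xi_proj (k *v ?e1) *v ?R z = ?R z"
        using xi_proj_fix kne[OF gk(2)] ne by blast+
      moreover have Rz: "?R z = ?R a + ?R c" unfolding ac(3) by (rule matrix_vector_right_distrib)
      ultimately have "\<delta>1 * ((norm (?R a))\<^sup>2 + (norm (?R c))\<^sup>2) \<le> \<bar>symp (?R a) (?R c)\<bar>"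
        using \<delta>1(2)[OF gk(2), of "?R a" "?R c"] by simp
      also have "symp (?R a) (?R c) = symp a c" by (rule symp_rho_diag) (rule det_rs[OF g'])
      finally have 1: "\<delta>1 * ((norm (?R a))\<^sup>2 + (norm (?R c))\<^sup>2) \<le> S * norm z * (E \<tau> z / sqrt \<delta>2)" using ac(4) by linarith
      have "(norm (?R z))\<^sup>2 \<le> (norm (?R a) + norm (?R c))\<^sup>2" unfolding Rz by (intro power_mono norm_triangle_ineq) auto
      also have "\<dots> \<le> 2 * ((norm (?R a))\<^sup>2 + (norm (?R c))\<^sup>2)"
        using sum_squares_bound[of "norm (?R a)" "norm (?R c)"] by (simp add: power2_sum)
      finally have "\<delta>1 * (norm (?R z))\<^sup>2 \<le> \<delta>1 * (2 * ((norm (?R a))\<^sup>2 + (norm (?R c))\<^sup>2))"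
        using \<delta>1(1) by (intro mult_left_mono) auto
      also have "\<dots> = 2 * (\<delta>1 * ((norm (?R a))\<^sup>2 + (norm (?R c))\<^sup>2))" by simp
      also have "\<dots> \<le> 2 * (S * norm z * (E \<tau> z / sqrt \<delta>2))" using 1 by (intro mult_left_mono) auto
      finally show "\<delta>1 * (norm (?R z))\<^sup>2 \<le> 2 * (S * norm z * (E \<tau> z / sqrt \<delta>2))" .
    qed
  qed
  define d where "d = det2 (blk i x) (blk i y)"
  \<comment> \<open>The two factors bound \<open>\<delta>1\<close> times the squared norms of the
    contracted \<open>x\<close> and \<open>y\<close>; the 4 is the square of the 2 in
    \<open>abs_det2_le\<close>.\<close>
  define f where "f \<tau> = 4 * (2 * (S * norm x * (E \<tau> x / sqrt \<delta>2))) * (2 * (S * norm y * (E \<tau> y / sqrt \<delta>2)))" for \<tau>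
  have bound: "\<delta>1\<^sup>2 * d\<^sup>2 \<le> f \<tau>" if \<tau>: "0 < \<tau>" "\<tau> \<le> 1" for \<tau>
  proof -
    obtain g where g: "g \<in> G" and b: "\<And>z. z \<in> xi (span {u}) \<Longrightarrow> \<delta>1 * (norm (rho_diag rs g *v z))\<^sup>2 \<le> 2 * (S * norm z * (E \<tau> z / sqrt \<delta>2))"
      using shrink[OF \<tau>] by blast
    let ?X = "rho_diag rs g *v x" and ?Y = "rho_diag rs g *v y"
    have "d = det2 (blk i ?X) (blk i ?Y)" unfolding d_def blk_rho_diag det2_matrix det_rs[OF g] by simp
    then have "\<bar>d\<bar> \<le> 2 * norm (blk i ?X) * norm (blk i ?Y)" using abs_det2_le by simp
    also have "\<dots> \<le> 2 * norm ?X * norm ?Y" by (intro mult_mono norm_blk_le) auto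
    finally have "\<bar>d\<bar>\<^sup>2 \<le> (2 * norm ?X * norm ?Y)\<^sup>2" by (intro power_mono) auto
    then have "\<delta>1\<^sup>2 * d\<^sup>2 \<le> \<delta>1\<^sup>2 * (2 * norm ?X * norm ?Y)\<^sup>2" by (intro mult_left_mono) auto
    also have "\<dots> = 4 * (\<delta>1 * (norm ?X)\<^sup>2) * (\<delta>1 * (norm ?Y)\<^sup>2)" by (simp add: power2_eq_square algebra_simps)
    also have "\<dots> \<le> f \<tau>" unfolding f_def using \<delta>1(1) \<delta>2(1) S
      by (intro mult_mono b xy mult_left_mono) (auto simp: E_def)
    finally show ?thesis .
  qed
  have cE: "continuous_on UNIV (\<lambda>\<tau>. E \<tau> z)" for z unfolding E_def by (intro continuous_intros cPp)
  have cf: "continuous_on UNIV f" unfolding f_def using \<delta>2(1) by (intro continuous_intros cE) auto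
  have "E 0 x = 0" unfolding E_def p0 using xi_proj_fix[OF u, of x] xy by simp
  then have f0: "f 0 = 0" by (simp add: f_def)
  have "(\<lambda>n. f (inverse (real (Suc n)))) \<longlonglongrightarrow> f 0"
    by (rule continuous_on_tendsto_compose[OF cf LIMSEQ_inverse_real_of_nat]) auto
  moreover have "\<delta>1\<^sup>2 * d\<^sup>2 \<le> f (inverse (real (Suc n)))" for n
    by (rule bound) (auto simp: inverse_le_1_iff)
  ultimately have "\<delta>1\<^sup>2 * d\<^sup>2 \<le> f 0" by (intro LIMSEQ_le_const) auto
  then have "\<delta>1\<^sup>2 * d\<^sup>2 \<le> 0" using f0 by simp
  moreover have "\<delta>1\<^sup>2 * d\<^sup>2 \<ge> 0" by simp
  ultimately have "\<delta>1\<^sup>2 * d\<^sup>2 = 0" by linarith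
  then show ?thesis using \<delta>1(1) by (simp add: d_def)
qed

text \<open>Vanishing block determinants put the \<open>i\<close>-th blocks on a common line, so the
  Lagrangian lies in a sum of \<open>CARD('n)\<close> lines. Its dimension forces equality.\<close>

lemma xi_split:
  assumes u: "u \<noteq> 0"
  shows "\<exists>w. (\<forall>i. norm (w i) = 1) \<and> xi (span {u}) = {x. \<forall>i. \<exists>c. blk i x = c *\<^sub>R w i}"
proof -
  let ?L = "xi (span {u})"
  have "\<exists>w. norm w = 1 \<and> (\<forall>x\<in>?L. \<exists>c. blk i x = c *\<^sub>R w)" for i
  proof (cases "\<exists>x\<in>?L. blk i x \<noteq> 0")
    case True
    then obtain x where x: "x \<in> ?L" "blk i x \<noteq> 0" by blast
    show ?thesis
    proof (intro exI[of _ "(1 / norm (blk i x)) *\<^sub>R blk i x"] conjI ballI)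
      fix y assume "y \<in> ?L"
      then obtain c where "blk i y = c *\<^sub>R blk i x"
        using blk_det2_zero[OF u x(1)] det2_eq_0_iff[OF x(2)] by blast
      then show "\<exists>c. blk i y = c *\<^sub>R (1 / norm (blk i x)) *\<^sub>R blk i x"
        using x(2) by (intro exI[of _ "c * norm (blk i x)"]) simp
    qed (use x in simp)
  next
    case False
    \<comment> \<open>If all \<open>i\<close>-th blocks vanish, any unit vector serves for the
      inclusion.\<close>
    then show ?thesis by (intro exI[of _ "axis 1 1"]) (auto intro!: exI[of _ 0] simp: norm_eq_1 inner_axis_axis)
  qed
  then obtain w where w: "\<And>i. norm (w i) = 1" "\<And>i x. x \<in> ?L \<Longrightarrow> \<exists>c. blk i x = c *\<^sub>R w i" by metis
  let ?S = "{x. \<forall>i. \<exists>c. blk i x = c *\<^sub>R w i}"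
  have sub: "?L \<subseteq> ?S" using w(2) by blast
  have sS: "subspace ?S"
  proof (rule subspaceI)
    show "0 \<in> ?S" by (auto intro: exI[of _ 0])
    show "x + y \<in> ?S" if "x \<in> ?S" "y \<in> ?S" for x y
      using that by (auto simp flip: scaleR_add_left) (metis scaleR_add_left)
    show "c *\<^sub>R x \<in> ?S" if "x \<in> ?S" for c x
      using that by (auto) (metis scaleR_scaleR)
  qed
  have "?S \<subseteq> span (range (\<lambda>i. emb i (w i)))"
  proof
    fix x assume "x \<in> ?S"
    then obtain c where c: "\<And>i. blk i x = c i *\<^sub>R w i" by (auto, metis)
    have "x = (\<Sum>i\<in>UNIV. c i *\<^sub>R emb i (w i))"
      by (rule blk_eqI) (simp add: blk_sum blk_emb c if_distrib[of "\<lambda>v. _ *\<^sub>R v"] cong: if_cong)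
    also have "\<dots> \<in> span (range (\<lambda>i. emb i (w i)))"
      by (intro span_sum span_scale span_base) auto
    finally show "x \<in> span (range (\<lambda>i. emb i (w i)))" .
  qed
  then have "dim ?S \<le> card (range (\<lambda>i. emb i (w i)))" by (rule dim_le_card) simp
  also have "\<dots> \<le> CARD('n)" by (rule card_image_le) simp
  also have "\<dots> = dim ?L" using xi_Lag[OF u] by (simp add: Lag_def)
  finally have "?L = ?S" by (rule subspace_dim_equal[OF xi_subspace[OF u] sS sub])
  then show ?thesis using w(1) by blast
qed

section \<open>The component maps of the limit map\<close>

definition split_dirs :: "(real^2) set \<Rightarrow> 'n \<Rightarrow> real^2" where
  "split_dirs L = (SOME w. (\<forall>i. norm (w i) = 1) \<and> xi L = {x. \<forall>i. \<exists>c. blk i x = c *\<^sub>R w i})"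

definition dirn :: "'n \<Rightarrow> real^2 \<Rightarrow> real^2" where
  "dirn i u = split_dirs (span {u}) i"

lemma dirn:
  assumes "u \<noteq> 0"
  shows norm_dirn: "norm (dirn i u) = 1"
    and xi_eq_dirn: "xi (span {u}) = {x. \<forall>i. \<exists>c. blk i x = c *\<^sub>R dirn i u}"
  using someI_ex[OF xi_split[OF assms]] unfolding dirn_def split_dirs_def by blast+

lemma dirn_scale: "c \<noteq> 0 \<Longrightarrow> dirn i (c *\<^sub>R u) = dirn i u"
  by (simp add: dirn_def span_singleton_scale)

lemma emb_in_xi:
  assumes "u \<noteq> 0"
  shows "emb i p \<in> xi (span {u}) \<longleftrightarrow> (\<exists>c. p = c *\<^sub>R dirn i u)"
proof
  assume "emb i p \<in> xi (span {u})"
  then have "\<forall>j. \<exists>c. blk j (emb i p) = c *\<^sub>R dirn j u" unfolding xi_eq_dirn[OF assms] by simp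
  then show "\<exists>c. p = c *\<^sub>R dirn i u" by (auto dest!: spec[of _ i] simp: blk_emb)
next
  assume "\<exists>c. p = c *\<^sub>R dirn i u"
  then obtain c where c: "p = c *\<^sub>R dirn i u" ..
  have "\<exists>c. blk j (emb i p) = c *\<^sub>R dirn j u" for j
    by (cases "j = i") (auto simp: blk_emb c intro: exI[of _ 0])
  then show "emb i p \<in> xi (span {u})" unfolding xi_eq_dirn[OF assms] by simp
qed

text \<open>The Lagrangian is an orthogonal sum of lines in the coordinate planes, so its projection
  is block diagonal, with the rank-one projections onto these lines as blocks.\<close>

lemma xi_proj_entry:
  assumes u: "u \<noteq> 0"
  shows "xi_proj u $ pick i a $ pick j b = (if i = j then dirn i u $ a * dirn i u $ b else 0)"
proof -
  let ?x = "axis (pick j b) 1 :: real^('n + 'n)"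
  let ?w = "dirn j u"
  let ?y = "emb j ((?w $ b) *\<^sub>R ?w)"
  have bx: "blk i ?x = (if i = j then axis b 1 else 0)" for i
    using exhaust_2[of b] by (auto simp: vec_eq_iff forall_2 axis_def pick_def)
  have ww: "inner ?w ?w = 1" using norm_dirn[OF u, of j] by (simp add: norm_eq_1)
  have "xi_proj u *v ?x = ?y" unfolding xi_proj_def
  proof (rule orthproj_eqI[OF xi_subspace[OF u]])
    show "?y \<in> xi (span {u})" unfolding emb_in_xi[OF u] by blast
    fix z assume "z \<in> xi (span {u})"
    then obtain c where c: "blk j z = c *\<^sub>R ?w" unfolding xi_eq_dirn[OF u] by blast
    have "inner (?x - ?y) z = (\<Sum>i\<in>UNIV. if i = j then inner (axis b 1 - (?w $ b) *\<^sub>R ?w) (blk j z) else 0)"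
      unfolding inner_blk blk_linear bx blk_emb by (intro sum.cong) auto
    also have "\<dots> = inner (axis b 1 - (?w $ b) *\<^sub>R ?w) (c *\<^sub>R ?w)" unfolding c by simp
    also have "\<dots> = 0" by (simp add: inner_diff_left ww inner_axis')
    finally show "inner (?x - ?y) z = 0" .
  qed
  then have "xi_proj u $ pick i a $ pick j b = ?y $ pick i a"
    unfolding matrix_vector_mult_basis by (metis column_def vec_lambda_beta)
  also have "\<dots> = blk i ?y $ a" by simp
  also have "\<dots> = (if i = j then dirn i u $ a * dirn i u $ b else 0)" by (simp add: blk_emb)
  finally show ?thesis .
qed

text \<open>The unit vector \<open>dirn i u\<close> is chosen with an arbitrary sign. The products
  do not depend on it and are entries of the continuous projection.\<close>

lemma continuous_dirn_products: "continuous_on (- {0}) (\<lambda>u. dirn i u $ a * dirn i u $ b)"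
proof -
  have "continuous_on (- {0}) (\<lambda>u. xi_proj u $ pick i a $ pick i b)"
    by (intro continuous_intros continuous_xi_proj)
  then show ?thesis by (rule continuous_on_eq) (simp add: xi_proj_entry)
qed

lemma dirn_transverse:
  assumes "det2 u v \<noteq> 0"
  shows "det2 (dirn i u) (dirn i v) \<noteq> 0"
proof
  assume d: "det2 (dirn i u) (dirn i v) = 0"
  have uv: "u \<noteq> 0" "v \<noteq> 0" using assms by (auto simp: det2_def)
  have n0: "dirn i u \<noteq> 0" using norm_dirn[OF uv(1), of i] by auto
  then obtain c where "dirn i v = c *\<^sub>R dirn i u" using d det2_eq_0_iff by blast
  then have "emb i (dirn i v) \<in> xi (span {u}) \<inter> xi (span {v})"
    using emb_in_xi[OF uv(1)] emb_in_xi[OF uv(2), of i "dirn i v"] by (auto intro: exI[of _ 1])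
  then have "emb i (dirn i v) = 0" using xi_transverse[OF assms] by blast
  then have "blk i (emb i (dirn i v)) = 0" by simp
  then show False using norm_dirn[OF uv(2), of i] by (simp add: blk_emb)
qed

lemma dirn_equivariant:
  assumes g: "g \<in> G" and u: "u \<noteq> 0"
  shows "\<exists>c. c \<noteq> 0 \<and> rs i g *v dirn i u = c *\<^sub>R dirn i (g *v u)"
proof -
  have gu: "g *v u \<noteq> 0" using det_G[OF g] u by (intro det_nz_mult_nz) auto
  have "emb i (dirn i u) \<in> xi (span {u})" unfolding emb_in_xi[OF u] by (rule exI[of _ 1]) simp
  then have "rho_diag rs g *v emb i (dirn i u) \<in> xi (span {g *v u})" by (rule rho_in_xi[OF g u])
  then obtain c where "blk i (rho_diag rs g *v emb i (dirn i u)) = c *\<^sub>R dirn i (g *v u)"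
    unfolding xi_eq_dirn[OF gu] by blast
  then have c: "rs i g *v dirn i u = c *\<^sub>R dirn i (g *v u)" by (simp add: blk_rho_diag blk_emb)
  have "dirn i u \<noteq> 0" using norm_dirn[OF u, of i] by auto
  then have "rs i g *v dirn i u \<noteq> 0" using det_rs[OF g, of i] by (intro det_nz_mult_nz) auto
  then show ?thesis using c by (intro exI[of _ c]) auto
qed

end

section \<open>Affine charts of the boundary maps\<close>

lemma strict_mono_surjI:
  fixes f :: "real \<Rightarrow> real"
  assumes sm: "strict_mono f" and cont: "continuous_on UNIV f"
    and unb: "\<And>B. \<exists>X. \<forall>x. X \<le> \<bar>x\<bar> \<longrightarrow> B < (f x)\<^sup>2"
  shows "surj f"
proof -
  have "\<exists>x. f x = y" for y
  proof -
    obtain X where X: "\<And>x. X \<le> \<bar>x\<bar> \<Longrightarrow> (\<bar>y\<bar> + \<bar>f 0\<bar>)\<^sup>2 < (f x)\<^sup>2" using unb by blast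
    have big: "\<bar>y\<bar> + \<bar>f 0\<bar> < \<bar>f x\<bar>" if "X \<le> \<bar>x\<bar>" for x
      using X[OF that] by (metis abs_ge_zero add_nonneg_nonneg power2_abs power2_less_imp_less)
    define b where "b = \<bar>X\<bar> + 1"
    have b: "b > 0" "X \<le> \<bar>b\<bar>" "X \<le> \<bar>- b\<bar>" by (auto simp: b_def)
    have "f 0 < f b" "f (-b) < f 0" using b(1) by (auto intro: strict_monoD[OF sm])
    then have "y \<le> f b" "f (-b) \<le> y" using big[OF b(2)] big[OF b(3)] by linarith+
    moreover have "- b \<le> b" using b by simp
    ultimately show ?thesis
      using IVT'[of f "-b" y b] continuous_on_subset[OF cont subset_UNIV] by blast
  qed
  then show ?thesis unfolding surj_def by metis
qed

text \<open>Meant for a matrix of determinant 1 with columns \<open>\<alpha> *\<^sub>R w1\<close>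
  and \<open>\<beta> *\<^sub>R w2\<close> whose sum is parallel to \<open>w3\<close>, with
  \<open>d12\<close>, \<open>d13\<close>, \<open>d23\<close> the determinants of pairs. Eliminating
  \<open>\<beta>\<close> leaves \<open>\<alpha>\<^sup>2 * d13 * d12 = - d23\<close>, so directions
  that stay apart bound the scalars.\<close>

lemma abs_scalar_bound:
  fixes \<alpha> \<beta> :: real
  assumes "\<alpha> * \<beta> * d12 = 1" "\<alpha> * d13 + \<beta> * d23 = 0" "\<delta> \<le> \<bar>d12\<bar>" "\<delta> \<le> \<bar>d13\<bar>" "\<bar>d23\<bar> \<le> 2" "\<delta> > 0"
  shows "\<bar>\<alpha>\<bar> \<le> 2 / \<delta>"
proof -
  have e: "\<alpha> * d13 = - (\<beta> * d23)" using assms(2) by linarith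
  have "\<alpha>\<^sup>2 * (d13 * d12) = (\<alpha> * d13) * (\<alpha> * d12)" by (simp add: power2_eq_square)
  also have "\<dots> = - d23 * (\<alpha> * \<beta> * d12)" unfolding e by simp
  finally have "\<alpha>\<^sup>2 * (d13 * d12) = - d23" using assms(1) by simp
  then have "\<alpha>\<^sup>2 * (\<bar>d13\<bar> * \<bar>d12\<bar>) = \<bar>d23\<bar>" by (metis abs_minus_cancel abs_mult abs_power2)
  moreover have "\<alpha>\<^sup>2 * (\<delta> * \<delta>) \<le> \<alpha>\<^sup>2 * (\<bar>d13\<bar> * \<bar>d12\<bar>)"
    using assms by (intro mult_left_mono mult_mono) auto
  ultimately have "(\<bar>\<alpha>\<bar> * \<delta>)\<^sup>2 \<le> 2\<^sup>2" using assms(5) by (simp add: power2_eq_square algebra_simps)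
  then have "\<bar>\<alpha>\<bar> * \<delta> \<le> 2" by (rule power2_le_imp_le) simp
  then show ?thesis using assms(6) by (simp add: field_simps)
qed

text \<open>Three distinct lines can be put in standard position, but a matrix of positive
  determinant keeps the cyclic order; hence the two possible third lines.\<close>

lemma sl2_with_columns:
  fixes u1 u2 u3 :: "real^2"
  assumes "det2 u1 u2 \<noteq> 0" "det2 u2 u3 \<noteq> 0" "det2 u1 u3 \<noteq> 0"
  shows "\<exists>A \<sigma> t1 t2 t3. det A = 1 \<and> (\<sigma> = 1 \<or> \<sigma> = (-1::real)) \<and> t1 \<noteq> 0 \<and> t2 \<noteq> 0 \<and> t3 \<noteq> 0 \<and>
    A *v vector [1, 0] = t1 *\<^sub>R u1 \<and> A *v vector [0, 1] = t2 *\<^sub>R u2 \<and> A *v vector [1, \<sigma>] = t3 *\<^sub>R u3"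
proof -
  define \<alpha> where "\<alpha> = - det2 u2 u3 / det2 u1 u2"
  define \<beta> where "\<beta> = det2 u1 u3 / det2 u1 u2"
  have ab: "\<alpha> \<noteq> 0" "\<beta> \<noteq> 0" using assms by (auto simp: \<alpha>_def \<beta>_def)
  have cr: "det2 u1 u2 *\<^sub>R u3 = (- det2 u2 u3) *\<^sub>R u1 + det2 u1 u3 *\<^sub>R u2"
    by (simp add: vec_eq_iff forall_2 det2_def algebra_simps)
  have "u3 = (1 / det2 u1 u2) *\<^sub>R (det2 u1 u2 *\<^sub>R u3)" using assms(1) by simp
  also have "\<dots> = \<alpha> *\<^sub>R u1 + \<beta> *\<^sub>R u2" unfolding cr by (simp add: \<alpha>_def \<beta>_def scaleR_right_diff_distrib)
  finally have u3: "u3 = \<alpha> *\<^sub>R u1 + \<beta> *\<^sub>R u2" .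
  define \<Delta> where "\<Delta> = \<alpha> * \<beta> * det2 u1 u2"
  have D0: "\<Delta> \<noteq> 0" using ab assms by (simp add: \<Delta>_def)
  \<comment> \<open>Flipping the second column makes the determinant positive, so that scaling by
    \<open>r\<close> brings it to 1.\<close>
  define \<sigma> where "\<sigma> = (if \<Delta> > 0 then 1 else -1 :: real)"
  have sD: "\<sigma> * \<Delta> = \<bar>\<Delta>\<bar>" "\<sigma> * \<sigma> = 1" by (auto simp: \<sigma>_def)
  define r where "r = 1 / sqrt \<bar>\<Delta>\<bar>"
  have r: "r \<noteq> 0" "r * r * \<bar>\<Delta>\<bar> = 1" using D0 by (auto simp: r_def)
  define A where "A = mat2 (r * \<alpha> * u1$1) (\<sigma> * r * \<beta> * u2$1) (r * \<alpha> * u1$2) (\<sigma> * r * \<beta> * u2$2)"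
  have "det A = (r * r) * (\<sigma> * \<Delta>)" by (simp add: A_def \<Delta>_def det2_def algebra_simps)
  then have dA: "det A = 1" using sD r by simp
  have "A *v vector [1, 0] = (r * \<alpha>) *\<^sub>R u1" "A *v vector [0, 1] = (\<sigma> * r * \<beta>) *\<^sub>R u2"
    by (simp_all add: A_def vec_eq_iff forall_2 matrix_vector_mult_2)
  moreover have "A *v vector [1, \<sigma>] = r *\<^sub>R u3"
  proof -
    have "(A *v vector [1, \<sigma>]) $ j = r * (\<alpha> * u1$j + (\<sigma> * \<sigma>) * \<beta> * u2$j)" for j
      using exhaust_2[of j] by (auto simp: A_def matrix_vector_mult_2 algebra_simps)
    then show ?thesis unfolding u3 sD by (simp add: vec_eq_iff)
  qed
  moreover have "\<sigma> = 1 \<or> \<sigma> = -1" "r * \<alpha> \<noteq> 0" "\<sigma> * r * \<beta> \<noteq> 0" using ab r by (auto simp: \<sigma>_def)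
  ultimately show ?thesis using dA r(1) by blast
qed

context limit_map
begin

abbreviation pt :: "real \<Rightarrow> real^2" where "pt x \<equiv> vector [x, 1]"
abbreviation pinf :: "real^2" where "pinf \<equiv> vector [1, 0]"

lemma pt_nz [simp]: "pt x \<noteq> 0" "pinf \<noteq> 0"
  by (simp_all add: vec_eq_iff forall_2)

lemma continuous_pt: "continuous_on UNIV pt"
proof -
  have "continuous_on UNIV (\<lambda>x. x *\<^sub>R pinf + vector [0, 1])" by (intro continuous_intros)
  then show ?thesis by (rule continuous_on_eq) (simp add: vec_eq_iff forall_2)
qed

lemma continuous_dirn_products_pt: "continuous_on UNIV (\<lambda>x. dirn i (pt x) $ a * dirn i (pt x) $ b)"
  by (rule continuous_on_compose2[OF continuous_dirn_products continuous_pt]) auto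

text \<open>The rotation (reflection if \<open>\<sigma> = -1\<close>) moves \<open>\<xi>\<^sub>i(\<infinity>)\<close> to \<open>\<infinity>\<close>; \<open>\<sigma>\<close> is chosen to make \<open>F\<close> increasing.\<close>
definition is_chart :: "'n \<Rightarrow> real \<Rightarrow> real \<Rightarrow> real \<Rightarrow> (real \<Rightarrow> real) \<Rightarrow> bool" where
  "is_chart i a b \<sigma> F \<longleftrightarrow> a\<^sup>2 + b\<^sup>2 = 1 \<and> (\<sigma> = 1 \<or> \<sigma> = -1) \<and> strict_mono F \<and> surj F \<and>
     (\<forall>x. \<exists>q. q \<noteq> 0 \<and> mat2 (\<sigma> * a) (\<sigma> * b) (- b) a *v dirn i (pt x) = q *\<^sub>R pt (F x)) \<and>
     (\<exists>q. q \<noteq> 0 \<and> mat2 (\<sigma> * a) (\<sigma> * b) (- b) a *v dirn i pinf = q *\<^sub>R pinf)"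

text \<open>\<open>F0\<close> is the affine coordinate of the direction after a rotation that takes
  the direction over infinity to infinity. Transversality makes it injective, so it is monotone once
  it is continuous; it is onto because its denominator tends to 0 at infinity.\<close>

lemma ex_chart: "\<exists>a b \<sigma> F. is_chart i a b \<sigma> F"
proof -
  define w0 where "w0 = dirn i pinf"
  define w where "w x = dirn i (pt x)" for x
  define a where "a = w0$1"
  define b where "b = w0$2"
  have sq1: "(v$1)\<^sup>2 + (v$2)\<^sup>2 = 1" if "norm v = 1" for v :: "real^2"
    using that by (simp add: norm_eq_1 inner_vec_def sum_2 power2_eq_square)
  have ab: "a\<^sup>2 + b\<^sup>2 = 1" using sq1[of w0] norm_dirn[of pinf i] by (simp add: w0_def a_def b_def)
  have w1: "(w x$1)\<^sup>2 + (w x$2)\<^sup>2 = 1" for x using sq1[of "w x"] norm_dirn[of "pt x" i] by (simp add: w_def)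
  define d where "d x = a * w x$2 - b * w x$1" for x
  define n where "n x = a * w x$1 + b * w x$2" for x
  have d0: "d x \<noteq> 0" for x
    using dirn_transverse[of pinf "pt x" i] by (simp add: d_def w_def w0_def a_def b_def det2_def)
  have nd: "(n x)\<^sup>2 + (d x)\<^sup>2 = 1" for x
  proof -
    have "(n x)\<^sup>2 + (d x)\<^sup>2 = (a\<^sup>2 + b\<^sup>2) * ((w x$1)\<^sup>2 + (w x$2)\<^sup>2)"
      by (simp add: n_def d_def power2_eq_square algebra_simps)
    then show ?thesis using ab w1 by simp
  qed
  define F0 where "F0 x = n x / d x" for x
  define pr where "pr j k x = w x$j * w x$k" for j k x
  have cp: "continuous_on UNIV (pr j k)" for j k
    unfolding pr_def w_def by (rule continuous_dirn_products_pt)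
  \<comment> \<open>Expanding the fraction by \<open>d x\<close> removes the arbitrary sign of
    \<open>w x\<close> and leaves the continuous products.\<close>
  have F0_alt: "F0 x = (a\<^sup>2 * pr 1 2 x - a * b * pr 1 1 x + a * b * pr 2 2 x - b\<^sup>2 * pr 1 2 x)
     / (a\<^sup>2 * pr 2 2 x - 2 * a * b * pr 1 2 x + b\<^sup>2 * pr 1 1 x)" for x
  proof -
    have "F0 x = (n x * d x) / (d x * d x)" unfolding F0_def using d0 by simp
    also have "n x * d x = a\<^sup>2 * pr 1 2 x - a * b * pr 1 1 x + a * b * pr 2 2 x - b\<^sup>2 * pr 1 2 x"
      by (simp add: n_def d_def pr_def power2_eq_square algebra_simps)
    also have "d x * d x = a\<^sup>2 * pr 2 2 x - 2 * a * b * pr 1 2 x + b\<^sup>2 * pr 1 1 x"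
      by (simp add: d_def pr_def power2_eq_square algebra_simps)
    finally show ?thesis .
  qed
  have dd: "d x * d x = a\<^sup>2 * pr 2 2 x - 2 * a * b * pr 1 2 x + b\<^sup>2 * pr 1 1 x" for x
    by (simp add: d_def pr_def power2_eq_square algebra_simps)
  have cF0: "continuous_on UNIV F0"
    unfolding F0_alt[abs_def]
  proof (intro continuous_on_divide ballI)
    fix x show "a\<^sup>2 * pr 2 2 x - 2 * a * b * pr 1 2 x + b\<^sup>2 * pr 1 1 x \<noteq> 0"
      unfolding dd[symmetric] using d0 by simp
  qed (intro continuous_on_add continuous_on_diff continuous_on_mult continuous_on_const cp)+
  have injF0: "x = y" if "F0 x = F0 y" for x y
  proof (rule ccontr)
    assume "x \<noteq> y"
    then have "det2 (pt x) (pt y) \<noteq> 0" by (simp add: det2_def)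
    then have "det2 (w x) (w y) \<noteq> 0" unfolding w_def by (rule dirn_transverse)
    moreover have "n x / d x = n y / d y" using that by (simp only: F0_def)
    then have "n x * d y - n y * d x = 0" by (simp add: frac_eq_eq d0)
    moreover have "n x * d y - n y * d x = (a\<^sup>2 + b\<^sup>2) * det2 (w x) (w y)"
      by (simp add: n_def d_def det2_def power2_eq_square algebra_simps)
    ultimately show False using ab by simp
  qed
  \<comment> \<open>\<open>pt x\<close> spans the same line as
    \<open>pinf + inverse x *\<^sub>R vector [0, 1]\<close>, which tends to \<open>pinf\<close>,
    where the quadratic form \<open>D\<close> vanishes.\<close>
  have lim: "((\<lambda>x. d x * d x) \<longlongrightarrow> 0) at_infinity"
  proof -
    define Dp where "Dp j k u = dirn i u$j * dirn i u$k" for j k u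
    have cDp: "continuous_on (- {0}) (Dp j k)" for j k unfolding Dp_def by (rule continuous_dirn_products)
    define D where "D u = a\<^sup>2 * Dp 2 2 u - 2 * a * b * Dp 1 2 u + b\<^sup>2 * Dp 1 1 u" for u
    have cD: "continuous_on (- {0}) D" unfolding D_def by (intro continuous_intros cDp)
    have "D pinf = 0" by (simp add: D_def Dp_def a_def b_def w0_def power2_eq_square)
    have "((\<lambda>x. pinf + inverse x *\<^sub>R vector [0, 1]) \<longlongrightarrow> pinf + 0 *\<^sub>R vector [0, 1]) at_infinity"
      by (intro tendsto_intros tendsto_inverse_0)
    then have "((\<lambda>x. pinf + inverse x *\<^sub>R vector [0, 1]) \<longlongrightarrow> pinf) at_infinity" by simp
    moreover have "pinf + t *\<^sub>R vector [0, 1] \<noteq> 0" for t by (simp add: vec_eq_iff forall_2)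
    ultimately have "((\<lambda>x. D (pinf + inverse x *\<^sub>R vector [0, 1])) \<longlongrightarrow> D pinf) at_infinity"
      by (intro continuous_on_tendsto_compose[OF cD]) auto
    then have l0: "((\<lambda>x. D (pinf + inverse x *\<^sub>R vector [0, 1])) \<longlongrightarrow> 0) at_infinity" using \<open>D pinf = 0\<close> by simp
    have "eventually (\<lambda>x::real. x \<noteq> 0) at_infinity"
      unfolding eventually_at_infinity by (rule exI[of _ 1]) auto
    then have ev: "eventually (\<lambda>x. D (pinf + inverse x *\<^sub>R vector [0, 1]) = d x * d x) at_infinity"
    proof eventually_elim
      case (elim x)
      have "pt x = x *\<^sub>R (pinf + inverse x *\<^sub>R vector [0, 1])" using elim by (simp add: vec_eq_iff forall_2)
      then have "w x = dirn i (pinf + inverse x *\<^sub>R vector [0, 1])" unfolding w_def by (simp only: dirn_scale[OF elim])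
      then show ?case unfolding D_def Dp_def dd pr_def by simp
    qed
    show ?thesis by (rule tendsto_cong[THEN iffD1, OF ev l0])
  qed
  have unb: "\<exists>X. \<forall>x. X \<le> \<bar>x\<bar> \<longrightarrow> B < (F0 x)\<^sup>2" for B
  proof -
    have "eventually (\<lambda>x. d x * d x < 1 / (\<bar>B\<bar> + 1)) at_infinity"
      using lim by (rule order_tendstoD(2)) simp
    then obtain X where X: "\<And>x. X \<le> \<bar>x\<bar> \<Longrightarrow> d x * d x < 1 / (\<bar>B\<bar> + 1)"
      unfolding eventually_at_infinity by auto
    have "B < (F0 x)\<^sup>2" if "X \<le> \<bar>x\<bar>" for x
    proof -
      have dpos: "(d x)\<^sup>2 > 0" using d0 by simp
      have "(d x)\<^sup>2 < 1 / (\<bar>B\<bar> + 1)" using X[OF that] by (simp add: power2_eq_square)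
      then have "(d x)\<^sup>2 * (\<bar>B\<bar> + 1) < 1" by (simp add: field_simps)
      then have "\<bar>B\<bar> * (d x)\<^sup>2 < 1 - (d x)\<^sup>2" by (simp add: algebra_simps)
      also have "1 - (d x)\<^sup>2 = (n x)\<^sup>2" using nd[of x] by linarith
      finally have "\<bar>B\<bar> < (n x)\<^sup>2 / (d x)\<^sup>2" using dpos by (simp add: pos_less_divide_eq)
      then show ?thesis by (simp add: F0_def power_divide)
    qed
    then show ?thesis by blast
  qed
  have "strict_mono F0 \<or> strict_mono (\<lambda>x. - F0 x)"
  proof -
    have "inj_on F0 UNIV" using injF0 by (auto simp: inj_on_def)
    then have "strict_mono_on UNIV F0 \<or> strict_antimono_on UNIV F0"
      using injective_eq_monotone_map[OF _ cF0] by (simp add: is_interval_univ)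
    then show ?thesis by (auto simp: monotone_on_def intro!: strict_monoI)
  qed
  then obtain \<sigma> :: real where \<sigma>: "\<sigma> = 1 \<or> \<sigma> = -1" "strict_mono (\<lambda>x. \<sigma> * F0 x)"
    by (elim disjE) (auto intro: exI[of _ 1] exI[of _ "-1"] dest: meta_spec[of _ 1] meta_spec[of _ "-1"])
  have surjF: "surj (\<lambda>x. \<sigma> * F0 x)"
  proof (rule strict_mono_surjI[OF \<sigma>(2)])
    show "continuous_on UNIV (\<lambda>x. \<sigma> * F0 x)" by (intro continuous_intros cF0)
    have "\<sigma>\<^sup>2 = 1" using \<sigma>(1) by auto
    then show "\<exists>X. \<forall>x. X \<le> \<bar>x\<bar> \<longrightarrow> B < (\<sigma> * F0 x)\<^sup>2" for B unfolding power_mult_distrib using unb[of B] by simp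
  qed
  have "mat2 (\<sigma> * a) (\<sigma> * b) (- b) a *v dirn i (pt x) = d x *\<^sub>R pt (\<sigma> * F0 x)" for x
    using d0[of x] unfolding w_def[symmetric]
    by (simp add: vec_eq_iff forall_2 matrix_vector_mult_2 F0_def n_def) (simp add: d_def algebra_simps)
  moreover have "mat2 (\<sigma> * a) (\<sigma> * b) (- b) a *v dirn i pinf = \<sigma> *\<^sub>R pinf"
  proof -
    have "\<sigma> * a * a + \<sigma> * b * b = \<sigma> * (a\<^sup>2 + b\<^sup>2)" by (simp add: power2_eq_square algebra_simps)
    then have "\<sigma> * a * a + \<sigma> * b * b = \<sigma>" using ab by simp
    then show ?thesis unfolding w0_def[symmetric]
      by (simp add: vec_eq_iff forall_2 matrix_vector_mult_2) (simp add: a_def b_def)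
  qed
  moreover have "\<sigma> \<noteq> 0" using \<sigma>(1) by auto
  ultimately have "is_chart i a b \<sigma> (\<lambda>x. \<sigma> * F0 x)"
    unfolding is_chart_def using ab \<sigma> surjF d0 by blast
  then show ?thesis by blast
qed

end

lemma mat2_mult: "mat2 a b c d ** mat2 a' b' c' d' = mat2 (a*a' + b*c') (a*b' + b*d') (c*a' + d*c') (c*b' + d*d')"
  unfolding mat2_eq_iff by (simp add: matrix_mul_2_nth)

lemma mat2_one: "mat 1 = mat2 1 0 0 1"
  unfolding mat2_eq_iff by (simp add: mat_def)

lemma abs_mult_entry_le:
  fixes A B :: "real^2^2"
  assumes "\<And>i j. \<bar>A$i$j\<bar> \<le> C" "\<And>i j. \<bar>B$i$j\<bar> \<le> D" "C \<ge> 0" "D \<ge> 0"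
  shows "\<bar>(A ** B)$i$j\<bar> \<le> 2 * C * D"
proof -
  have "\<bar>(A ** B)$i$j\<bar> \<le> \<bar>A$i$1\<bar> * \<bar>B$1$j\<bar> + \<bar>A$i$2\<bar> * \<bar>B$2$j\<bar>"
    unfolding matrix_mul_2_nth abs_mult[symmetric] by (rule abs_triangle_ineq)
  also have "\<dots> \<le> C * D + C * D" using assms by (intro add_mono mult_mono) auto
  finally show ?thesis by simp
qed

section \<open>The representations in chart coordinates and their cocompactness\<close>

context limit_map
begin

definition chart_mat :: "real \<Rightarrow> real \<Rightarrow> real \<Rightarrow> real^2^2" where
  "chart_mat a b \<sigma> = mat2 (\<sigma> * a) (\<sigma> * b) (- b) a"

definition chart_inv :: "real \<Rightarrow> real \<Rightarrow> real \<Rightarrow> real^2^2" where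
  "chart_inv a b \<sigma> = mat2 (\<sigma> * a) (- b) (\<sigma> * b) a"

definition chart_rep :: "'n \<Rightarrow> real \<Rightarrow> real \<Rightarrow> real \<Rightarrow> real^2^2 \<Rightarrow> real^2^2" where
  "chart_rep i a b \<sigma> g = chart_mat a b \<sigma> ** rs i g ** chart_inv a b \<sigma>"

lemma chart_inverse:
  assumes "is_chart i a b \<sigma> F"
  shows "chart_mat a b \<sigma> ** chart_inv a b \<sigma> = mat 1" "chart_inv a b \<sigma> ** chart_mat a b \<sigma> = mat 1"
    "det (chart_mat a b \<sigma>) = \<sigma>" "det (chart_inv a b \<sigma>) = \<sigma>" "\<sigma> * \<sigma> = 1"
proof -
  have ab: "a * a + b * b = 1" and s: "\<sigma> * \<sigma> = 1" using assms by (auto simp: is_chart_def power2_eq_square)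
  show "chart_mat a b \<sigma> ** chart_inv a b \<sigma> = mat 1"
    unfolding chart_mat_def chart_inv_def mat2_mult mat2_one mat2_eq_iff mat2_nth
    apply (intro conjI) using ab s by algebra+
  show "chart_inv a b \<sigma> ** chart_mat a b \<sigma> = mat 1"
    unfolding chart_mat_def chart_inv_def mat2_mult mat2_one mat2_eq_iff mat2_nth
    apply (intro conjI) using ab s by algebra+
  have "det (chart_mat a b \<sigma>) = \<sigma> * (a * a + b * b)" "det (chart_inv a b \<sigma>) = \<sigma> * (a * a + b * b)"
    by (simp_all add: chart_mat_def chart_inv_def algebra_simps)
  then show "det (chart_mat a b \<sigma>) = \<sigma>" "det (chart_inv a b \<sigma>) = \<sigma>" using ab by simp_all
  show "\<sigma> * \<sigma> = 1" by (rule s)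
qed

lemma det_chart_rep:
  assumes "is_chart i a b \<sigma> F" "g \<in> G"
  shows "det (chart_rep i a b \<sigma> g) = 1"
  unfolding chart_rep_def det_mul chart_inverse[OF assms(1)] det_rs[OF assms(2)]
  using chart_inverse(5)[OF assms(1)] by simp

lemma chart_mat_dirn:
  assumes "is_chart i a b \<sigma> F"
  shows "\<exists>q. q \<noteq> 0 \<and> chart_mat a b \<sigma> *v dirn i (pt x) = q *\<^sub>R pt (F x)"
    "\<exists>q. q \<noteq> 0 \<and> chart_mat a b \<sigma> *v dirn i pinf = q *\<^sub>R pinf"
  using assms unfolding is_chart_def chart_mat_def by blast+

text \<open>The chart takes the direction over infinity to infinity. So \<open>g\<close> has a pole
  at \<open>x\<close> exactly when the conjugated matrix has one at \<open>F x\<close>.\<close>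

lemma chart_equivariant:
  assumes ch: "is_chart i a b \<sigma> F" and g: "g \<in> G"
  defines "s \<equiv> chart_rep i a b \<sigma> g"
  shows "g$2$1 * x + g$2$2 \<noteq> 0 \<longleftrightarrow> s$2$1 * F x + s$2$2 \<noteq> 0"
    and "g$2$1 * x + g$2$2 \<noteq> 0 \<Longrightarrow> F (mob g x) = mob s (F x)"
proof -
  let ?M = "chart_mat a b \<sigma>"
  obtain q where q: "q \<noteq> 0" "?M *v dirn i (pt x) = q *\<^sub>R pt (F x)" using chart_mat_dirn[OF ch] by blast
  obtain k where k: "k \<noteq> 0" "rs i g *v dirn i (pt x) = k *\<^sub>R dirn i (g *v pt x)"
    using dirn_equivariant[OF g pt_nz(1)] by blast
  have "pt (F x) = (1 / q) *\<^sub>R (?M *v dirn i (pt x))" using q by simp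
  then have "s *v pt (F x) = (1 / q) *\<^sub>R (?M *v (rs i g *v ((chart_inv a b \<sigma> ** ?M) *v dirn i (pt x))))"
    unfolding s_def chart_rep_def by (simp add: matrix_vector_mult_scaleR matrix_vector_mul_assoc[symmetric] del: matrix_vector_mul_assoc)
  also have "\<dots> = (k / q) *\<^sub>R (?M *v dirn i (g *v pt x))"
    unfolding chart_inverse(2)[OF ch] by (simp add: k matrix_vector_mult_scaleR)
  finally have sF: "s *v pt (F x) = (k / q) *\<^sub>R (?M *v dirn i (g *v pt x))" .
  have s1: "s$1$1 * F x + s$1$2 = (s *v pt (F x))$1" and s2: "s$2$1 * F x + s$2$2 = (s *v pt (F x))$2"
    by (simp_all add: matrix_vector_mult_2)
  have g1: "g$1$1 * x + g$1$2 = (g *v pt x)$1" and g2: "g$2$1 * x + g$2$2 = (g *v pt x)$2"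
    by (simp_all add: matrix_vector_mult_2)
  have main: "s$2$1 * F x + s$2$2 \<noteq> 0 \<and> F (mob g x) = mob s (F x)" if nz: "g$2$1 * x + g$2$2 \<noteq> 0"
  proof -
    have "g *v pt x = (g$2$1 * x + g$2$2) *\<^sub>R pt (mob g x)"
      using nz unfolding vec_eq_iff forall_2 by (simp add: matrix_vector_mult_2 mob_def)
    then have "dirn i (g *v pt x) = dirn i (pt (mob g x))" using dirn_scale[OF nz] by simp
    moreover obtain q' where q': "q' \<noteq> 0" "?M *v dirn i (pt (mob g x)) = q' *\<^sub>R pt (F (mob g x))"
      using chart_mat_dirn[OF ch] by blast
    ultimately have e: "s *v pt (F x) = (k / q * q') *\<^sub>R pt (F (mob g x))" unfolding sF by simp
    have nz': "k / q * q' \<noteq> 0" using q k q' by simp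
    show ?thesis unfolding mob_def[of s] s1 s2 e using nz' by simp
  qed
  have "s$2$1 * F x + s$2$2 = 0" if z: "g$2$1 * x + g$2$2 = 0"
  proof -
    have e: "g *v pt x = (g$1$1 * x + g$1$2) *\<^sub>R pinf"
      using z unfolding vec_eq_iff forall_2 by (simp add: matrix_vector_mult_2)
    have "g *v pt x \<noteq> 0" using det_G[OF g] by (intro det_nz_mult_nz) auto
    then have nz: "g$1$1 * x + g$1$2 \<noteq> 0" using e by auto
    obtain q' where "?M *v dirn i pinf = q' *\<^sub>R pinf" using chart_mat_dirn[OF ch] by blast
    then show ?thesis unfolding s2 sF e dirn_scale[OF nz] by simp
  qed
  then show "g$2$1 * x + g$2$2 \<noteq> 0 \<longleftrightarrow> s$2$1 * F x + s$2$2 \<noteq> 0" using main by blast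
  show "g$2$1 * x + g$2$2 \<noteq> 0 \<Longrightarrow> F (mob g x) = mob s (F x)" using main by blast
qed

text \<open>Surjectivity of the chart function accounts for all lines but one, and the point at
  infinity for that one.\<close>

lemma dirn_surj:
  assumes v: "v \<noteq> 0"
  shows "\<exists>u c. u \<noteq> 0 \<and> v = c *\<^sub>R dirn i u"
proof -
  obtain a b \<sigma> F where ch: "is_chart i a b \<sigma> F" using ex_chart by blast
  let ?M = "chart_mat a b \<sigma>" and ?N = "chart_inv a b \<sigma>"
  have NM: "?N *v (?M *v y) = y" for y
    unfolding matrix_vector_mul_assoc chart_inverse(2)[OF ch] by simp
  define m where "m = ?M *v v"
  have "\<exists>u c. u \<noteq> 0 \<and> m = c *\<^sub>R (?M *v dirn i u)"
  proof (cases "m$2 = 0")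
    case True
    obtain q where q: "q \<noteq> 0" "?M *v dirn i pinf = q *\<^sub>R pinf" using chart_mat_dirn[OF ch] by blast
    have "m = (m$1 / q) *\<^sub>R (?M *v dirn i pinf)" unfolding q using True q(1) by (simp add: vec_eq_iff forall_2)
    then show ?thesis using pt_nz(2) by blast
  next
    case False
    obtain x where x: "F x = m$1 / m$2" using ch unfolding is_chart_def by (metis surjD)
    obtain q where q: "q \<noteq> 0" "?M *v dirn i (pt x) = q *\<^sub>R pt (F x)" using chart_mat_dirn[OF ch] by blast
    have "m = (m$2 / q) *\<^sub>R (?M *v dirn i (pt x))" unfolding q x using False q(1) by (simp add: vec_eq_iff forall_2)
    then show ?thesis using pt_nz(1) by blast
  qed
  then obtain u c where u: "u \<noteq> 0" "m = c *\<^sub>R (?M *v dirn i u)" by blast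
  have "v = ?N *v m" by (simp add: m_def NM)
  also have "\<dots> = c *\<^sub>R dirn i u" unfolding u(2) matrix_vector_mult_scaleR NM ..
  finally show ?thesis using u(1) by blast
qed

text \<open>The squared determinant is a polynomial in the products of coordinates, hence continuous
  in \<open>k\<close>; transversality makes it positive on the compact set.\<close>

lemma dirn_det_lower_bound:
  assumes K: "compact K" "\<And>k. k \<in> K \<Longrightarrow> det k = 1" and pq: "det2 p q \<noteq> 0"
  shows "\<exists>\<delta>>0. \<forall>k\<in>K. \<delta> \<le> \<bar>det2 (dirn i (k *v p)) (dirn i (k *v q))\<bar>"
proof (cases "K = {}")
  case True
  then show ?thesis by (intro exI[of _ 1]) auto
next
  case False
  have pq0: "p \<noteq> 0" "q \<noteq> 0" using pq by (auto simp: det2_def)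
  define P where "P j k r u = dirn i (u *v r)$j * dirn i (u *v r)$k" for j k and r :: "real^2" and u :: "real^2^2"
  have cP: "continuous_on K (P j k r)" if "r \<noteq> 0" for j k r
    unfolding P_def
  proof (rule continuous_on_compose2[OF continuous_dirn_products[of i j k]])
    show "continuous_on K (\<lambda>u. u *v r)" by (intro continuous_intros)
    show "(\<lambda>u. u *v r) ` K \<subseteq> - {0}" using K(2) that det_nz_mult_nz by fastforce
  qed
  define D where "D k = (det2 (dirn i (k *v p)) (dirn i (k *v q)))\<^sup>2" for k
  have "D k = P 1 1 p k * P 2 2 q k - 2 * (P 1 2 p k * P 1 2 q k) + P 2 2 p k * P 1 1 q k" for k
    by (simp add: D_def P_def det2_def power2_eq_square algebra_simps)
  then have D_alt: "D = (\<lambda>k. P 1 1 p k * P 2 2 q k - 2 * (P 1 2 p k * P 1 2 q k) + P 2 2 p k * P 1 1 q k)" by (rule ext)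
  have cD: "continuous_on K D" unfolding D_alt
    by (intro continuous_on_add continuous_on_diff continuous_on_mult continuous_on_const cP pq0)
  obtain k0 where k0: "k0 \<in> K" "\<And>k. k \<in> K \<Longrightarrow> D k0 \<le> D k" using continuous_attains_inf[OF K(1) False cD] by blast
  have "det2 (k0 *v p) (k0 *v q) \<noteq> 0" using pq K(2)[OF k0(1)] by (simp add: det2_matrix)
  then have "det2 (dirn i (k0 *v p)) (dirn i (k0 *v q)) \<noteq> 0" by (rule dirn_transverse)
  then have pos: "D k0 > 0" by (simp add: D_def)
  have "sqrt (D k0) \<le> \<bar>det2 (dirn i (k *v p)) (dirn i (k *v q))\<bar>" if "k \<in> K" for k
  proof -
    have "sqrt (D k0) \<le> sqrt (D k)" using k0(2)[OF that] by simp
    then show ?thesis by (simp add: D_def)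
  qed
  then show ?thesis using pos by (intro exI[of _ "sqrt (D k0)"]) simp
qed

text \<open>The lines spanned by the columns of \<open>h\<close> and by their sum are the directions
  over three lines \<open>u1\<close>, \<open>u2\<close>, \<open>u3\<close>. A matrix of determinant
  1 bringing a standard triple to these is a group element \<open>g\<close> times some
  \<open>k\<close> in \<open>K\<close>. Then \<open>c\<close>, which is \<open>h\<close> with
  \<open>rs i g\<close> removed, sends the standard lines to directions over the lines of a triple
  moved by \<open>k\<close>. These stay uniformly apart, so \<open>c\<close> is bounded.\<close>

lemma rs_cocompact:
  "\<exists>C. \<forall>h. det h = 1 \<longrightarrow> (\<exists>g\<in>G. \<exists>c. det c = 1 \<and> (\<forall>j k. \<bar>c$j$k\<bar> \<le> C) \<and> h = rs i g ** c)"
proof -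
  obtain K where K: "compact K" "\<forall>k\<in>K. det k = 1" "\<forall>h::real^2^2. det h = 1 \<longrightarrow> (\<exists>g\<in>G. \<exists>k\<in>K. h = g ** k)"
    using cocompact_set by blast
  have dK: "\<And>k. k \<in> K \<Longrightarrow> det k = 1" using K(2) by blast
  let ?e2 = "vector [0, 1] :: real^2"
  let ?r = "\<lambda>\<sigma>. vector [1, \<sigma>] :: real^2"
  have lb: "\<exists>\<delta>>0. \<forall>k\<in>K. \<delta> \<le> \<bar>det2 (dirn i (k *v p)) (dirn i (k *v q))\<bar>" if "det2 p q \<noteq> 0" for p q
    by (rule dirn_det_lower_bound[OF K(1) dK that])
  obtain d1 where d1: "d1 > 0" "\<And>k. k \<in> K \<Longrightarrow> d1 \<le> \<bar>det2 (dirn i (k *v pinf)) (dirn i (k *v ?e2))\<bar>"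
    using lb[of pinf ?e2] by (auto simp: det2_def)
  obtain d2 where d2: "d2 > 0" "\<And>k. k \<in> K \<Longrightarrow> d2 \<le> \<bar>det2 (dirn i (k *v pinf)) (dirn i (k *v ?r 1))\<bar>"
    using lb[of pinf "?r 1"] by (auto simp: det2_def)
  obtain d3 where d3: "d3 > 0" "\<And>k. k \<in> K \<Longrightarrow> d3 \<le> \<bar>det2 (dirn i (k *v pinf)) (dirn i (k *v ?r (-1)))\<bar>"
    using lb[of pinf "?r (-1)"] by (auto simp: det2_def)
  obtain d4 where d4: "d4 > 0" "\<And>k. k \<in> K \<Longrightarrow> d4 \<le> \<bar>det2 (dirn i (k *v ?e2)) (dirn i (k *v ?r 1))\<bar>"
    using lb[of ?e2 "?r 1"] by (auto simp: det2_def)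
  obtain d5 where d5: "d5 > 0" "\<And>k. k \<in> K \<Longrightarrow> d5 \<le> \<bar>det2 (dirn i (k *v ?e2)) (dirn i (k *v ?r (-1)))\<bar>"
    using lb[of ?e2 "?r (-1)"] by (auto simp: det2_def)
  \<comment> \<open>Both signs of the third vector enter, because either may come out of
    \<open>sl2_with_columns\<close>.\<close>
  define \<delta> where "\<delta> = min d1 (min (min d2 d3) (min d4 d5))"
  have \<delta>: "\<delta> > 0" "\<delta> \<le> d1" "\<delta> \<le> d2" "\<delta> \<le> d3" "\<delta> \<le> d4" "\<delta> \<le> d5" using d1 d2 d3 d4 d5 by (auto simp: \<delta>_def)
  have "\<exists>g\<in>G. \<exists>c. det c = 1 \<and> (\<forall>j k. \<bar>c$j$k\<bar> \<le> 2 / \<delta>) \<and> h = rs i g ** c" if h: "det h = 1" for h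
  proof -
    have hne: "h *v p \<noteq> 0" if "p \<noteq> 0" for p using h that by (intro det_nz_mult_nz) auto
    have ne: "?e2 \<noteq> 0" "?r 1 \<noteq> 0" "\<And>\<sigma>. ?r \<sigma> \<noteq> 0" by (simp_all add: vec_eq_iff forall_2)
    obtain u1 c1 where u1: "u1 \<noteq> 0" "h *v pinf = c1 *\<^sub>R dirn i u1" using dirn_surj[OF hne[OF pt_nz(2)]] by blast
    obtain u2 c2 where u2: "u2 \<noteq> 0" "h *v ?e2 = c2 *\<^sub>R dirn i u2" using dirn_surj[OF hne[OF ne(1)]] by blast
    obtain u3 c3 where u3: "u3 \<noteq> 0" "h *v ?r 1 = c3 *\<^sub>R dirn i u3" using dirn_surj[OF hne[OF ne(2)]] by blast
    have indep: "det2 u v \<noteq> 0" if asm: "u \<noteq> 0" "v \<noteq> 0" "h *v p = c *\<^sub>R dirn i u" "h *v q = d *\<^sub>R dirn i v" "det2 p q \<noteq> 0" for u v p q c d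
    proof
      assume "det2 u v = 0"
      then obtain t where t: "v = t *\<^sub>R u" using det2_eq_0_iff[OF asm(1)] by blast
      then have "t \<noteq> 0" using asm(2) by auto
      then have "dirn i v = dirn i u" unfolding t by (rule dirn_scale)
      then have "det2 (h *v p) (h *v q) = 0" unfolding asm(3,4) by (simp add: det2_def)
      then show False using asm(5) h by (simp add: det2_matrix)
    qed
    have "det2 u1 u2 \<noteq> 0" by (rule indep[OF u1(1) u2(1) u1(2) u2(2)]) (simp add: det2_def)
    moreover have "det2 u2 u3 \<noteq> 0" by (rule indep[OF u2(1) u3(1) u2(2) u3(2)]) (simp add: det2_def)
    moreover have "det2 u1 u3 \<noteq> 0" by (rule indep[OF u1(1) u3(1) u1(2) u3(2)]) (simp add: det2_def)
    ultimately obtain A \<sigma> t1 t2 t3 where A: "det A = 1" "\<sigma> = 1 \<or> \<sigma> = (-1::real)" "t1 \<noteq> 0" "t2 \<noteq> 0" "t3 \<noteq> 0"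
      "A *v pinf = t1 *\<^sub>R u1" "A *v ?e2 = t2 *\<^sub>R u2" "A *v ?r \<sigma> = t3 *\<^sub>R u3"
      using sl2_with_columns[of u1 u2 u3] by blast
    obtain g k where gk: "g \<in> G" "k \<in> K" "A = g ** k" using K(3) A(1) by blast
    define g' where "g' = matrix_inv g"
    have g': "g' \<in> G" using inv_G gk(1) by (simp add: g'_def)
    have g'A: "g' *v (A *v p) = k *v p" for p
      unfolding gk(3) g'_def by (simp add: matrix_vector_mul_assoc matrix_mul_assoc inv_G_mult[OF gk(1)])
    define c where "c = rs i g' ** h"
    have rr: "rs i g ** rs i g' = mat 1"
      using mult_rs[OF gk(1) g', of i] rs_one[of i] inv_G_mult(2)[OF gk(1)] by (simp add: g'_def)
    have hc: "h = rs i g ** c" unfolding c_def by (simp add: matrix_mul_assoc rr)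
    have dc: "det c = 1" unfolding c_def by (simp add: det_mul det_rs[OF g'] h)
    have cdir: "\<exists>\<alpha>. c *v p = \<alpha> *\<^sub>R dirn i (k *v q)"
      if asm: "u \<noteq> 0" "h *v p = d *\<^sub>R dirn i u" "A *v q = t *\<^sub>R u" "t \<noteq> 0" for p q d t u
    proof -
      obtain m where m: "rs i g' *v dirn i u = m *\<^sub>R dirn i (g' *v u)" using dirn_equivariant[OF g' asm(1)] by blast
      have "k *v q = t *\<^sub>R (g' *v u)" using g'A[of q] unfolding asm(3) by (simp add: matrix_vector_mult_scaleR)
      then have "dirn i (k *v q) = dirn i (g' *v u)" by (simp only: dirn_scale[OF asm(4)])
      moreover have "c *v p = rs i g' *v (h *v p)" by (simp add: c_def matrix_vector_mul_assoc)
      ultimately have "c *v p = (d * m) *\<^sub>R dirn i (k *v q)" unfolding asm(2) by (simp add: matrix_vector_mult_scaleR m)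
      then show ?thesis by blast
    qed
    define w1 where "w1 = dirn i (k *v pinf)"
    define w2 where "w2 = dirn i (k *v ?e2)"
    define w3 where "w3 = dirn i (k *v ?r \<sigma>)"
    obtain \<alpha> where \<alpha>: "c *v pinf = \<alpha> *\<^sub>R w1" unfolding w1_def using cdir[OF u1 A(6,3)] by blast
    obtain \<beta> where \<beta>: "c *v ?e2 = \<beta> *\<^sub>R w2" unfolding w2_def using cdir[OF u2 A(7,4)] by blast
    obtain \<gamma> where \<gamma>: "c *v ?r 1 = \<gamma> *\<^sub>R w3" unfolding w3_def using cdir[OF u3 A(8,5)] by blast
    have kne: "k *v p \<noteq> 0" if "p \<noteq> 0" for p using dK[OF gk(2)] that by (intro det_nz_mult_nz) auto
    have nw: "norm w1 = 1" "norm w2 = 1" "norm w3 = 1"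
      unfolding w1_def w2_def w3_def using norm_dirn[OF kne] ne by simp_all
    have "det2 (c *v pinf) (c *v ?e2) = 1" unfolding det2_matrix dc by (simp add: det2_def)
    then have ab: "\<alpha> * \<beta> * det2 w1 w2 = 1" unfolding \<alpha> \<beta> det2_linear(1,2) by (simp add: mult_ac)
    have "?r 1 = pinf + ?e2" by (simp add: vec_eq_iff forall_2)
    then have sum: "\<gamma> *\<^sub>R w3 = \<alpha> *\<^sub>R w1 + \<beta> *\<^sub>R w2"
      using \<alpha> \<beta> \<gamma> by (metis matrix_vector_right_distrib)
    have "det2 (\<alpha> *\<^sub>R w1 + \<beta> *\<^sub>R w2) w3 = 0" unfolding sum[symmetric] by (simp add: det2_def)
    then have lin: "\<alpha> * det2 w1 w3 + \<beta> * det2 w2 w3 = 0" by (simp only: det2_linear(1,3))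
    have l12: "\<delta> \<le> \<bar>det2 w1 w2\<bar>" unfolding w1_def w2_def using d1(2)[OF gk(2)] \<delta> by linarith
    have l13: "\<delta> \<le> \<bar>det2 w1 w3\<bar>" unfolding w1_def w3_def using d2(2)[OF gk(2)] d3(2)[OF gk(2)] \<delta> A(2) by auto
    have l23: "\<delta> \<le> \<bar>det2 w2 w3\<bar>" unfolding w2_def w3_def using d4(2)[OF gk(2)] d5(2)[OF gk(2)] \<delta> A(2) by auto
    have up: "\<bar>det2 w1 w3\<bar> \<le> 2" "\<bar>det2 w2 w3\<bar> \<le> 2" using abs_det2_le[of w1 w3] abs_det2_le[of w2 w3] nw by simp_all
    have b\<alpha>: "\<bar>\<alpha>\<bar> \<le> 2 / \<delta>" by (rule abs_scalar_bound[OF ab lin l12 l13 up(2) \<delta>(1)])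
    have "\<beta> * \<alpha> * det2 w1 w2 = 1" "\<beta> * det2 w2 w3 + \<alpha> * det2 w1 w3 = 0" using ab lin by (simp_all add: mult_ac add.commute)
    then have b\<beta>: "\<bar>\<beta>\<bar> \<le> 2 / \<delta>" by (rule abs_scalar_bound[OF _ _ l12 l23 up(1) \<delta>(1)])
    have col: "\<bar>(\<kappa> *\<^sub>R w)$j\<bar> \<le> 2 / \<delta>" if "norm w = 1" "\<bar>\<kappa>\<bar> \<le> 2 / \<delta>" for \<kappa> j and w :: "real^2"
    proof -
      have "\<bar>(\<kappa> *\<^sub>R w)$j\<bar> = \<bar>\<kappa>\<bar> * \<bar>w$j\<bar>" by (simp add: abs_mult)
      also have "\<dots> \<le> \<bar>\<kappa>\<bar> * 1" using component_le_norm_cart[of w j] that(1) by (intro mult_left_mono) auto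
      finally show ?thesis using that(2) by simp
    qed
    have "\<bar>c$j$k\<bar> \<le> 2 / \<delta>" for j k
    proof -
      have "c$j$1 = (c *v pinf)$j" "c$j$2 = (c *v ?e2)$j" by (simp_all add: matrix_vector_mult_2)
      then have "\<bar>c$j$1\<bar> \<le> 2 / \<delta>" "\<bar>c$j$2\<bar> \<le> 2 / \<delta>" unfolding \<alpha> \<beta> using col[OF nw(1) b\<alpha>] col[OF nw(2) b\<beta>] by simp_all
      then show ?thesis using exhaust_2[of k] by auto
    qed
    then show ?thesis using gk(1) dc hc by blast
  qed
  then show ?thesis by blast
qed

lemma chart_coeff_le:
  assumes ch: "is_chart i a b \<sigma> F"
  shows "\<bar>a\<bar> \<le> 1" "\<bar>b\<bar> \<le> 1" "\<bar>\<sigma>\<bar> = 1"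
proof -
  have ab: "a\<^sup>2 + b\<^sup>2 = 1" using ch by (simp add: is_chart_def)
  have "a\<^sup>2 \<le> 1" "b\<^sup>2 \<le> 1" using ab zero_le_power2[of a] zero_le_power2[of b] by linarith+
  then show "\<bar>a\<bar> \<le> 1" "\<bar>b\<bar> \<le> 1" by (simp_all add: abs_square_le_1)
  show "\<bar>\<sigma>\<bar> = 1" using ch by (auto simp: is_chart_def)
qed

lemma chart_rep_cocompact:
  assumes ch: "is_chart i a b \<sigma> F"
  shows "\<exists>C. \<forall>h. det h = 1 \<longrightarrow> (\<exists>g\<in>G. \<exists>c. det c = 1 \<and> (\<forall>j k. \<bar>c$j$k\<bar> \<le> C) \<and> h = chart_rep i a b \<sigma> g ** c)"
proof -
  let ?M = "chart_mat a b \<sigma>" and ?N = "chart_inv a b \<sigma>"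
  obtain C where C: "\<And>h. det h = 1 \<Longrightarrow> \<exists>g\<in>G. \<exists>c. det c = 1 \<and> (\<forall>j k. \<bar>c$j$k\<bar> \<le> C) \<and> h = rs i g ** c"
    using rs_cocompact by blast
  have C0: "C \<ge> 0"
  proof -
    have "det (mat 1 :: real^2^2) = 1" by simp
    from C[OF this] obtain c :: "real^2^2" where "\<bar>c$1$1\<bar> \<le> C" by blast
    then show ?thesis by (rule order_trans[OF abs_ge_zero])
  qed
  have entries: "\<bar>?M$j$k\<bar> \<le> 1" "\<bar>?N$j$k\<bar> \<le> 1" for j k
    using exhaust_2[of j] exhaust_2[of k] chart_coeff_le[OF ch] by (auto simp: chart_mat_def chart_inv_def abs_mult)
  \<comment> \<open>Chart matrices have entries of size at most 1, and each of the two products at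
    most doubles the bound.\<close>
  have "\<exists>g\<in>G. \<exists>c. det c = 1 \<and> (\<forall>j k. \<bar>c$j$k\<bar> \<le> 4 * C) \<and> h = chart_rep i a b \<sigma> g ** c" if h: "det h = 1" for h
  proof -
    have "det (?N ** h ** ?M) = 1" using h chart_inverse[OF ch] by (simp add: det_mul)
    from C[OF this] obtain g c where g: "g \<in> G" and c: "det c = 1" "\<forall>j k. \<bar>c$j$k\<bar> \<le> C" and e: "?N ** h ** ?M = rs i g ** c" by blast
    have "h = (?M ** ?N) ** h ** (?M ** ?N)" unfolding chart_inverse(1)[OF ch] by simp
    also have "\<dots> = ?M ** (?N ** h ** ?M) ** ?N" by (simp only: matrix_mul_assoc)
    also have "\<dots> = ?M ** rs i g ** (?N ** ?M) ** c ** ?N" unfolding e chart_inverse(2)[OF ch] by (simp add: matrix_mul_assoc)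
    also have "\<dots> = chart_rep i a b \<sigma> g ** (?M ** c ** ?N)" by (simp only: chart_rep_def matrix_mul_assoc)
    finally have "h = chart_rep i a b \<sigma> g ** (?M ** c ** ?N)" .
    moreover have "det (?M ** c ** ?N) = 1" using c(1) chart_inverse[OF ch] by (simp add: det_mul)
    moreover have "\<bar>(?M ** c ** ?N)$j$k\<bar> \<le> 4 * C" for j k
    proof -
      have "\<bar>(?M ** c)$j$k\<bar> \<le> 2 * 1 * C" for j k by (rule abs_mult_entry_le) (use entries c(2) C0 in auto)
      then have "\<bar>(?M ** c ** ?N)$j$k\<bar> \<le> 2 * (2 * 1 * C) * 1" by (rule abs_mult_entry_le) (use entries C0 in auto)
      then show ?thesis by simp
    qed
    ultimately show ?thesis using g by blast
  qed
  then show ?thesis by blast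
qed

end

section \<open>Arc length in the charts\<close>

lemma countable_discrete_set:
  fixes S :: "'a::{metric_space, second_countable_topology} set"
  assumes "discrete_set S"
  shows "countable S"
proof -
  obtain e where e: "\<And>x. x \<in> S \<Longrightarrow> e x > 0" "\<And>x y. x \<in> S \<Longrightarrow> y \<in> S \<Longrightarrow> y \<noteq> x \<Longrightarrow> e x \<le> dist y x"
    using assms unfolding discrete_set_def by metis
  define B where "B x = ball x (e x / 2)" for x
  have dj: "B x \<inter> B y = {}" if "x \<in> S" "y \<in> S" "x \<noteq> y" for x y
  proof (rule ccontr)
    assume "B x \<inter> B y \<noteq> {}"
    then obtain z where "dist x z < e x / 2" "dist y z < e y / 2" by (auto simp: B_def)
    moreover have "e x \<le> dist x y" "e y \<le> dist x y" using e(2) that by (metis dist_commute)+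
    moreover have "dist x y \<le> dist x z + dist y z" by (metis dist_triangle2)
    ultimately show False by linarith
  qed
  have cen: "x \<in> B x" if "x \<in> S" for x using e(1)[OF that] by (simp add: B_def)
  have "inj_on B S" using dj cen by (intro inj_onI) (metis disjoint_iff)
  moreover have "countable (B ` S)"
  proof (rule countable_disjoint_open_subsets)
    show "pairwise disjnt (B ` S)" using dj by (auto simp: pairwise_def disjnt_def) 
  qed (auto simp: B_def)
  ultimately show ?thesis by (rule countable_image_inj_on[rotated])
qed

lemma inverse_one_plus_square_lipschitz: "\<bar>1 / (1 + x\<^sup>2) - 1 / (1 + y\<^sup>2)\<bar> \<le> \<bar>x - y\<bar>"
  and ratio_one_plus_square_lipschitz: "\<bar>x / (1 + x\<^sup>2) - y / (1 + y\<^sup>2)\<bar> \<le> \<bar>x - y\<bar>" for x y :: real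
proof -
  have p: "1 + x\<^sup>2 > 0" "1 + y\<^sup>2 > 0" by (simp_all add: add_pos_nonneg)
  define D where "D = (1 + x\<^sup>2) * (1 + y\<^sup>2)"
  have D: "D > 0" using p by (simp add: D_def)
  have D1: "D = 1 + x\<^sup>2 + y\<^sup>2 + x\<^sup>2 * y\<^sup>2" by (simp add: D_def algebra_simps)
  have h: "\<bar>x\<bar> \<le> (1 + x\<^sup>2) / 2" "\<bar>y\<bar> \<le> (1 + y\<^sup>2) / 2" "\<bar>x * y\<bar> \<le> (x\<^sup>2 + y\<^sup>2) / 2"
    using zero_le_power2[of "\<bar>x\<bar> - 1"] zero_le_power2[of "\<bar>y\<bar> - 1"] zero_le_power2[of "\<bar>x\<bar> - \<bar>y\<bar>"]
    by (simp_all add: power2_diff abs_mult)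
  have nn: "0 \<le> x\<^sup>2" "0 \<le> y\<^sup>2" "0 \<le> x\<^sup>2 * y\<^sup>2" by simp_all
  have "\<bar>x + y\<bar> \<le> (1 + x\<^sup>2) / 2 + (1 + y\<^sup>2) / 2"
    by (rule order_trans[OF abs_triangle_ineq add_mono[OF h(1,2)]])
  also have "\<dots> \<le> D" using nn unfolding D1 by (simp add: field_simps)
  finally have b1: "\<bar>x + y\<bar> \<le> D" .
  have "\<bar>1 - x * y\<bar> \<le> \<bar>1\<bar> + \<bar>x * y\<bar>" by (rule abs_triangle_ineq4)
  also have "\<dots> \<le> 1 + (x\<^sup>2 + y\<^sup>2) / 2" using h(3) by simp
  also have "\<dots> \<le> D" using nn unfolding D1 by (simp add: field_simps)
  finally have b2: "\<bar>1 - x * y\<bar> \<le> D" .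
  have "1 / (1 + x\<^sup>2) - 1 / (1 + y\<^sup>2) = ((1 + y\<^sup>2) - (1 + x\<^sup>2)) / D"
    using p by (simp add: diff_frac_eq D_def)
  also have "(1 + y\<^sup>2) - (1 + x\<^sup>2) = (y - x) * (x + y)" by (simp add: power2_eq_square algebra_simps)
  finally have e1: "\<bar>1 / (1 + x\<^sup>2) - 1 / (1 + y\<^sup>2)\<bar> = \<bar>x - y\<bar> * (\<bar>x + y\<bar> / D)"
    using D by (simp add: abs_mult abs_minus_commute)
  have "x / (1 + x\<^sup>2) - y / (1 + y\<^sup>2) = (x * (1 + y\<^sup>2) - y * (1 + x\<^sup>2)) / D"
    using p by (simp add: diff_frac_eq D_def)
  also have "x * (1 + y\<^sup>2) - y * (1 + x\<^sup>2) = (x - y) * (1 - x * y)" by (simp add: power2_eq_square algebra_simps)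
  finally have e2: "\<bar>x / (1 + x\<^sup>2) - y / (1 + y\<^sup>2)\<bar> = \<bar>x - y\<bar> * (\<bar>1 - x * y\<bar> / D)"
    using D by (simp add: abs_mult)
  have 1: "\<bar>x + y\<bar> / D \<le> 1" and 2: "\<bar>1 - x * y\<bar> / D \<le> 1" using b1 b2 D by simp_all
  show "\<bar>1 / (1 + x\<^sup>2) - 1 / (1 + y\<^sup>2)\<bar> \<le> \<bar>x - y\<bar>" "\<bar>x / (1 + x\<^sup>2) - y / (1 + y\<^sup>2)\<bar> \<le> \<bar>x - y\<bar>"
    unfolding e1 e2 by (rule mult_left_le[OF 1 abs_ge_zero], rule mult_left_le[OF 2 abs_ge_zero])
qed

text \<open>These quotients are the entries of the projection onto the line with chart coordinate
  \<open>x\<close>. Polynomial division leaves a constant and multiples of two 1-Lipschitz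
  functions.\<close>

lemma quadratic_quotient_lipschitz:
  fixes x y :: real
  assumes "\<bar>\<alpha>\<bar> \<le> 1" "\<bar>\<beta>\<bar> \<le> 1" "\<bar>\<gamma>\<bar> \<le> 1" "\<bar>\<delta>\<bar> \<le> 1"
  shows "\<bar>(\<alpha> * x + \<beta>) * (\<gamma> * x + \<delta>) / (1 + x\<^sup>2) - (\<alpha> * y + \<beta>) * (\<gamma> * y + \<delta>) / (1 + y\<^sup>2)\<bar> \<le> 4 * \<bar>x - y\<bar>"
proof -
  have e: "(\<alpha> * z + \<beta>) * (\<gamma> * z + \<delta>) / (1 + z\<^sup>2) =
      \<alpha> * \<gamma> + (\<beta> * \<delta> - \<alpha> * \<gamma>) * (1 / (1 + z\<^sup>2)) + (\<alpha> * \<delta> + \<beta> * \<gamma>) * (z / (1 + z\<^sup>2))" for z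
  proof -
    have "1 + z\<^sup>2 \<noteq> 0" using zero_le_power2[of z] by linarith
    moreover have "(\<alpha> * z + \<beta>) * (\<gamma> * z + \<delta>) = \<alpha> * \<gamma> * (1 + z\<^sup>2) + (\<beta> * \<delta> - \<alpha> * \<gamma>) + (\<alpha> * \<delta> + \<beta> * \<gamma>) * z"
      by (simp add: power2_eq_square algebra_simps)
    ultimately show ?thesis by (simp add: add_divide_distrib)
  qed
  have m: "\<bar>u * v\<bar> \<le> 1" if "\<bar>u\<bar> \<le> 1" "\<bar>v\<bar> \<le> 1" for u v :: real
    using mult_mono[OF that] by (simp add: abs_mult)
  have c: "\<bar>\<beta> * \<delta> - \<alpha> * \<gamma>\<bar> \<le> 2" "\<bar>\<alpha> * \<delta> + \<beta> * \<gamma>\<bar> \<le> 2"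
    using m[OF assms(2,4)] m[OF assms(1,3)] m[OF assms(1,4)] m[OF assms(2,3)] by linarith+
  let ?P = "(\<beta> * \<delta> - \<alpha> * \<gamma>) * (1 / (1 + x\<^sup>2) - 1 / (1 + y\<^sup>2))"
  let ?Q = "(\<alpha> * \<delta> + \<beta> * \<gamma>) * (x / (1 + x\<^sup>2) - y / (1 + y\<^sup>2))"
  have P: "\<bar>?P\<bar> \<le> 2 * \<bar>x - y\<bar>" unfolding abs_mult
    by (intro mult_mono c inverse_one_plus_square_lipschitz) auto
  have Q: "\<bar>?Q\<bar> \<le> 2 * \<bar>x - y\<bar>" unfolding abs_mult
    by (intro mult_mono c ratio_one_plus_square_lipschitz) auto
  have E: "(\<alpha> * x + \<beta>) * (\<gamma> * x + \<delta>) / (1 + x\<^sup>2) - (\<alpha> * y + \<beta>) * (\<gamma> * y + \<delta>) / (1 + y\<^sup>2) = ?P + ?Q"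
    unfolding e by (simp add: right_diff_distrib)
  show ?thesis unfolding E using order_trans[OF abs_triangle_ineq add_mono[OF P Q]] by simp
qed

lemma hausdorff1_zero_mono:
  fixes S T :: "'a::metric_space set"
  assumes "hausdorff1 T = 0" "S \<subseteq> T"
  shows "hausdorff1 S = 0"
proof (rule hausdorff1_zeroI)
  fix e :: real assume "e > 0"
  from hausdorff1_zeroD[OF assms(1) this] obtain U :: "nat \<Rightarrow> 'a set" where
    "T \<subseteq> (\<Union>i. U i)" "\<forall>i. bounded (U i)" "(\<Sum>i. ennreal (diameter (U i))) < ennreal e" by blast
  then show "\<exists>U :: nat \<Rightarrow> 'a set. S \<subseteq> (\<Union>i. U i) \<and> (\<forall>i. bounded (U i)) \<and> (\<Sum>i. ennreal (diameter (U i))) \<le> ennreal e"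
    using assms(2) by (intro exI[of _ U]) auto
qed

lemma norm_matrix_le_entries:
  fixes A :: "real^'m::finite^'k::finite"
  assumes "\<And>r s. \<bar>A$r$s\<bar> \<le> B"
  shows "norm A \<le> real CARD('k) * (real CARD('m) * B)"
proof -
  have "norm (A$r) \<le> real CARD('m) * B" for r
  proof -
    have "norm (A$r) \<le> (\<Sum>s\<in>UNIV. \<bar>A$r$s\<bar>)" by (rule norm_le_l1_cart)
    also have "\<dots> \<le> (\<Sum>s\<in>(UNIV::'m set). B)" by (intro sum_mono assms)
    finally show ?thesis by simp
  qed
  then have "(\<Sum>r\<in>UNIV. norm (A$r)) \<le> (\<Sum>r\<in>(UNIV::'k set). real CARD('m) * B)" by (intro sum_mono)
  moreover have "norm A \<le> (\<Sum>r\<in>UNIV. norm (A$r))"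
    unfolding norm_vec_def by (rule L2_set_le_sum) simp
  ultimately show ?thesis by simp
qed

lemma abs_entry_le_dist: "\<bar>A$r$s - B$r$s\<bar> \<le> dist A (B :: real^'m::finite^'k::finite)"
proof -
  have "\<bar>(A - B)$r$s\<bar> \<le> norm ((A - B)$r)" by (rule component_le_norm_cart)
  also have "\<dots> \<le> norm (A - B)" by (rule Finite_Cartesian_Product.norm_nth_le)
  finally show ?thesis by (simp add: dist_norm)
qed

lemma mob_differentiable_on:
  assumes "\<And>x. x \<in> S \<Longrightarrow> M$2$1 * x + M$2$2 \<noteq> 0"
  shows "mob M differentiable_on S"
proof -
  have "\<exists>D. (mob M has_field_derivative D) (at x within S)" if "x \<in> S" for x
    unfolding mob_def[abs_def] using assms[OF that] by (auto intro!: exI derivative_eq_intros)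
  then show ?thesis unfolding differentiable_on_def differentiable_def has_field_derivative_def by blast
qed

lemma matrix_inv_eqI:
  fixes A B :: "real^'k^'k"
  assumes "A ** B = mat 1" "B ** A = mat 1"
  shows "matrix_inv A = B"
proof -
  have "A ** matrix_inv A = mat 1 \<and> matrix_inv A ** A = mat 1"
    unfolding matrix_inv_def by (rule someI[of _ B]) (use assms in blast)
  then have "matrix_inv A = (B ** A) ** matrix_inv A" "A ** matrix_inv A = mat 1" using assms by simp_all
  then show ?thesis by (simp flip: matrix_mul_assoc)
qed

context limit_map
begin

definition Phi :: "real \<Rightarrow> real^('n + 'n)^('n + 'n)" where
  "Phi x = xi_proj (pt x)"

text \<open>The chart coordinate as a rational function of the projection matrix: the entries of the
  rotated rank-one block are products of numerator and denominator of the coordinate, and the ratio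
  of two of them is the coordinate itself.\<close>

definition chart_ratio :: "'n \<Rightarrow> real \<Rightarrow> real \<Rightarrow> real \<Rightarrow> real^('n + 'n)^('n + 'n) \<Rightarrow> real" where
  "chart_ratio i a b \<sigma> P =
    (- \<sigma> * a * b * P$(Inl i)$(Inl i) + \<sigma> * (a\<^sup>2 - b\<^sup>2) * P$(Inl i)$(Inr i) + \<sigma> * a * b * P$(Inr i)$(Inr i)) /
    (b\<^sup>2 * P$(Inl i)$(Inl i) - 2 * a * b * P$(Inl i)$(Inr i) + a\<^sup>2 * P$(Inr i)$(Inr i))"

lemma Phi_entry:
  "Phi x $ pick i j $ pick i' k = (if i = i' then dirn i (pt x) $ j * dirn i (pt x) $ k else 0)"
  unfolding Phi_def by (simp add: xi_proj_entry)

lemma dirn_pt_chart: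
  assumes ch: "is_chart i a b \<sigma> F"
  shows "\<exists>q. q\<^sup>2 * (1 + (F x)\<^sup>2) = 1 \<and> dirn i (pt x) = q *\<^sub>R vector [\<sigma> * a * F x - b, \<sigma> * b * F x + a] \<and>
    \<sigma> * a * dirn i (pt x) $ 1 + \<sigma> * b * dirn i (pt x) $ 2 = q * F x \<and>
    - b * dirn i (pt x) $ 1 + a * dirn i (pt x) $ 2 = q"
proof -
  obtain q where q: "q \<noteq> 0" "chart_mat a b \<sigma> *v dirn i (pt x) = q *\<^sub>R pt (F x)" using chart_mat_dirn[OF ch] by blast
  let ?w = "dirn i (pt x)"
  have "?w = (chart_inv a b \<sigma> ** chart_mat a b \<sigma>) *v ?w" unfolding chart_inverse(2)[OF ch] by simp
  also have "\<dots> = chart_inv a b \<sigma> *v (q *\<^sub>R pt (F x))" by (simp only: matrix_vector_mul_assoc[symmetric] q)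
  also have "\<dots> = q *\<^sub>R vector [\<sigma> * a * F x - b, \<sigma> * b * F x + a]"
    by (simp add: vec_eq_iff forall_2 matrix_vector_mult_2 chart_inv_def algebra_simps)
  finally have w: "?w = q *\<^sub>R vector [\<sigma> * a * F x - b, \<sigma> * b * F x + a]" .
  have ab: "a\<^sup>2 + b\<^sup>2 = 1" and s: "\<sigma>\<^sup>2 = 1" using ch chart_inverse(5)[OF ch] by (auto simp: is_chart_def power2_eq_square)
  have "1 = inner ?w ?w" using norm_dirn[OF pt_nz(1), of i x] by (simp add: norm_eq_1)
  also have "\<dots> = (?w$1)\<^sup>2 + (?w$2)\<^sup>2" by (simp add: inner_vec_def sum_2 power2_eq_square)
  also have "\<dots> = q\<^sup>2 * ((\<sigma> * a * F x - b)\<^sup>2 + (\<sigma> * b * F x + a)\<^sup>2)"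
  proof -
    have "?w$1 = q * (\<sigma> * a * F x - b)" "?w$2 = q * (\<sigma> * b * F x + a)" unfolding w by simp_all
    then show ?thesis by (simp only: power_mult_distrib) (simp only: distrib_left)
  qed
  also have "(\<sigma> * a * F x - b)\<^sup>2 + (\<sigma> * b * F x + a)\<^sup>2 = (a\<^sup>2 + b\<^sup>2) * (\<sigma>\<^sup>2 * (F x)\<^sup>2 + 1)"
    by (simp add: power2_eq_square algebra_simps)
  finally have "q\<^sup>2 * (1 + (F x)\<^sup>2) = 1" using ab s by (simp add: add.commute)
  moreover have "\<sigma> * a * ?w $ 1 + \<sigma> * b * ?w $ 2 = q * F x" "- b * ?w $ 1 + a * ?w $ 2 = q"
    using arg_cong[OF q(2), of "\<lambda>v. v$1"] arg_cong[OF q(2), of "\<lambda>v. v$2"]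
    by (simp_all add: matrix_vector_mult_2 chart_mat_def)
  ultimately show ?thesis using w by blast
qed

lemma chart_ratio_Phi:
  assumes ch: "is_chart i a b \<sigma> F"
  shows "b\<^sup>2 * Phi x$(Inl i)$(Inl i) - 2 * a * b * Phi x$(Inl i)$(Inr i) + a\<^sup>2 * Phi x$(Inr i)$(Inr i) = 1 / (1 + (F x)\<^sup>2)"
    and "chart_ratio i a b \<sigma> (Phi x) = F x"
proof -
  let ?w = "dirn i (pt x)"
  obtain q where q: "q\<^sup>2 * (1 + (F x)\<^sup>2) = 1" "\<sigma> * a * ?w $ 1 + \<sigma> * b * ?w $ 2 = q * F x"
    "- b * ?w $ 1 + a * ?w $ 2 = q" using dirn_pt_chart[OF ch, of x] by blast
  have P: "Phi x$(Inl i)$(Inl i) = ?w$1 * ?w$1" "Phi x$(Inl i)$(Inr i) = ?w$1 * ?w$2" "Phi x$(Inr i)$(Inr i) = ?w$2 * ?w$2"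
    using Phi_entry[of x i 1 i 1] Phi_entry[of x i 1 i 2] Phi_entry[of x i 2 i 2] by simp_all
  have den: "b\<^sup>2 * (?w$1 * ?w$1) - 2 * a * b * (?w$1 * ?w$2) + a\<^sup>2 * (?w$2 * ?w$2) = (- b * ?w $ 1 + a * ?w $ 2)\<^sup>2"
    by (simp add: power2_eq_square algebra_simps)
  have num: "- \<sigma> * a * b * (?w$1 * ?w$1) + \<sigma> * (a\<^sup>2 - b\<^sup>2) * (?w$1 * ?w$2) + \<sigma> * a * b * (?w$2 * ?w$2) =
     (\<sigma> * a * ?w $ 1 + \<sigma> * b * ?w $ 2) * (- b * ?w $ 1 + a * ?w $ 2)"
    by (simp add: power2_eq_square algebra_simps)
  have q0: "q \<noteq> 0" using q(1) by auto
  have "1 + (F x)\<^sup>2 \<noteq> 0" using q(1) by auto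
  then show "b\<^sup>2 * Phi x$(Inl i)$(Inl i) - 2 * a * b * Phi x$(Inl i)$(Inr i) + a\<^sup>2 * Phi x$(Inr i)$(Inr i) = 1 / (1 + (F x)\<^sup>2)"
    unfolding P den q(3) using nonzero_eq_divide_eq[THEN iffD2, OF _ q(1)] by simp
  show "chart_ratio i a b \<sigma> (Phi x) = F x"
    unfolding chart_ratio_def P den num q(2,3) using q0 by (simp add: power2_eq_square)
qed

lemma dirn_product_lipschitz:
  assumes ch: "is_chart i a b \<sigma> F"
  shows "\<bar>dirn i (pt x) $ j * dirn i (pt x) $ k - dirn i (pt y) $ j * dirn i (pt y) $ k\<bar> \<le> 4 * \<bar>F x - F y\<bar>"
proof -
  define \<alpha> where "\<alpha> j = (if j = 1 then \<sigma> * a else \<sigma> * b)" for j :: 2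
  define \<beta> where "\<beta> j = (if j = 1 then - b else a)" for j :: 2
  have bd: "\<bar>\<alpha> j\<bar> \<le> 1" "\<bar>\<beta> j\<bar> \<le> 1" for j using chart_coeff_le[OF ch] by (auto simp: \<alpha>_def \<beta>_def abs_mult)
  have e: "dirn i (pt z) $ j * dirn i (pt z) $ k = (\<alpha> j * F z + \<beta> j) * (\<alpha> k * F z + \<beta> k) / (1 + (F z)\<^sup>2)" for z
  proof -
    obtain q where q: "q\<^sup>2 * (1 + (F z)\<^sup>2) = 1" "dirn i (pt z) = q *\<^sub>R vector [\<sigma> * a * F z - b, \<sigma> * b * F z + a]"
      using dirn_pt_chart[OF ch, of z] by blast
    have w: "dirn i (pt z) $ j = q * (\<alpha> j * F z + \<beta> j)" for j
      unfolding q(2) using exhaust_2[of j] by (auto simp: \<alpha>_def \<beta>_def)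
    have nz: "1 + (F z)\<^sup>2 \<noteq> 0" using q(1) by auto
    have "q\<^sup>2 = 1 / (1 + (F z)\<^sup>2)" using nonzero_eq_divide_eq[THEN iffD2, OF nz q(1)] .
    moreover have "dirn i (pt z) $ j * dirn i (pt z) $ k = q\<^sup>2 * ((\<alpha> j * F z + \<beta> j) * (\<alpha> k * F z + \<beta> k))"
      unfolding w by (simp add: power2_eq_square)
    ultimately show ?thesis by simp
  qed
  show ?thesis unfolding e by (rule quadratic_quotient_lipschitz[OF bd(1) bd(2) bd(1) bd(2)])
qed

lemma Phi_lipschitz:
  assumes ch: "\<And>i. is_chart i (a i) (b i) (\<sigma> i) (F i)"
  shows "\<exists>K\<ge>0. \<forall>x y. dist (Phi x) (Phi y) \<le> K * (\<Sum>i\<in>UNIV. \<bar>F i x - F i y\<bar>)"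
proof -
  define m where "m = real CARD('n + 'n)"
  have "dist (Phi x) (Phi y) \<le> (m * (m * 4)) * (\<Sum>i\<in>UNIV. \<bar>F i x - F i y\<bar>)" for x y
  proof -
    let ?S = "\<Sum>i\<in>UNIV. \<bar>F i x - F i y\<bar>"
    have S0: "?S \<ge> 0" by (simp add: sum_nonneg)
    have "\<bar>(Phi x - Phi y) $ r $ s\<bar> \<le> 4 * ?S" for r s
    proof -
      have "\<exists>i j. r = pick i j" for r :: "'n + 'n"
        by (cases r) (metis pick_simps(1), metis pick_simps(2))
      then obtain i j i' k where rs: "r = pick i j" "s = pick i' k" by metis
      show ?thesis
      proof (cases "i = i'")
        case True
        have "\<bar>(Phi x - Phi y) $ r $ s\<bar> \<le> 4 * \<bar>F i x - F i y\<bar>"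
          unfolding rs using True dirn_product_lipschitz[OF ch, of i x j k y] by (simp add: Phi_entry)
        also have "\<dots> \<le> 4 * ?S" by (intro mult_left_mono member_le_sum) auto
        finally show ?thesis .
      next
        case False
        then show ?thesis unfolding rs using S0 by (simp add: Phi_entry)
      qed
    qed
    then have "norm (Phi x - Phi y) \<le> real CARD('n + 'n) * (real CARD('n + 'n) * (4 * ?S))" by (rule norm_matrix_le_entries)
    then show ?thesis by (simp only: dist_norm m_def mult.assoc)
  qed
  moreover have "m * (m * 4) \<ge> 0" by (simp add: m_def)
  ultimately show ?thesis by blast
qed

text \<open>The denominator of \<open>chart_ratio\<close> is \<open>1 / (1 + (F x)\<^sup>2)\<close>,
  which is bounded below only where \<open>F\<close> is bounded; near infinity the projections crowd
  together.\<close>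

lemma chart_locally_lipschitz:
  assumes ch: "is_chart i a b \<sigma> F" and M: "M \<ge> 0" and x: "\<bar>F x\<bar> \<le> M" and y: "\<bar>F y\<bar> \<le> M"
  shows "\<bar>F x - F y\<bar> \<le> (1 + M\<^sup>2) * (4 + 4 * M) * dist (Phi x) (Phi y)"
proof -
  define num where "num P = - \<sigma> * a * b * P$(Inl i)$(Inl i) + \<sigma> * (a\<^sup>2 - b\<^sup>2) * P$(Inl i)$(Inr i) + \<sigma> * a * b * P$(Inr i)$(Inr i)"
    for P :: "real^('n + 'n)^('n + 'n)"
  define den where "den P = b\<^sup>2 * P$(Inl i)$(Inl i) - 2 * a * b * P$(Inl i)$(Inr i) + a\<^sup>2 * P$(Inr i)$(Inr i)"
    for P :: "real^('n + 'n)^('n + 'n)"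
  have den: "den (Phi z) = 1 / (1 + (F z)\<^sup>2)" for z unfolding den_def by (rule chart_ratio_Phi(1)[OF ch])
  have pos: "1 + (F z)\<^sup>2 > 0" for z by (simp add: add_pos_nonneg)
  have num: "num (Phi z) = F z * den (Phi z)" for z
  proof -
    have "num (Phi z) / den (Phi z) = F z"
      using chart_ratio_Phi(2)[OF ch, of z] unfolding chart_ratio_def num_def den_def .
    moreover have "den (Phi z) \<noteq> 0" unfolding den using pos[of z] by simp
    ultimately show ?thesis by (simp add: nonzero_divide_eq_eq)
  qed
  let ?d = "dist (Phi x) (Phi y)"
  have c: "\<bar>a * b\<bar> \<le> 1" "\<bar>a\<^sup>2\<bar> \<le> 1" "\<bar>b\<^sup>2\<bar> \<le> 1" "\<bar>\<sigma> * (a * b)\<bar> \<le> 1" "\<bar>\<sigma> * (a\<^sup>2 - b\<^sup>2)\<bar> \<le> 1"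
  proof -
    note ab = chart_coeff_le[OF ch]
    show "\<bar>a * b\<bar> \<le> 1" using mult_mono[OF ab(1,2)] by (simp add: abs_mult)
    then show "\<bar>\<sigma> * (a * b)\<bar> \<le> 1" unfolding abs_mult[of \<sigma>] ab(3) by simp
    show a2: "\<bar>a\<^sup>2\<bar> \<le> 1" and b2: "\<bar>b\<^sup>2\<bar> \<le> 1" using ab by (simp_all add: abs_square_le_1)
    have "\<bar>a\<^sup>2 - b\<^sup>2\<bar> \<le> 1" using a2 b2 zero_le_power2[of a] zero_le_power2[of b] by linarith
    then show "\<bar>\<sigma> * (a\<^sup>2 - b\<^sup>2)\<bar> \<le> 1" unfolding abs_mult[of \<sigma>] ab(3) by simp
  qed
  have term_le: "\<bar>c * (Phi x$r$s - Phi y$r$s)\<bar> \<le> ?d" if "\<bar>c\<bar> \<le> 1" for c r s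
  proof -
    have "\<bar>c * (Phi x$r$s - Phi y$r$s)\<bar> = \<bar>c\<bar> * \<bar>Phi x$r$s - Phi y$r$s\<bar>" by (simp add: abs_mult)
    also have "\<dots> \<le> 1 * ?d" using that by (intro mult_mono abs_entry_le_dist) auto
    finally show ?thesis by simp
  qed
  have dn: "\<bar>num (Phi x) - num (Phi y)\<bar> \<le> 4 * ?d"
  proof -
    have "num (Phi x) - num (Phi y) = - (\<sigma> * (a * b) * (Phi x$(Inl i)$(Inl i) - Phi y$(Inl i)$(Inl i)))
      + \<sigma> * (a\<^sup>2 - b\<^sup>2) * (Phi x$(Inl i)$(Inr i) - Phi y$(Inl i)$(Inr i))
      + \<sigma> * (a * b) * (Phi x$(Inr i)$(Inr i) - Phi y$(Inr i)$(Inr i))"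
      by (simp add: num_def algebra_simps)
    then show ?thesis
      using term_le[OF c(4), of "Inl i" "Inl i"] term_le[OF c(5), of "Inl i" "Inr i"] term_le[OF c(4), of "Inr i" "Inr i"]
        zero_le_dist[of "Phi x" "Phi y"] by linarith
  qed
  have dd: "\<bar>den (Phi x) - den (Phi y)\<bar> \<le> 4 * ?d"
  proof -
    have "den (Phi x) - den (Phi y) = b\<^sup>2 * (Phi x$(Inl i)$(Inl i) - Phi y$(Inl i)$(Inl i))
      - 2 * (a * b * (Phi x$(Inl i)$(Inr i) - Phi y$(Inl i)$(Inr i)))
      + a\<^sup>2 * (Phi x$(Inr i)$(Inr i) - Phi y$(Inr i)$(Inr i))"
      by (simp add: den_def algebra_simps)
    then show ?thesis
      using term_le[OF c(3), of "Inl i" "Inl i"] term_le[OF c(1), of "Inl i" "Inr i"] term_le[OF c(2), of "Inr i" "Inr i"]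
      by linarith
  qed
  have d0: "den (Phi x) \<noteq> 0" unfolding den using pos[of x] by simp
  \<comment> \<open>Since the numerator is \<open>F\<close> times the denominator, only the
    denominator at \<open>x\<close> is divided by.\<close>
  have "F x - F y = ((num (Phi x) - num (Phi y)) - F y * (den (Phi x) - den (Phi y))) / den (Phi x)"
    unfolding num using d0 by (simp add: field_simps)
  also have "\<dots> = ((num (Phi x) - num (Phi y)) - F y * (den (Phi x) - den (Phi y))) * (1 + (F x)\<^sup>2)"
    unfolding den[of x] by simp
  finally have "\<bar>F x - F y\<bar> = \<bar>(num (Phi x) - num (Phi y)) - F y * (den (Phi x) - den (Phi y))\<bar> * (1 + (F x)\<^sup>2)"
    using pos[of x] by (simp add: abs_mult)
  also have "\<dots> \<le> ((4 + 4 * M) * ?d) * (1 + M\<^sup>2)"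
  proof (rule mult_mono)
    have "\<bar>F y * (den (Phi x) - den (Phi y))\<bar> \<le> M * (4 * ?d)"
      unfolding abs_mult using y dd M by (intro mult_mono) auto
    then show "\<bar>(num (Phi x) - num (Phi y)) - F y * (den (Phi x) - den (Phi y))\<bar> \<le> (4 + 4 * M) * ?d"
      using dn by (simp add: algebra_simps)
    have "\<bar>F x\<bar>\<^sup>2 \<le> M\<^sup>2" using x by (intro power_mono) auto
    then show "1 + (F x)\<^sup>2 \<le> 1 + M\<^sup>2" by simp
  qed (use M pos[of x] in auto)
  finally show ?thesis by (simp only: mult_ac)
qed

end

section \<open>Ergodic components\<close>

lemma matrix_mul_uminus:
  fixes A :: "real^'m^'k" and B :: "real^'l^'m"
  shows matrix_mul_uminus_left: "(- A) ** B = - (A ** B)"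
    and matrix_mul_uminus_right: "A ** (- B) = - (A ** B)"
  by (simp_all add: vec_eq_iff matrix_matrix_mult_def sum_negf)

locale charted_limit_map = limit_map G rs xi
  for G :: "(real^2^2) set" and rs :: "'n::finite \<Rightarrow> real^2^2 \<Rightarrow> real^2^2"
    and xi :: "(real^2) set \<Rightarrow> (real^('n + 'n)) set" +
  fixes ca cb cs :: "'n \<Rightarrow> real" and F :: "'n \<Rightarrow> real \<Rightarrow> real"
  assumes chart: "\<And>i. is_chart i (ca i) (cb i) (cs i) (F i)"
    and nonconj: "\<And>i j. i \<noteq> j \<Longrightarrow> \<not> proj_conj G (rs i) (rs j)"
begin

definition conj_rep :: "'n \<Rightarrow> real^2^2 \<Rightarrow> real^2^2" where
  "conj_rep i = chart_rep i (ca i) (cb i) (cs i)"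

lemma F_mono: "strict_mono (F i)" and F_surj: "surj (F i)"
  using chart[of i] by (simp_all add: is_chart_def)

lemma F_inj: "inj (F i)" using F_mono by (rule strict_mono_imp_inj_on)

lemma det_conj_rep: "g \<in> G \<Longrightarrow> det (conj_rep i g) = 1"
  unfolding conj_rep_def by (rule det_chart_rep[OF chart])

lemma conj_rep_den: "g \<in> G \<Longrightarrow> g$2$1 * x + g$2$2 \<noteq> 0 \<longleftrightarrow> conj_rep i g$2$1 * F i x + conj_rep i g$2$2 \<noteq> 0"
  unfolding conj_rep_def by (rule chart_equivariant(1)[OF chart])

lemma conj_rep_mob: "g \<in> G \<Longrightarrow> g$2$1 * x + g$2$2 \<noteq> 0 \<Longrightarrow> F i (mob g x) = mob (conj_rep i g) (F i x)"
  unfolding conj_rep_def by (rule chart_equivariant(2)[OF chart])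

lemma conj_rep_cocompact: "\<exists>C. \<forall>h. det h = 1 \<longrightarrow> (\<exists>g\<in>G. \<exists>c. det c = 1 \<and> (\<forall>j k. \<bar>c$j$k\<bar> \<le> C) \<and> h = conj_rep i g ** c)"
  unfolding conj_rep_def by (rule chart_rep_cocompact[OF chart])

lemma F_image_borel: "X \<in> sets borel \<Longrightarrow> F i ` X \<in> sets borel"
  by (rule strict_mono_surj_image_borel(3)[OF F_mono F_surj])

lemma F_image_Compl: "F i ` (- X) = - (F i ` X)"
  using bij_image_Compl_eq[OF bijI[OF F_inj F_surj]] .

lemma invariant_zero_one:
  assumes X: "X \<in> sets borel"
    and inv: "\<And>g x. g \<in> G \<Longrightarrow> x \<in> X \<Longrightarrow> g$2$1 * x + g$2$2 \<noteq> 0 \<Longrightarrow> mob g x \<in> X"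
  shows "negligible (F i ` X) \<or> negligible (F i ` (- X))"
proof -
  obtain C where C: "\<forall>h. det h = 1 \<longrightarrow> (\<exists>g\<in>G. \<exists>c. det c = 1 \<and> (\<forall>j k. \<bar>c$j$k\<bar> \<le> C) \<and> h = conj_rep i g ** c)"
    using conj_rep_cocompact by blast
  show ?thesis unfolding F_image_Compl
  proof (rule cocompact_invariant_zero_one[where S = "conj_rep i ` G" and C = C])
    show "\<exists>g\<in>conj_rep i ` G. \<exists>c. det c = 1 \<and> (\<forall>j k. \<bar>c$j$k\<bar> \<le> C) \<and> h = g ** c" if "det h = 1" for h
      using C that by blast
    show "F i ` X \<in> sets borel" by (rule F_image_borel[OF X])
    fix h y assume h: "h \<in> conj_rep i ` G" and y: "y \<in> F i ` X" and nz: "h$2$1 * y + h$2$2 \<noteq> 0"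
    obtain g where g: "g \<in> G" "h = conj_rep i g" using h by blast
    obtain x where x: "x \<in> X" "y = F i x" using y by blast
    have gz: "g$2$1 * x + g$2$2 \<noteq> 0" using nz conj_rep_den[OF g(1)] unfolding g x by blast
    have "mob h y = F i (mob g x)" unfolding g x using conj_rep_mob[OF g(1) gz] by simp
    then show "mob h y \<in> F i ` X" using inv[OF g(1) x(1) gz] by simp
  qed
qed

text \<open>Otherwise rigidity makes \<open>F j\<close> an affine function of \<open>F i\<close>.
  The affine matrix \<open>T\<close> intertwines the two representations in chart coordinates up to
  sign, and undoing the charts yields a projective conjugacy.\<close>

lemma separating_set:
  assumes ij: "i \<noteq> j"
  shows "\<exists>D\<in>sets borel. negligible (F i ` (- D)) \<and> negligible (F j ` D)"
proof (rule ccontr)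
  assume ns: "\<not> ?thesis"
  obtain C where C: "\<forall>h. det h = 1 \<longrightarrow> (\<exists>g\<in>G. \<exists>c. det c = 1 \<and> (\<forall>j k. \<bar>c$j$k\<bar> \<le> C) \<and> h = conj_rep i g ** c)"
    using conj_rep_cocompact by blast
  have "\<exists>\<alpha> \<beta>. \<alpha> > 0 \<and> (\<forall>x. F j x = \<alpha> * F i x + \<beta>)"
    by (rule cocompact_homeo_rigidity[OF F_mono[of i] F_surj[of i] F_mono[of j] F_surj[of j] det_conj_rep[where i = j]
        conj_rep_den[where i = i] conj_rep_mob[where i = i] conj_rep_den[where i = j] conj_rep_mob[where i = j] C[rule_format] ns])
  then obtain \<alpha> \<beta> where ab: "\<alpha> > 0" "\<And>x. F j x = \<alpha> * F i x + \<beta>" by blast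
  define T where "T = mat2 \<alpha> \<beta> 0 1"
  define T' where "T' = mat2 (1 / \<alpha>) (- \<beta> / \<alpha>) 0 1"
  have TT: "T ** T' = mat 1" "T' ** T = mat 1"
    unfolding T_def T'_def mat2_mult mat2_one using ab(1) by simp_all
  let ?Mi = "chart_mat (ca i) (cb i) (cs i)" and ?Ni = "chart_inv (ca i) (cb i) (cs i)"
  let ?Mj = "chart_mat (ca j) (cb j) (cs j)" and ?Nj = "chart_inv (ca j) (cb j) (cs j)"
  note inv_i = chart_inverse(1,2)[OF chart[of i]] and inv_j = chart_inverse(1,2)[OF chart[of j]]
  \<comment> \<open>Both products have determinant \<open>\<alpha>\<close> and induce the same map
    away from poles, so they agree up to sign.\<close>
  have intertwine: "conj_rep j g ** T = T ** conj_rep i g \<or> conj_rep j g ** T = - (T ** conj_rep i g)" if g: "g \<in> G" for g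
  proof (rule mob_eq_imp_eq[OF _ _ finite.emptyI])
    show "det (T ** conj_rep i g) = det (conj_rep j g ** T)" "det (T ** conj_rep i g) \<noteq> 0"
      using det_conj_rep[OF g] ab(1) by (simp_all add: det_mul T_def)
    fix y assume nz: "(T ** conj_rep i g)$2$1 * y + (T ** conj_rep i g)$2$2 \<noteq> 0"
    obtain x where x: "y = F i x" using F_surj by (metis surjD)
    have sz: "conj_rep i g$2$1 * F i x + conj_rep i g$2$2 \<noteq> 0" using nz unfolding x by (simp add: matrix_mul_2_nth T_def)
    then have gz: "g$2$1 * x + g$2$2 \<noteq> 0" using conj_rep_den[OF g] by blast
    have T1: "T$2$1 * z + T$2$2 \<noteq> 0" "mob T z = \<alpha> * z + \<beta>" for z by (simp_all add: T_def mob_def)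
    have "mob (T ** conj_rep i g) y = \<alpha> * F i (mob g x) + \<beta>"
      unfolding x mob_mult(2)[OF sz] T1(2) conj_rep_mob[OF g gz] ..
    also have "\<dots> = mob (conj_rep j g) (F j x)" using conj_rep_mob[OF g gz, of j] ab(2) by simp
    also have "\<dots> = mob (conj_rep j g ** T) y" unfolding mob_mult(2)[OF T1(1)] T1(2) x ab(2) ..
    finally show "mob (T ** conj_rep i g) y = mob (conj_rep j g ** T) y" .
  qed
  \<comment> \<open>Into chart \<open>i\<close>, across by \<open>T\<close>, and out of chart
    \<open>j\<close>.\<close>
  define c where "c = ?Nj ** T ** ?Mi"
  define c' where "c' = ?Ni ** T' ** ?Mj"
  have collapse: "A ** B ** (C ** D) = A ** D" if "B ** C = mat 1" for A B C D :: "real^2^2"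
  proof -
    have "A ** B ** (C ** D) = A ** (B ** C) ** D" by (simp only: matrix_mul_assoc)
    then show ?thesis using that by simp
  qed
  have cc: "c ** c' = mat 1" "c' ** c = mat 1"
  proof -
    have "c ** c' = (?Nj ** T ** ?Mi) ** (?Ni ** (T' ** ?Mj))" by (simp only: c_def c'_def matrix_mul_assoc)
    also have "\<dots> = ?Nj ** T ** (T' ** ?Mj)" by (rule collapse[OF inv_i(1)])
    also have "\<dots> = ?Nj ** ?Mj" by (rule collapse[OF TT(1)])
    finally show "c ** c' = mat 1" using inv_j(2) by simp
    have "c' ** c = (?Ni ** T' ** ?Mj) ** (?Nj ** (T ** ?Mi))" by (simp only: c_def c'_def matrix_mul_assoc)
    also have "\<dots> = ?Ni ** T' ** (T ** ?Mi)" by (rule collapse[OF inv_j(1)])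
    also have "\<dots> = ?Ni ** ?Mi" by (rule collapse[OF TT(2)])
    finally show "c' ** c = mat 1" using inv_i(2) by simp
  qed
  have "proj_conj G (rs i) (rs j)"
    unfolding proj_conj_def
  proof (intro exI[of _ c] conjI ballI)
    show "invertible c" unfolding invertible_def using cc by blast
    fix g assume g: "g \<in> G"
    have rsj: "rs j g = ?Nj ** conj_rep j g ** ?Mj"
    proof -
      have "?Nj ** conj_rep j g ** ?Mj = ?Nj ** ?Mj ** (rs j g ** ?Nj ** ?Mj)" by (simp only: conj_rep_def chart_rep_def matrix_mul_assoc)
      also have "\<dots> = rs j g ** (?Nj ** ?Mj)" using inv_j(2) by (simp add: matrix_mul_assoc[symmetric])
      finally show ?thesis using inv_j(2) by simp
    qed
    have "conj_rep j g = (conj_rep j g ** T) ** T'" using TT(1) by (simp add: matrix_mul_assoc[symmetric])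
    then have "conj_rep j g = T ** conj_rep i g ** T' \<or> conj_rep j g = - (T ** conj_rep i g ** T')"
      using intertwine[OF g] matrix_mul_uminus_left by metis
    moreover have "?Nj ** (T ** conj_rep i g ** T') ** ?Mj = c ** rs i g ** c'"
      by (simp only: c_def c'_def conj_rep_def chart_rep_def matrix_mul_assoc)
    moreover have "?Nj ** (- (T ** conj_rep i g ** T')) ** ?Mj = - (?Nj ** (T ** conj_rep i g ** T') ** ?Mj)"
      by (simp only: matrix_mul_uminus_left matrix_mul_uminus_right)
    ultimately show "rs j g = c ** rs i g ** matrix_inv c \<or> rs j g = - (c ** rs i g ** matrix_inv c)"
      unfolding matrix_inv_eqI[OF cc] rsj by metis
  qed
  then show False using nonconj[OF ij] by blast
qed

section \<open>Affine parametrisation of the curve and its null sets\<close>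

lemma xi_span_eq_pt:
  assumes "u$2 \<noteq> 0"
  shows "span {u} = span {pt (u$1 / u$2)}"
proof -
  have "u = (u$2) *\<^sub>R pt (u$1 / u$2)" using assms by (simp add: vec_eq_iff forall_2)
  then show ?thesis using span_singleton_scale[OF assms, of "pt (u$1 / u$2)"] by simp
qed

text \<open>Misses only the point of the curve over infinity, a set of arc length zero. Below,
  subsets of the curve are studied through their preimages under \<open>gx\<close>.\<close>

definition gx :: "real \<Rightarrow> (real^('n + 'n)) set" where
  "gx x = xi (span {pt x})"

lemma xi_RP1_cases:
  assumes "L \<in> xi ` RP1"
  shows "L = xi (span {pinf}) \<or> (\<exists>x. L = gx x)"
proof -
  obtain u where u: "u \<noteq> 0" "L = xi (span {u})" using assms unfolding RP1_eq by blast
  show ?thesis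
  proof (cases "u$2 = 0")
    case True
    then have e: "u = (u$1) *\<^sub>R pinf" by (simp add: vec_eq_iff forall_2)
    then have "u$1 \<noteq> 0" using u(1) by auto
    then have "span {u} = span {pinf}" using e span_singleton_scale[of "u$1" pinf] by simp
    then show ?thesis using u by simp
  next
    case False
    then show ?thesis using xi_span_eq_pt[OF False] u unfolding gx_def by metis
  qed
qed

lemma gx_in: "gx x \<in> xi ` RP1" unfolding gx_def by (intro imageI span_in_RP1) simp

lemma Phi_gx: "Phi x = orthproj (gx x)" by (simp add: Phi_def xi_proj_def gx_def)

lemma subspace_xi: "L \<in> xi ` RP1 \<Longrightarrow> subspace L"
  using xi_in_Lag by (auto simp: Lag_def)

lemma Phi_inj: "Phi x = Phi y \<Longrightarrow> x = y"
proof -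
  assume "Phi x = Phi y"
  \<comment> \<open>\<open>undefined\<close> stands for an arbitrary index; every single chart
    already separates points.\<close>
  then have "F undefined x = F undefined y" using chart_ratio_Phi(2)[OF chart] by metis
  then show ?thesis using F_inj by (metis injD)
qed

lemma gx_mem_iff:
  assumes "A \<subseteq> xi ` RP1"
  shows "gx x \<in> A \<longleftrightarrow> Phi x \<in> orthproj ` A"
proof
  assume "Phi x \<in> orthproj ` A"
  then obtain L where L: "L \<in> A" "orthproj (gx x) = orthproj L" unfolding Phi_gx by blast
  then have "gx x = L" using assms subspace_xi gx_in by (intro orthproj_inj) auto
  then show "gx x \<in> A" using L by simp
qed (auto simp: Phi_gx)

lemma Phi_continuous: "continuous_on UNIV Phi"
  unfolding Phi_def[abs_def] by (rule continuous_on_xi_proj_comp[OF continuous_pt]) (rule pt_nz(1))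

lemma trace_borel:
  assumes "A \<in> lag_sets (xi ` RP1)"
  shows "{x. gx x \<in> A} \<in> sets borel"
proof -
  have A: "A \<subseteq> xi ` RP1" "orthproj ` A \<in> sets borel" using assms by (auto simp: lag_sets_def)
  have "{x. gx x \<in> A} = Phi -` (orthproj ` A)" using gx_mem_iff[OF A(1)] by auto
  then show ?thesis using measurable_sets[OF borel_measurable_continuous_onI[OF Phi_continuous] A(2)] by simp
qed

text \<open>The range of \<open>Phi\<close> is a countable union of compact sets, and on it the
  image of \<open>X\<close> is cut out by the Borel function \<open>chart_ratio\<close>.\<close>

lemma Phi_image_borel:
  assumes X: "X \<in> sets borel"
  shows "Phi ` X \<in> sets borel"
proof -
  obtain i :: 'n where True by blast
  let ?r = "chart_ratio i (ca i) (cb i) (cs i)"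
  have r: "?r (Phi x) = F i x" for x by (rule chart_ratio_Phi(2)[OF chart])
  have entry: "(\<lambda>P. P$r$t) \<in> borel_measurable borel" for r t :: "'n + 'n"
    by (intro borel_measurable_continuous_onI continuous_intros)
  have rm: "?r \<in> borel_measurable borel"
    unfolding chart_ratio_def[abs_def]
    by (intro borel_measurable_divide borel_measurable_add borel_measurable_diff borel_measurable_times borel_measurable_const entry)
  have rangeb: "range Phi \<in> sets borel"
  proof -
    have "range Phi = (\<Union>n::nat. Phi ` {- real n..real n})"
    proof (intro set_eqI iffI)
      fix y assume "y \<in> range Phi"
      then obtain x where x: "y = Phi x" by blast
      obtain k :: nat where "\<bar>x\<bar> \<le> real k" using real_arch_simple[of "\<bar>x\<bar>"] by (elim exE)
      then have "y \<in> Phi ` {- real k..real k}" unfolding x by (intro imageI) (simp add: abs_le_iff)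
      then show "y \<in> (\<Union>n::nat. Phi ` {- real n..real n})" by (rule UN_I[OF UNIV_I])
    qed blast
    moreover have "Phi ` {- real n..real n} \<in> sets borel" for n
      using compact_continuous_image[OF continuous_on_subset[OF Phi_continuous subset_UNIV] compact_Icc]
      by (intro borel_closed compact_imp_closed)
    ultimately show ?thesis by simp
  qed
  have "Phi ` X = range Phi \<inter> ?r -` (F i ` X)"
  proof (intro set_eqI iffI)
    fix y assume "y \<in> range Phi \<inter> ?r -` (F i ` X)"
    then obtain x x' where "y = Phi x" "F i x = F i x'" "x' \<in> X" using r by auto
    then show "y \<in> Phi ` X" using F_inj by (metis imageI injD)
  qed (auto simp: r)
  then show ?thesis using rangeb measurable_sets[OF rm F_image_borel[OF X]] by simp
qed

text \<open>Each chart coordinate is Lipschitz in the projection on the sets where it is bounded by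
  \<open>n\<close>; this gives one direction. For the other, the projection is Lipschitz in the sum
  of all coordinates, and the point over infinity is covered separately.\<close>

lemma lag_measure_zero_iff:
  assumes A: "A \<subseteq> xi ` RP1"
  shows "lag_measure (xi ` RP1) A = 0 \<longleftrightarrow> (\<forall>i. negligible (F i ` {x. gx x \<in> A}))"
proof
  let ?X = "{x. gx x \<in> A}"
  have m: "lag_measure (xi ` RP1) A = hausdorff1 (orthproj ` A)"
    using A by (simp add: lag_measure_def Int_absorb2)
  {
    assume z: "lag_measure (xi ` RP1) A = 0"
    show "\<forall>i. negligible (F i ` ?X)"
    proof
      fix i
      have "negligible (F i ` (?X \<inter> {x. \<bar>F i x\<bar> \<le> real n}))" for n
      proof (rule hausdorff1_zero_imp_negligible)
        show "hausdorff1 (Phi ` (?X \<inter> {x. \<bar>F i x\<bar> \<le> real n})) = 0"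
          by (rule hausdorff1_zero_mono[OF z[unfolded m]]) (auto simp: Phi_gx)
        show "0 \<le> (1 + (real n)\<^sup>2) * (4 + 4 * real n)" by simp
        show "\<bar>F i x - F i y\<bar> \<le> (1 + (real n)\<^sup>2) * (4 + 4 * real n) * dist (Phi x) (Phi y)"
          if "x \<in> ?X \<inter> {x. \<bar>F i x\<bar> \<le> real n}" "y \<in> ?X \<inter> {x. \<bar>F i x\<bar> \<le> real n}" for x y
          by (rule chart_locally_lipschitz[OF chart]) (use that in auto)
      qed
      then have "negligible (\<Union>n. F i ` (?X \<inter> {x. \<bar>F i x\<bar> \<le> real n}))"
        by (intro negligible_countable_Union countable_image) auto
      moreover have "F i ` ?X \<subseteq> (\<Union>n. F i ` (?X \<inter> {x. \<bar>F i x\<bar> \<le> real n}))"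
      proof
        fix y assume "y \<in> F i ` ?X"
        then obtain x where x: "x \<in> ?X" "y = F i x" by blast
        obtain k :: nat where "\<bar>F i x\<bar> \<le> real k" using real_arch_simple[of "\<bar>F i x\<bar>"] by (elim exE)
        then have "y \<in> F i ` (?X \<inter> {x. \<bar>F i x\<bar> \<le> real k})" using x by blast
        then show "y \<in> (\<Union>n. F i ` (?X \<inter> {x. \<bar>F i x\<bar> \<le> real n}))" by (rule UN_I[OF UNIV_I])
      qed
      ultimately show "negligible (F i ` ?X)" by (rule negligible_subset)
    qed
  next
    assume neg: "\<forall>i. negligible (F i ` ?X)"
    obtain K where K: "K \<ge> 0" "\<forall>x y. dist (Phi x) (Phi y) \<le> K * (\<Sum>i\<in>UNIV. \<bar>F i x - F i y\<bar>)"
      using Phi_lipschitz[OF chart] by blast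
    have "hausdorff1 (orthproj ` A) = 0"
    proof (rule negligible_imp_hausdorff1_zero[of F K Phi ?X _ "orthproj (xi (span {pinf}))"])
      show "orthproj ` A \<subseteq> insert (orthproj (xi (span {pinf}))) (Phi ` ?X)"
      proof
        fix P assume "P \<in> orthproj ` A"
        then obtain L where L: "L \<in> A" "P = orthproj L" by blast
        from xi_RP1_cases[of L] A L(1) have "L = xi (span {pinf}) \<or> (\<exists>x. L = gx x)" by blast
        then show "P \<in> insert (orthproj (xi (span {pinf}))) (Phi ` ?X)" using L by (auto simp: Phi_gx)
      qed
    qed (use F_mono F_surj K neg in auto)
    then show "lag_measure (xi ` RP1) A = 0" using m by simp
  }
qed

section \<open>Strictly invariant sets of full measure\<close>

lemma countable_G: "countable G"
proof -
  have "discrete_set G" using sg unfolding surface_group_def by (elim conjE)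
  then show ?thesis by (rule countable_discrete_set)
qed

lemma mob_set_borel:
  assumes "Z \<in> sets borel"
  shows "{x. M$2$1 * x + M$2$2 \<noteq> 0 \<and> mob M x \<in> Z} \<in> sets borel"
proof -
  have m: "mob M \<in> borel_measurable borel" unfolding mob_def[abs_def] by measurable
  have "{x :: real. M$2$1 * x + M$2$2 \<noteq> 0} \<in> sets borel" by measurable
  moreover have "mob M -` Z \<in> sets borel" using measurable_sets[OF m assms] by simp
  moreover have "{x. M$2$1 * x + M$2$2 \<noteq> 0 \<and> mob M x \<in> Z} = {x. M$2$1 * x + M$2$2 \<noteq> 0} \<inter> mob M -` Z" by auto
  ultimately show ?thesis by simp
qed

lemma mob_inv:
  assumes g: "g \<in> G" and nz: "g$2$1 * x + g$2$2 \<noteq> 0"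
  shows "matrix_inv g$2$1 * mob g x + matrix_inv g$2$2 \<noteq> 0" "mob (matrix_inv g) (mob g x) = x"
proof -
  have e: "matrix_inv g ** g = mat2 1 0 0 1" using inv_G_mult(1)[OF g] mat2_one by simp
  show "matrix_inv g$2$1 * mob g x + matrix_inv g$2$2 \<noteq> 0"
    using mob_mult(1)[OF nz, of "matrix_inv g"] unfolding e by auto
  show "mob (matrix_inv g) (mob g x) = x"
    using mob_mult(2)[OF nz, of "matrix_inv g"] unfolding e by (simp add: mob_def[of "mat2 1 0 0 1"])
qed

text \<open>The exceptional set consists of the pole and of the preimage of \<open>Z\<close>. In the
  chart this preimage is an image under the inverse group element, a differentiable map, and such
  maps keep null sets null. The form of the set is that of one factor in the complement of
  \<open>invariant_core\<close>.\<close>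

lemma negligible_mob_preimage:
  assumes g: "g \<in> G" and Z: "negligible (F i ` Z)"
  shows "negligible (F i ` {x. \<not> (g$2$1 * x + g$2$2 \<noteq> 0 \<and> mob g x \<notin> Z)})"
proof -
  let ?g = "matrix_inv g"
  let ?W = "{y \<in> F i ` Z. conj_rep i ?g$2$1 * y + conj_rep i ?g$2$2 \<noteq> 0}"
  have g': "?g \<in> G" by (rule inv_G[OF g])
  have "negligible ?W" using Z by (rule negligible_subset) auto
  then have 1: "negligible (mob (conj_rep i ?g) ` ?W)"
    by (rule negligible_differentiable_image_negligible[OF order_refl]) (rule mob_differentiable_on, simp)
  have "finite {x. g$2$1 * x + g$2$2 = 0}"
  proof -
    have "g$2$1 \<noteq> 0 \<or> g$2$2 \<noteq> 0" using det_G[OF g] by (auto simp: det_2)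
    then have "[:g$2$2, g$2$1:] \<noteq> 0" by auto
    then have "finite {x. poly [:g$2$2, g$2$1:] x = 0}" by (rule poly_roots_finite)
    then show ?thesis by (simp add: algebra_simps)
  qed
  then have 2: "negligible (F i ` {x. g$2$1 * x + g$2$2 = 0})" by (intro negligible_finite finite_imageI)
  show ?thesis
  proof (rule negligible_subset[OF negligible_Un[OF 1 2]], rule image_subsetI)
    fix x assume x: "x \<in> {x. \<not> (g$2$1 * x + g$2$2 \<noteq> 0 \<and> mob g x \<notin> Z)}"
    show "F i x \<in> mob (conj_rep i ?g) ` ?W \<union> F i ` {x. g$2$1 * x + g$2$2 = 0}"
    proof (cases "g$2$1 * x + g$2$2 = 0")
      case True
      then show ?thesis by blast
    next
      case False
      then have z: "mob g x \<in> Z" using x by blast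
      note inv = mob_inv[OF g False]
      have "F i x = mob (conj_rep i ?g) (F i (mob g x))" using conj_rep_mob[OF g' inv(1), of i] inv(2) by simp
      moreover have "F i (mob g x) \<in> ?W" using z inv(1) conj_rep_den[OF g', of "mob g x" i] by blast
      ultimately show ?thesis by blast
    qed
  qed
qed

lemma act_gx:
  assumes g: "g \<in> G" and nz: "g$2$1 * x + g$2$2 \<noteq> 0"
  shows "act (rho_diag rs g) (gx x) = gx (mob g x)"
proof -
  have "g *v pt x = (g$2$1 * x + g$2$2) *\<^sub>R pt (mob g x)"
    using nz unfolding vec_eq_iff forall_2 by (simp add: matrix_vector_mult_2 mob_def)
  then have "span {g *v pt x} = span {pt (mob g x)}" using span_singleton_scale[OF nz] by simp
  then show ?thesis unfolding gx_def using xi_act[OF g pt_nz(1), of x] by simp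
qed

lemma gx_inj: "gx x = gx y \<Longrightarrow> x = y"
  by (rule Phi_inj) (simp add: Phi_gx)

text \<open>The nonvanishing condition removes the orbit of \<open>\<infinity>\<close>, so that the result is strictly invariant.\<close>
definition invariant_core :: "real set \<Rightarrow> real set" where
  "invariant_core X0 = {x. \<forall>g\<in>G. g$2$1 * x + g$2$2 \<noteq> 0 \<and> mob g x \<in> X0}"

lemma invariant_core_subset: "invariant_core X0 \<subseteq> X0"
proof
  fix x assume "x \<in> invariant_core X0"
  then have "mob (mat 1) x \<in> X0" using one_G unfolding invariant_core_def by blast
  then show "x \<in> X0" by (simp add: mob_def mat_def)
qed

lemma invariant_core_borel: "X0 \<in> sets borel \<Longrightarrow> invariant_core X0 \<in> sets borel"
proof -
  assume X0: "X0 \<in> sets borel"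
  have "invariant_core X0 = (\<Inter>g\<in>G. {x. g$2$1 * x + g$2$2 \<noteq> 0 \<and> mob g x \<in> X0})"
    unfolding invariant_core_def by blast
  also have "\<dots> \<in> sets borel"
    using countable_G one_G mob_set_borel[OF X0] by (intro sets.countable_INT') auto
  finally show ?thesis .
qed

lemma invariant_core_mob:
  assumes x: "x \<in> invariant_core X0" and g: "g \<in> G"
  shows "g$2$1 * x + g$2$2 \<noteq> 0" "mob g x \<in> invariant_core X0"
proof -
  show nz: "g$2$1 * x + g$2$2 \<noteq> 0" using x g unfolding invariant_core_def by blast
  show "mob g x \<in> invariant_core X0"
    unfolding invariant_core_def
  proof (intro CollectI ballI)
    fix h assume h: "h \<in> G"
    have "(h ** g)$2$1 * x + (h ** g)$2$2 \<noteq> 0 \<and> mob (h ** g) x \<in> X0"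
      using x mult_G[OF h g] unfolding invariant_core_def by blast
    then show "h$2$1 * mob g x + h$2$2 \<noteq> 0 \<and> mob h (mob g x) \<in> X0"
      unfolding mob_mult(1)[OF nz] mob_mult(2)[OF nz] by simp
  qed
qed

text \<open>The complement is a union of exceptional sets over the countable group.\<close>

lemma invariant_core_conull:
  assumes "negligible (F i ` (- X0))"
  shows "negligible (F i ` (- invariant_core X0))"
proof -
  have "- invariant_core X0 = (\<Union>g\<in>G. {x. \<not> (g$2$1 * x + g$2$2 \<noteq> 0 \<and> mob g x \<notin> - X0)})"
    unfolding invariant_core_def by blast
  then have "F i ` (- invariant_core X0) = (\<Union>g\<in>G. F i ` {x. \<not> (g$2$1 * x + g$2$2 \<noteq> 0 \<and> mob g x \<notin> - X0)})"
    by (simp only: image_UN)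
  moreover have "negligible (\<Union>g\<in>G. F i ` {x. \<not> (g$2$1 * x + g$2$2 \<noteq> 0 \<and> mob g x \<notin> - X0)})"
    using countable_G negligible_mob_preimage[OF _ assms]
    by (intro negligible_countable_Union countable_image) blast+
  ultimately show ?thesis by (simp only:)
qed

lemma act_image_core:
  assumes g: "g \<in> G"
  shows "act (rho_diag rs g) ` gx ` invariant_core X0 = gx ` invariant_core X0"
proof (intro set_eqI iffI)
  fix L assume "L \<in> act (rho_diag rs g) ` gx ` invariant_core X0"
  then obtain x where x: "x \<in> invariant_core X0" "L = act (rho_diag rs g) (gx x)" by blast
  then show "L \<in> gx ` invariant_core X0"
    using act_gx[OF g invariant_core_mob(1)[OF x(1) g]] invariant_core_mob(2)[OF x(1) g] by simp
next
  fix L assume "L \<in> gx ` invariant_core X0"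
  then obtain x where x: "x \<in> invariant_core X0" "L = gx x" by blast
  have g': "matrix_inv g \<in> G" by (rule inv_G[OF g])
  define y where "y = mob (matrix_inv g) x"
  have y: "y \<in> invariant_core X0" unfolding y_def by (rule invariant_core_mob(2)[OF x(1) g'])
  have nz: "matrix_inv g$2$1 * x + matrix_inv g$2$2 \<noteq> 0" by (rule invariant_core_mob(1)[OF x(1) g'])
  have "g ** matrix_inv g = mat2 1 0 0 1" using inv_G_mult(2)[OF g] mat2_one by simp
  then have "mob g y = x" using mob_mult(2)[OF nz, of g] by (simp add: y_def mob_def[of "mat2 1 0 0 1"])
  then have "L = act (rho_diag rs g) (gx y)" using act_gx[OF g invariant_core_mob(1)[OF y g]] x(2) by simp
  then show "L \<in> act (rho_diag rs g) ` gx ` invariant_core X0" using y by blast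
qed

lemma trace_invariant:
  assumes A: "\<forall>t\<in>(\<lambda>g. act (rho_diag rs g)) ` G. t ` A = A"
    and x: "gx x \<in> A" and g: "g \<in> G" and nz: "g$2$1 * x + g$2$2 \<noteq> 0"
  shows "gx (mob g x) \<in> A"
proof -
  have "act (rho_diag rs g) ` A = A" using A g by blast
  then have "act (rho_diag rs g) (gx x) \<in> A" using x by blast
  then show ?thesis unfolding act_gx[OF g nz] .
qed

text \<open>\<open>D i j\<close> has full measure for \<open>F i\<close> and is null for
  \<open>F j\<close>. Removing \<open>D j i\<close> keeps this and makes the sets for
  \<open>i\<close> and \<open>j\<close> disjoint.\<close>

lemma exists_separated_sets:
  "\<exists>X0 :: 'n \<Rightarrow> real set. (\<forall>i. X0 i \<in> sets borel) \<and> (\<forall>i. negligible (F i ` (- X0 i))) \<and>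
    (\<forall>i j. i \<noteq> j \<longrightarrow> negligible (F j ` X0 i) \<and> X0 i \<inter> X0 j = {})"
proof -
  have "\<forall>i j. \<exists>D. i \<noteq> j \<longrightarrow> D \<in> sets borel \<and> negligible (F i ` (- D)) \<and> negligible (F j ` D)"
    using separating_set by blast
  then obtain D where D: "\<And>i j. i \<noteq> j \<Longrightarrow> D i j \<in> sets borel \<and> negligible (F i ` (- D i j)) \<and> negligible (F j ` D i j)"
    by metis
  define X0 where "X0 i = (\<Inter>j\<in>- {i}. D i j - D j i)" for i
  have "X0 i \<in> sets borel" for i
  proof (cases "- {i} = {}")
    case True
    then show ?thesis by (simp add: X0_def)
  next
    case False
    then show ?thesis unfolding X0_def using D by (intro sets.finite_INT sets.Diff) auto
  qed
  moreover have "negligible (F i ` (- X0 i))" for i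
  proof -
    have "F i ` (- X0 i) = (\<Union>j\<in>- {i}. F i ` (- D i j) \<union> F i ` (D j i))" unfolding X0_def by blast
    moreover have "negligible (\<Union>j\<in>- {i}. F i ` (- D i j) \<union> F i ` (D j i))"
      using D by (intro negligible_Union) (auto intro!: negligible_Un)
    ultimately show ?thesis by (simp only:)
  qed
  moreover have "negligible (F j ` X0 i)" if "i \<noteq> j" for i j
    by (rule negligible_subset[of "F j ` D i j"]) (use D that in \<open>auto simp: X0_def\<close>)
  moreover have "X0 i \<inter> X0 j = {}" if "i \<noteq> j" for i j using that unfolding X0_def by blast
  ultimately show ?thesis by blast
qed

text \<open>On the \<open>i\<close>-th component every other \<open>F j\<close> sees only null sets,
  so whether a piece has arc length zero is decided by \<open>F i\<close> alone, where the zero-one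
  law applies.\<close>

theorem ergodic_components_lag:
  "ergodic_components (lag_measure (xi ` RP1)) (lag_sets (xi ` RP1)) (xi ` RP1)
     ((\<lambda>g. act (rho_diag rs g)) ` G) CARD('n)"
proof -
  let ?C = "xi ` RP1"
  let ?T = "(\<lambda>g. act (rho_diag rs g)) ` G"
  obtain X0 :: "'n \<Rightarrow> real set" where X0: "\<And>i. X0 i \<in> sets borel" "\<And>i. negligible (F i ` (- X0 i))"
    "\<And>i j. i \<noteq> j \<Longrightarrow> negligible (F j ` X0 i)" "\<And>i j. i \<noteq> j \<Longrightarrow> X0 i \<inter> X0 j = {}"
    using exists_separated_sets by metis
  define X where "X i = invariant_core (X0 i)" for i
  have XX0: "X i \<subseteq> X0 i" for i unfolding X_def by (rule invariant_core_subset)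
  have Xb: "X i \<in> sets borel" for i unfolding X_def by (rule invariant_core_borel[OF X0(1)])
  have Xfull: "negligible (F i ` (- X i))" for i unfolding X_def by (rule invariant_core_conull[OF X0(2)])
  have Xnull: "negligible (F j ` X i)" if "i \<noteq> j" for i j
    by (rule negligible_subset[OF X0(3)[OF that]]) (rule image_mono[OF XX0])
  define E where "E i = gx ` X i" for i
  have EC: "E i \<subseteq> ?C" for i unfolding E_def using gx_in by blast
  have tr: "{x. gx x \<in> E i} = X i" for i unfolding E_def using gx_inj by blast
  have Eset: "E i \<in> lag_sets ?C" for i
  proof -
    have "orthproj ` E i = Phi ` X i" unfolding E_def by (simp add: image_image Phi_gx)
    then show ?thesis unfolding lag_sets_def using EC Phi_image_borel[OF Xb] by simp
  qed
  have Einv: "t ` E i = E i" if "t \<in> ?T" for t i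
    using that act_image_core unfolding E_def X_def by blast
  have Epos: "lag_measure ?C (E i) > 0" for i
  proof (rule ccontr)
    assume "\<not> ?thesis"
    then have "lag_measure ?C (E i) = 0" by simp
    then have "negligible (F i ` X i)" using lag_measure_zero_iff[OF EC, of i] unfolding tr by blast
    then have "negligible (F i ` X i \<union> F i ` (- X i))" using Xfull by (rule negligible_Un)
    moreover have "F i ` X i \<union> F i ` (- X i) = UNIV" unfolding F_image_Compl by blast
    ultimately have "negligible (UNIV :: real set)" by simp
    then show False by simp
  qed
  have Eerg: "lag_measure ?C A = 0 \<or> lag_measure ?C (E i - A) = 0"
    if A: "A \<in> lag_sets ?C" "A \<subseteq> E i" "\<forall>t\<in>?T. t ` A = A" for A i
  proof -
    have AC: "A \<subseteq> ?C" using A(2) EC by blast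
    let ?Y = "{x. gx x \<in> A}"
    have Ysub: "?Y \<subseteq> X i" using A(2) tr by blast
    have "negligible (F i ` ?Y) \<or> negligible (F i ` (- ?Y))"
    proof (rule invariant_zero_one[OF trace_borel[OF A(1)]])
      show "mob g x \<in> ?Y" if "g \<in> G" "x \<in> ?Y" "g$2$1 * x + g$2$2 \<noteq> 0" for g x
        unfolding mem_Collect_eq by (rule trace_invariant[OF A(3) that(2)[unfolded mem_Collect_eq] that(1,3)])
    qed
    then show ?thesis
    proof
      assume "negligible (F i ` ?Y)"
      then have "negligible (F j ` ?Y)" for j
      proof (cases "i = j")
        case False
        show ?thesis by (rule negligible_subset[OF Xnull[OF False] image_mono[OF Ysub]])
      qed simp
      then have "lag_measure ?C A = 0" unfolding lag_measure_zero_iff[OF AC] by (rule allI)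
      then show ?thesis by (rule disjI1)
    next
      assume n: "negligible (F i ` (- ?Y))"
      have Z: "{x. gx x \<in> E i - A} = X i - ?Y" using tr by blast
      have "negligible (F j ` (X i - ?Y))" for j
      proof (cases "i = j")
        case True
        then show ?thesis using negligible_subset[OF n, of "F i ` (X i - ?Y)"] by blast
      next
        case False
        show ?thesis by (rule negligible_subset[OF Xnull[OF False]]) blast
      qed
      moreover have "E i - A \<subseteq> ?C" using EC by blast
      ultimately have "lag_measure ?C (E i - A) = 0" using lag_measure_zero_iff[of "E i - A"] unfolding Z by simp
      then show ?thesis by (rule disjI2)
    qed
  qed
  have Edisj: "E i \<inter> E j = {}" if "i \<noteq> j" for i j
  proof (rule ccontr)
    assume "E i \<inter> E j \<noteq> {}"
    then obtain x y where xy: "x \<in> X i" "y \<in> X j" "gx x = gx y" unfolding E_def by blast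
    then have "x = y" using gx_inj by blast
    then show False using xy XX0 X0(4)[OF that] by blast
  qed
  \<comment> \<open>For each \<open>j\<close> the rest already misses \<open>X j\<close>, which has
    full measure for \<open>F j\<close>.\<close>
  have Erest: "lag_measure ?C (?C - (\<Union>i. E i)) = 0"
  proof -
    have "negligible (F j ` {x. gx x \<in> ?C - (\<Union>i. E i)})" for j
    proof (rule negligible_subset[OF Xfull[of j]], rule image_mono, rule subsetI)
      fix x assume "x \<in> {x. gx x \<in> ?C - (\<Union>i. E i)}"
      then show "x \<in> - X j" unfolding E_def by blast
    qed
    moreover have "?C - (\<Union>i. E i) \<subseteq> ?C" by (rule Diff_subset)
    ultimately show ?thesis using lag_measure_zero_iff[of "?C - (\<Union>i. E i)"] by simp
  qed
  obtain h :: "nat \<Rightarrow> 'n" where h: "bij_betw h {0..<CARD('n)} UNIV"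
    using ex_bij_betw_nat_finite[of "UNIV :: 'n set"] by auto
  have hinj: "h i \<noteq> h j" if "i < CARD('n)" "j < CARD('n)" "i \<noteq> j" for i j
    using h that unfolding bij_betw_def inj_on_def by auto
  have hU: "h ` {..<CARD('n)} = UNIV" using h by (simp add: bij_betw_def lessThan_atLeast0)
  have "(\<Union>i<CARD('n). E (h i)) = (\<Union>i\<in>h ` {..<CARD('n)}. E i)" by blast
  then have U: "(\<Union>i<CARD('n). E (h i)) = (\<Union>i. E i)" unfolding hU .
  show ?thesis
    unfolding ergodic_components_def
  proof (rule exI[of _ "\<lambda>k. E (h k)"], intro conjI allI impI ballI)
    show "lag_measure ?C (?C - (\<Union>i<CARD('n). E (h i))) = 0" unfolding U by (rule Erest)
    show "E (h i) \<inter> E (h j) = {}" if "i < CARD('n)" "j < CARD('n)" "i \<noteq> j" for i j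
      by (rule Edisj[OF hinj[OF that]])
    fix i
    show "E (h i) \<in> lag_sets ?C" "E (h i) \<subseteq> ?C" "lag_measure ?C (E (h i)) > 0" by (rule Eset EC Epos)+
    show "t ` E (h i) = E (h i)" if "t \<in> ?T" for t by (rule Einv[OF that])
    show "lag_measure ?C A = 0 \<or> lag_measure ?C (E (h i) - A) = 0"
      if "A \<in> lag_sets ?C" "A \<subseteq> E (h i) \<and> (\<forall>t\<in>?T. t ` A = A)" for A
      using Eerg[of A "h i"] that by blast
  qed
qed

end

theorem theoremC1:
  fixes G :: "(real^2^2) set"
    and rs :: "'n::finite \<Rightarrow> real^2^2 \<Rightarrow> real^2^2"
    and xi :: "(real^2) set \<Rightarrow> (real^('n + 'n)) set"
  assumes "surface_group G"
    and "\<forall>i. fuchsian_rep G (rs i)"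
    and "\<forall>i j. i \<noteq> j \<longrightarrow> \<not> proj_conj G (rs i) (rs j)"
    and "positive_limit_map G (rho_diag rs) xi"
  shows "ergodic_components (lag_measure (xi ` RP1)) (lag_sets (xi ` RP1)) (xi ` RP1)
           ((\<lambda>g. act (rho_diag rs g)) ` G) CARD('n)"
proof -
  interpret limit_map G rs xi using assms by unfold_locales auto
  obtain ca cb cs F where "\<And>i. is_chart i (ca i) (cb i) (cs i) (F i)" using ex_chart by metis
  then interpret charted_limit_map G rs xi ca cb cs F using assms by unfold_locales auto
  show ?thesis by (rule ergodic_components_lag)
qed

end
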